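(* Let $\mathcal{E}$ be a topos with a representable point $p:\mathcal{E}ns\to\mathcal{E}$, i.e. a point whose inverse image functor is $p^{*}=[A,-]$ for some object $A\in\mathcal{E}$. Then $\mathcal{E}$ is connected atomic if and only if it is (equivalent to) the classifying topos $\mathcal{B}G$ of a discrete group $G$; and this group can be taken to be $G = Aut(A)^{op}$.
   Context: $\mathcal{E}ns$ is the category of sets; topos means Grothendieck topos over $\mathcal{E}ns$. $[A,-]$ is the hom functor $\mathcal{E}(A,-)$. A connected atomic topos is a connected, locally connected and boolean topos. For a discrete group $G$, $\mathcal{B}G$ is the category of sets with an action of $G$. $Aut(A)^{op}$ is the automorphism group of $A$ in $\mathcal{E}$ with opposite multiplication. *)

theory Defs
  imports "HOL-Library.FuncSet" "HOL-Library.Equipollence" "HOL-Algebra.Group_Action"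
begin

section \<open>Categories, functors, natural transformations\<close>

text \<open>Hom-sets of different pairs of objects need not be disjoint, so composition takes the
  objects as arguments: \<open>Cmp C a b c g f\<close> is the composite of \<open>f : a \<rightarrow> b\<close> followed by
  \<open>g : b \<rightarrow> c\<close>.\<close>

record ('o, 'm) cat =
  Ob :: "'o set"
  Hom :: "'o \<Rightarrow> 'o \<Rightarrow> 'm set"
  Ident :: "'o \<Rightarrow> 'm"
  Cmp :: "'o \<Rightarrow> 'o \<Rightarrow> 'o \<Rightarrow> 'm \<Rightarrow> 'm \<Rightarrow> 'm"

definition category :: "('o, 'm) cat \<Rightarrow> bool" where
  "category C \<longleftrightarrow>
     (\<forall>a\<in>Ob C. Ident C a \<in> Hom C a a) \<and>
     (\<forall>a\<in>Ob C. \<forall>b\<in>Ob C. \<forall>c\<in>Ob C. \<forall>f\<in>Hom C a b. \<forall>g\<in>Hom C b c. Cmp C a b c g f \<in> Hom C a c) \<and>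
     (\<forall>a\<in>Ob C. \<forall>b\<in>Ob C. \<forall>f\<in>Hom C a b.
        Cmp C a a b f (Ident C a) = f \<and> Cmp C a b b (Ident C b) f = f) \<and>
     (\<forall>a\<in>Ob C. \<forall>b\<in>Ob C. \<forall>c\<in>Ob C. \<forall>d\<in>Ob C. \<forall>f\<in>Hom C a b. \<forall>g\<in>Hom C b c. \<forall>h\<in>Hom C c d.
        Cmp C a c d h (Cmp C a b c g f) = Cmp C a b d (Cmp C b c d h g) f)"

definition is_iso :: "('o, 'm) cat \<Rightarrow> 'o \<Rightarrow> 'o \<Rightarrow> 'm \<Rightarrow> bool" where
  "is_iso C a b f \<longleftrightarrow> f \<in> Hom C a b \<and>
     (\<exists>g\<in>Hom C b a. Cmp C a b a g f = Ident C a \<and> Cmp C b a b f g = Ident C b)"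

definition is_mono :: "('o, 'm) cat \<Rightarrow> 'o \<Rightarrow> 'o \<Rightarrow> 'm \<Rightarrow> bool" where
  "is_mono C a b m \<longleftrightarrow> m \<in> Hom C a b \<and>
     (\<forall>x\<in>Ob C. \<forall>f\<in>Hom C x a. \<forall>g\<in>Hom C x a. Cmp C x a b m f = Cmp C x a b m g \<longrightarrow> f = g)"

definition op_cat :: "('o, 'm) cat \<Rightarrow> ('o, 'm) cat" where
  "op_cat C = \<lparr>Ob = Ob C, Hom = (\<lambda>a b. Hom C b a), Ident = Ident C,
     Cmp = (\<lambda>a b c g f. Cmp C c b a f g)\<rparr>"

record ('o, 'm, 'p, 'n) fctr =
  FOb :: "'o \<Rightarrow> 'p"
  FMor :: "'o \<Rightarrow> 'o \<Rightarrow> 'm \<Rightarrow> 'n"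

definition is_functor :: "('o, 'm) cat \<Rightarrow> ('p, 'n) cat \<Rightarrow> ('o, 'm, 'p, 'n) fctr \<Rightarrow> bool" where
  "is_functor C D F \<longleftrightarrow>
     (\<forall>a\<in>Ob C. FOb F a \<in> Ob D) \<and>
     (\<forall>a\<in>Ob C. \<forall>b\<in>Ob C. \<forall>f\<in>Hom C a b. FMor F a b f \<in> Hom D (FOb F a) (FOb F b)) \<and>
     (\<forall>a\<in>Ob C. FMor F a a (Ident C a) = Ident D (FOb F a)) \<and>
     (\<forall>a\<in>Ob C. \<forall>b\<in>Ob C. \<forall>c\<in>Ob C. \<forall>f\<in>Hom C a b. \<forall>g\<in>Hom C b c.
        FMor F a c (Cmp C a b c g f) =
          Cmp D (FOb F a) (FOb F b) (FOb F c) (FMor F b c g) (FMor F a b f))"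

definition id_fctr :: "('o, 'm, 'o, 'm) fctr" where
  "id_fctr = \<lparr>FOb = (\<lambda>a. a), FMor = (\<lambda>a b f. f)\<rparr>"

definition comp_fctr ::
  "('p, 'n, 'q, 'k) fctr \<Rightarrow> ('o, 'm, 'p, 'n) fctr \<Rightarrow> ('o, 'm, 'q, 'k) fctr" where
  "comp_fctr G F = \<lparr>FOb = (\<lambda>a. FOb G (FOb F a)),
     FMor = (\<lambda>a b f. FMor G (FOb F a) (FOb F b) (FMor F a b f))\<rparr>"

definition full_functor :: "('o, 'm) cat \<Rightarrow> ('p, 'n) cat \<Rightarrow> ('o, 'm, 'p, 'n) fctr \<Rightarrow> bool" where
  "full_functor C D F \<longleftrightarrow>
     (\<forall>a\<in>Ob C. \<forall>b\<in>Ob C. Hom D (FOb F a) (FOb F b) \<subseteq> FMor F a b ` Hom C a b)"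

definition faithful_functor :: "('o, 'm) cat \<Rightarrow> ('o, 'm, 'p, 'n) fctr \<Rightarrow> bool" where
  "faithful_functor C F \<longleftrightarrow> (\<forall>a\<in>Ob C. \<forall>b\<in>Ob C. inj_on (FMor F a b) (Hom C a b))"

definition nat_trans ::
  "('o, 'm) cat \<Rightarrow> ('p, 'n) cat \<Rightarrow> ('o, 'm, 'p, 'n) fctr \<Rightarrow> ('o, 'm, 'p, 'n) fctr \<Rightarrow> ('o \<Rightarrow> 'n) \<Rightarrow> bool"
  where
  "nat_trans C D F G \<tau> \<longleftrightarrow>
     (\<forall>a\<in>Ob C. \<tau> a \<in> Hom D (FOb F a) (FOb G a)) \<and>
     (\<forall>a\<in>Ob C. \<forall>b\<in>Ob C. \<forall>f\<in>Hom C a b.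
        Cmp D (FOb F a) (FOb F b) (FOb G b) (\<tau> b) (FMor F a b f) =
        Cmp D (FOb F a) (FOb G a) (FOb G b) (FMor G a b f) (\<tau> a))"

definition naturally_iso ::
  "('o, 'm) cat \<Rightarrow> ('p, 'n) cat \<Rightarrow> ('o, 'm, 'p, 'n) fctr \<Rightarrow> ('o, 'm, 'p, 'n) fctr \<Rightarrow> bool" where
  "naturally_iso C D F G \<longleftrightarrow>
     (\<exists>\<tau>. nat_trans C D F G \<tau> \<and> (\<forall>a\<in>Ob C. is_iso D (FOb F a) (FOb G a) (\<tau> a)))"

definition equivalent_cat :: "('o, 'm) cat \<Rightarrow> ('p, 'n) cat \<Rightarrow> bool" where
  "equivalent_cat C D \<longleftrightarrow> category C \<and> category D \<and>
     (\<exists>F G. is_functor C D F \<and> is_functor D C G \<and>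
        naturally_iso C C (comp_fctr G F) id_fctr \<and> naturally_iso D D (comp_fctr F G) id_fctr)"

text \<open>Arrows of a functor category are extensional, so that equality of arrows is equality of
  all components.\<close>

definition functor_cat ::
  "('o, 'm) cat \<Rightarrow> ('p, 'n) cat \<Rightarrow> (('o, 'm, 'p, 'n) fctr, 'o \<Rightarrow> 'n) cat" where
  "functor_cat C D =
     \<lparr>Ob = {F. is_functor C D F},
      Hom = (\<lambda>F G. {\<tau>. nat_trans C D F G \<tau>} \<inter> extensional (Ob C)),
      Ident = (\<lambda>F. \<lambda>a\<in>Ob C. Ident D (FOb F a)),
      Cmp = (\<lambda>F G H \<tau> \<sigma>. \<lambda>a\<in>Ob C. Cmp D (FOb F a) (FOb G a) (FOb H a) (\<tau> a) (\<sigma> a))\<rparr>"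

definition full_subcat :: "('o, 'm) cat \<Rightarrow> ('o \<Rightarrow> bool) \<Rightarrow> ('o, 'm) cat" where
  "full_subcat C P = C\<lparr>Ob := {a \<in> Ob C. P a}\<rparr>"

text \<open>\<open>left_adjoint C D F G\<close>: the functor \<open>F : C \<rightarrow> D\<close> is left adjoint to \<open>G : D \<rightarrow> C\<close>.\<close>

definition left_adjoint ::
  "('o, 'm) cat \<Rightarrow> ('p, 'n) cat \<Rightarrow> ('o, 'm, 'p, 'n) fctr \<Rightarrow> ('p, 'n, 'o, 'm) fctr \<Rightarrow> bool" where
  "left_adjoint C D F G \<longleftrightarrow>
     (\<exists>\<Phi>.
        (\<forall>a\<in>Ob C. \<forall>b\<in>Ob D. bij_betw (\<Phi> a b) (Hom D (FOb F a) b) (Hom C a (FOb G b))) \<and>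
        (\<forall>a\<in>Ob C. \<forall>a'\<in>Ob C. \<forall>b\<in>Ob D. \<forall>b'\<in>Ob D.
           \<forall>u\<in>Hom C a' a. \<forall>v\<in>Hom D b b'. \<forall>h\<in>Hom D (FOb F a) b.
           \<Phi> a' b' (Cmp D (FOb F a') b b' v (Cmp D (FOb F a') (FOb F a) b h (FMor F a' a u))) =
           Cmp C a' (FOb G b) (FOb G b') (FMor G b b' v)
             (Cmp C a' a (FOb G b) (\<Phi> a b h) u)))"


section \<open>Finite limits\<close>

definition is_cone ::
  "('j, 'i) cat \<Rightarrow> ('o, 'm) cat \<Rightarrow> ('j, 'i, 'o, 'm) fctr \<Rightarrow> 'o \<Rightarrow> ('j \<Rightarrow> 'm) \<Rightarrow> bool" where
  "is_cone J C D x \<xi> \<longleftrightarrow> x \<in> Ob C \<and> (\<forall>j\<in>Ob J. \<xi> j \<in> Hom C x (FOb D j)) \<and>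
     (\<forall>i\<in>Ob J. \<forall>j\<in>Ob J. \<forall>f\<in>Hom J i j. Cmp C x (FOb D i) (FOb D j) (FMor D i j f) (\<xi> i) = \<xi> j)"

definition is_limit ::
  "('j, 'i) cat \<Rightarrow> ('o, 'm) cat \<Rightarrow> ('j, 'i, 'o, 'm) fctr \<Rightarrow> 'o \<Rightarrow> ('j \<Rightarrow> 'm) \<Rightarrow> bool" where
  "is_limit J C D l \<pi> \<longleftrightarrow> is_cone J C D l \<pi> \<and>
     (\<forall>x \<xi>. is_cone J C D x \<xi> \<longrightarrow>
        (\<exists>!u. u \<in> Hom C x l \<and> (\<forall>j\<in>Ob J. Cmp C x l (FOb D j) (\<pi> j) u = \<xi> j)))"

definition finite_category :: "('j, 'i) cat \<Rightarrow> bool" where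
  "finite_category J \<longleftrightarrow> category J \<and> finite (Ob J) \<and> (\<forall>i\<in>Ob J. \<forall>j\<in>Ob J. finite (Hom J i j))"

text \<open>Up to isomorphism, a finite category has natural numbers as objects and arrows, so these index
  categories suffice.\<close>

definition preserves_finite_limits ::
  "('o, 'm) cat \<Rightarrow> ('p, 'n) cat \<Rightarrow> ('o, 'm, 'p, 'n) fctr \<Rightarrow> bool" where
  "preserves_finite_limits C D F \<longleftrightarrow>
     (\<forall>(J :: (nat, nat) cat) X l \<pi>.
        finite_category J \<longrightarrow> is_functor J C X \<longrightarrow> is_limit J C X l \<pi> \<longrightarrow>
        is_limit J D (comp_fctr F X) (FOb F l) (\<lambda>j. FMor F l (FOb X j) (\<pi> j)))"


section \<open>The category of sets\<close>

text \<open>A type \<open>'v\<close> plays the role of a universe of sets: its cardinality is regular and a strong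
  limit, and a set is small if its cardinality is less than that of \<open>'v\<close>. HOL does not prove that
  an uncountable such type exists, so this is a hypothesis on \<open>'v\<close>. Both conditions together force
  \<open>'v\<close> to be infinite; the countable case, in which small means finite, is not excluded.\<close>

definition small :: "'v itself \<Rightarrow> 'a set \<Rightarrow> bool" where
  "small (_ :: 'v itself) S \<longleftrightarrow> S \<prec> (UNIV :: 'v set)"

definition universe :: "'v itself \<Rightarrow> bool" where
  "universe (v :: 'v itself) \<longleftrightarrow>
     (\<forall>S :: 'v set. small v S \<longrightarrow> small v (Pow S)) \<and>
     (\<forall>(I :: 'v set) (X :: 'v \<Rightarrow> 'v set).
        small v I \<longrightarrow> (\<forall>i\<in>I. small v (X i)) \<longrightarrow> small v (\<Union>i\<in>I. X i))"

definition Ens :: "('v set, 'v \<Rightarrow> 'v) cat" where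
  "Ens = \<lparr>Ob = {X. small TYPE('v) X}, Hom = (\<lambda>X Y. X \<rightarrow>\<^sub>E Y), Ident = (\<lambda>X. \<lambda>x\<in>X. x),
     Cmp = (\<lambda>X Y Z g f. compose X g f)\<rparr>"


section \<open>Grothendieck topoi\<close>

definition small_category :: "('v, 'v) cat \<Rightarrow> bool" where
  "small_category C \<longleftrightarrow> category C \<and> small TYPE('v) (Ob C) \<and>
     (\<forall>a\<in>Ob C. \<forall>b\<in>Ob C. small TYPE('v) (Hom C a b))"

text \<open>An arrow \<open>f : a \<rightarrow> u\<close> with target \<open>u\<close> is represented in a sieve by the pair \<open>(a, f)\<close>.\<close>

definition is_sieve :: "('o, 'm) cat \<Rightarrow> 'o \<Rightarrow> ('o \<times> 'm) set \<Rightarrow> bool" where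
  "is_sieve C u S \<longleftrightarrow> S \<subseteq> {(a, f). a \<in> Ob C \<and> f \<in> Hom C a u} \<and>
     (\<forall>(a, f)\<in>S. \<forall>b\<in>Ob C. \<forall>g\<in>Hom C b a. (b, Cmp C b a u f g) \<in> S)"

definition maximal_sieve :: "('o, 'm) cat \<Rightarrow> 'o \<Rightarrow> ('o \<times> 'm) set" where
  "maximal_sieve C u = {(a, f). a \<in> Ob C \<and> f \<in> Hom C a u}"

definition pullback_sieve ::
  "('o, 'm) cat \<Rightarrow> 'o \<Rightarrow> 'o \<Rightarrow> 'm \<Rightarrow> ('o \<times> 'm) set \<Rightarrow> ('o \<times> 'm) set" where
  "pullback_sieve C a u h S = {(b, g). b \<in> Ob C \<and> g \<in> Hom C b a \<and> (b, Cmp C b a u h g) \<in> S}"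

definition grothendieck_topology :: "('o, 'm) cat \<Rightarrow> ('o \<Rightarrow> ('o \<times> 'm) set set) \<Rightarrow> bool" where
  "grothendieck_topology C J \<longleftrightarrow>
     (\<forall>u\<in>Ob C. \<forall>S\<in>J u. is_sieve C u S) \<and>
     (\<forall>u\<in>Ob C. maximal_sieve C u \<in> J u) \<and>
     (\<forall>u\<in>Ob C. \<forall>a\<in>Ob C. \<forall>h\<in>Hom C a u. \<forall>S\<in>J u. pullback_sieve C a u h S \<in> J a) \<and>
     (\<forall>u\<in>Ob C. \<forall>S\<in>J u. \<forall>R. is_sieve C u R \<longrightarrow>
        (\<forall>(a, f)\<in>S. pullback_sieve C a u f R \<in> J a) \<longrightarrow> R \<in> J u)"

definition matching_family ::
  "('o, 'm) cat \<Rightarrow> ('o, 'm, 'v set, 'v \<Rightarrow> 'v) fctr \<Rightarrow> 'o \<Rightarrow> ('o \<times> 'm) set \<Rightarrow> ('o \<Rightarrow> 'm \<Rightarrow> 'v) \<Rightarrow> bool"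
  where
  "matching_family C P u S x \<longleftrightarrow>
     (\<forall>(a, f)\<in>S. x a f \<in> FOb P a) \<and>
     (\<forall>(a, f)\<in>S. \<forall>b\<in>Ob C. \<forall>g\<in>Hom C b a. FMor P a b g (x a f) = x b (Cmp C b a u f g))"

definition is_sheaf ::
  "('o, 'm) cat \<Rightarrow> ('o \<Rightarrow> ('o \<times> 'm) set set) \<Rightarrow> ('o, 'm, 'v set, 'v \<Rightarrow> 'v) fctr \<Rightarrow> bool" where
  "is_sheaf C J P \<longleftrightarrow> is_functor (op_cat C) Ens P \<and>
     (\<forall>u\<in>Ob C. \<forall>S\<in>J u. \<forall>x. matching_family C P u S x \<longrightarrow>
        (\<exists>!y. y \<in> FOb P u \<and> (\<forall>(a, f)\<in>S. FMor P u a f y = x a f)))"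

definition sheaf_cat ::
  "('v, 'v) cat \<Rightarrow> ('v \<Rightarrow> ('v \<times> 'v) set set) \<Rightarrow> (('v, 'v, 'v set, 'v \<Rightarrow> 'v) fctr, 'v \<Rightarrow> 'v \<Rightarrow> 'v) cat"
  where
  "sheaf_cat C J = full_subcat (functor_cat (op_cat C) Ens) (is_sheaf C J)"

definition grothendieck_topos :: "'v itself \<Rightarrow> ('o, 'm) cat \<Rightarrow> bool" where
  "grothendieck_topos (_ :: 'v itself) E \<longleftrightarrow>
     (\<exists>(C :: ('v, 'v) cat) J. small_category C \<and> grothendieck_topology C J \<and>
        equivalent_cat E (sheaf_cat C J))"


section \<open>Geometric morphisms and points\<close>

record ('o, 'm, 'p, 'n) geom =
  inverse_image :: "('p, 'n, 'o, 'm) fctr"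
  direct_image :: "('o, 'm, 'p, 'n) fctr"

definition geometric_morphism ::
  "('o, 'm) cat \<Rightarrow> ('p, 'n) cat \<Rightarrow> ('o, 'm, 'p, 'n) geom \<Rightarrow> bool" where
  "geometric_morphism E F f \<longleftrightarrow>
     is_functor F E (inverse_image f) \<and> is_functor E F (direct_image f) \<and>
     left_adjoint F E (inverse_image f) (direct_image f) \<and>
     preserves_finite_limits F E (inverse_image f)"

definition is_point :: "('o, 'm) cat \<Rightarrow> ('v set, 'v \<Rightarrow> 'v, 'o, 'm) geom \<Rightarrow> bool" where
  "is_point E p \<longleftrightarrow> geometric_morphism Ens E p"

text \<open>A set-valued functor is isomorphic to the hom functor of \<open>A\<close>. The isomorphism is a natural
  family of bijections because the arrows of \<open>E\<close> need not be elements of the universe \<open>'v\<close>.\<close>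

definition represented_by ::
  "('o, 'm) cat \<Rightarrow> 'o \<Rightarrow> ('o, 'm, 'v set, 'v \<Rightarrow> 'v) fctr \<Rightarrow> bool" where
  "represented_by E A F \<longleftrightarrow>
     (\<exists>\<phi>. (\<forall>X\<in>Ob E. bij_betw (\<phi> X) (Hom E A X) (FOb F X)) \<and>
        (\<forall>X\<in>Ob E. \<forall>Y\<in>Ob E. \<forall>f\<in>Hom E X Y. \<forall>x\<in>Hom E A X.
           \<phi> Y (Cmp E A X Y f x) = FMor F X Y f (\<phi> X x)))"


section \<open>Connected atomic topoi\<close>

text \<open>The geometric morphism from a topos to the category of sets is unique up to isomorphism.\<close>

definition connected_topos :: "'v itself \<Rightarrow> ('o, 'm) cat \<Rightarrow> bool" where
  "connected_topos (_ :: 'v itself) E \<longleftrightarrow>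
     (\<exists>\<gamma>. geometric_morphism E (Ens :: ('v set, 'v \<Rightarrow> 'v) cat) \<gamma> \<and>
        full_functor (Ens :: ('v set, 'v \<Rightarrow> 'v) cat) E (inverse_image \<gamma>) \<and>
        faithful_functor (Ens :: ('v set, 'v \<Rightarrow> 'v) cat) (inverse_image \<gamma>))"

definition locally_connected_topos :: "'v itself \<Rightarrow> ('o, 'm) cat \<Rightarrow> bool" where
  "locally_connected_topos (_ :: 'v itself) E \<longleftrightarrow>
     (\<exists>\<gamma> L. geometric_morphism E (Ens :: ('v set, 'v \<Rightarrow> 'v) cat) \<gamma> \<and>
        is_functor E (Ens :: ('v set, 'v \<Rightarrow> 'v) cat) L \<and>
        left_adjoint E (Ens :: ('v set, 'v \<Rightarrow> 'v) cat) L (inverse_image \<gamma>))"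

text \<open>Inclusion of subobjects \<open>m : U \<rightarrow> X\<close> and \<open>n : V \<rightarrow> X\<close> of \<open>X\<close>.\<close>

definition sub_le :: "('o, 'm) cat \<Rightarrow> 'o \<Rightarrow> 'o \<Rightarrow> 'm \<Rightarrow> 'o \<Rightarrow> 'm \<Rightarrow> bool" where
  "sub_le E X U m V n \<longleftrightarrow> (\<exists>f\<in>Hom E U V. Cmp E U V X n f = m)"

definition complementary_subobjects ::
  "('o, 'm) cat \<Rightarrow> 'o \<Rightarrow> 'o \<Rightarrow> 'm \<Rightarrow> 'o \<Rightarrow> 'm \<Rightarrow> bool" where
  "complementary_subobjects E X U m V n \<longleftrightarrow>
     (\<forall>W\<in>Ob E. \<forall>k. is_mono E W X k \<longrightarrow> sub_le E X W k U m \<longrightarrow> sub_le E X W k V n \<longrightarrow>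
        (\<forall>Z\<in>Ob E. \<forall>z. is_mono E Z X z \<longrightarrow> sub_le E X W k Z z)) \<and>
     (\<forall>W\<in>Ob E. \<forall>k. is_mono E W X k \<longrightarrow> sub_le E X U m W k \<longrightarrow> sub_le E X V n W k \<longrightarrow>
        (\<forall>Z\<in>Ob E. \<forall>z. is_mono E Z X z \<longrightarrow> sub_le E X Z z W k))"

text \<open>Since subobjects in a topos form Heyting algebras, these are Boolean algebras as soon as
  every subobject has a complement: meet the least and join the greatest subobject.\<close>

definition boolean_topos :: "('o, 'm) cat \<Rightarrow> bool" where
  "boolean_topos E \<longleftrightarrow>
     (\<forall>X\<in>Ob E. \<forall>U\<in>Ob E. \<forall>m. is_mono E U X m \<longrightarrow>
        (\<exists>V\<in>Ob E. \<exists>n. is_mono E V X n \<and> complementary_subobjects E X U m V n))"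

definition connected_atomic :: "'v itself \<Rightarrow> ('o, 'm) cat \<Rightarrow> bool" where
  "connected_atomic v E \<longleftrightarrow> connected_topos v E \<and> locally_connected_topos v E \<and> boolean_topos E"


section \<open>Groups and their classifying topoi\<close>

text \<open>Small sets with a left action of \<open>G\<close>, and equivariant maps.\<close>

definition classifying_topos ::
  "('g, 'r) monoid_scheme \<Rightarrow> ('v set \<times> ('g \<Rightarrow> 'v \<Rightarrow> 'v), 'v \<Rightarrow> 'v) cat" where
  "classifying_topos G =
     \<lparr>Ob = {(X, \<phi>). small TYPE('v) X \<and> group_action G X \<phi> \<and> \<phi> \<in> extensional (carrier G)},
      Hom = (\<lambda>(X, \<phi>) (Y, \<psi>). {f \<in> X \<rightarrow>\<^sub>E Y. \<forall>g\<in>carrier G. \<forall>x\<in>X. f (\<phi> g x) = \<psi> g (f x)}),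
      Ident = (\<lambda>(X, \<phi>). \<lambda>x\<in>X. x),
      Cmp = (\<lambda>(X, \<phi>) _ _ g f. compose X g f)\<rparr>"

definition Aut_op :: "('o, 'm) cat \<Rightarrow> 'o \<Rightarrow> 'm monoid" where
  "Aut_op E A = \<lparr>carrier = {f. is_iso E A A f}, mult = (\<lambda>f g. Cmp E A A A g f), one = Ident E A\<rparr>"

end

theory Submission
  imports Defs
begin

text \<open>Write \<open>pts X\<close> for the set of arrows \<open>A \<rightarrow> X\<close>, and \<open>R\<close> for the direct image functor of
  the point. Since \<open>X \<mapsto> pts X\<close> is left adjoint to \<open>R\<close>, an arrow \<open>X \<rightarrow> R S\<close> is the same as an
  arbitrary function \<open>pts X \<rightarrow> S\<close>. This is what makes everything computable on points. In
  particular, let \<open>S\<close> have two elements: every subset \<open>B\<close> of \<open>pts Z\<close> defines a subobject of \<open>Z\<close>, the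
  equalizer of two arrows \<open>Z \<rightarrow> R S\<close>, and if \<open>B\<close> is stable under composition with endomorphisms of
  \<open>A\<close>, the points of this subobject are exactly the elements of \<open>B\<close> (lemma \<open>invariant_subobject\<close>).

  Let \<open>E\<close> be boolean and connected. A point of \<open>X\<close> lies in exactly one of two complementary
  subobjects, because two functions on \<open>pts X\<close> which agree on both subobjects define the same arrow
  \<open>X \<rightarrow> R S\<close> (\<open>covers_disjointly_points\<close>). By connectedness the terminal object does not
  decompose, so an object without points is initial: it maps to the subterminal object \<open>R \<emptyset>\<close>, which
  has no points, and if \<open>R \<emptyset>\<close> were not initial, then \<open>1\<close> would be the disjoint union of two
  noninitial parts (\<open>connected_no_points_initial\<close>). Taking complements, a subobject of \<open>X\<close> that
  contains all points of \<open>X\<close> is \<open>X\<close>; hence arrows are determined by their effect on points, and an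
  arrow that is bijective on points is an isomorphism. Applied to the image of an endomorphism \<open>e\<close>
  of \<open>A\<close>, the same dichotomy shows that \<open>e\<close> has a right inverse; so every endomorphism of \<open>A\<close> is
  invertible and \<open>pts X\<close> is a set with an action of \<open>Aut(A)\<close>.

  The functor \<open>pts\<close> to sets with a group action is therefore faithful. It is full because \<open>Y\<close> embeds
  into \<open>R (pts Y)\<close> as the invariant subobject of its own points, so that an arrow into \<open>Y\<close> is the same
  as a suitable function (\<open>equivariant_map_arrow\<close>). It is essentially surjective because the points
  of \<open>R S\<close> are the functions \<open>End(A) \<rightarrow> S\<close>; when the group acts on \<open>S\<close>, the orbit maps among them
  form an invariant set isomorphic to \<open>S\<close> (\<open>object_of_action\<close>).

  That \<open>E\<close> is a category of sheaves enters through four properties: equalizers, pullbacks, a strict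
  initial object, and the possibility of gluing arrows along two disjoint subobjects that cover. They
  are proved for sheaves on a site and transferred to \<open>E\<close>.

  Conversely, the trivial action functor from sets to sets with a group action has the fixed points
  as right adjoint and the orbits as left adjoint, it is full and faithful, and the complement of an
  invariant subset is invariant. All this is carried to an equivalent category by composing
  adjunctions.\<close>

section \<open>Composition, functors and isomorphisms\<close>

lemma category_ident: "category C \<Longrightarrow> a \<in> Ob C \<Longrightarrow> Ident C a \<in> Hom C a a"
  unfolding category_def by blast

lemma category_cmp:
  "category C \<Longrightarrow> a \<in> Ob C \<Longrightarrow> b \<in> Ob C \<Longrightarrow> c \<in> Ob C \<Longrightarrow> f \<in> Hom C a b \<Longrightarrow> g \<in> Hom C b c \<Longrightarrow>
     Cmp C a b c g f \<in> Hom C a c"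
  unfolding category_def by blast

lemma category_ident_right:
  "category C \<Longrightarrow> a \<in> Ob C \<Longrightarrow> b \<in> Ob C \<Longrightarrow> f \<in> Hom C a b \<Longrightarrow> Cmp C a a b f (Ident C a) = f"
  unfolding category_def by blast

lemma category_ident_left:
  "category C \<Longrightarrow> a \<in> Ob C \<Longrightarrow> b \<in> Ob C \<Longrightarrow> f \<in> Hom C a b \<Longrightarrow> Cmp C a b b (Ident C b) f = f"
  unfolding category_def by blast

lemma category_assoc:
  "category C \<Longrightarrow> a \<in> Ob C \<Longrightarrow> b \<in> Ob C \<Longrightarrow> c \<in> Ob C \<Longrightarrow> d \<in> Ob C \<Longrightarrow>
     f \<in> Hom C a b \<Longrightarrow> g \<in> Hom C b c \<Longrightarrow> h \<in> Hom C c d \<Longrightarrow>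
     Cmp C a c d h (Cmp C a b c g f) = Cmp C a b d (Cmp C b c d h g) f"
  unfolding category_def by blast

lemmas category_rules =
  category_ident category_cmp category_ident_right category_ident_left

lemma functor_ob: "is_functor C D F \<Longrightarrow> a \<in> Ob C \<Longrightarrow> FOb F a \<in> Ob D"
  unfolding is_functor_def by blast

lemma functor_mor:
  "is_functor C D F \<Longrightarrow> a \<in> Ob C \<Longrightarrow> b \<in> Ob C \<Longrightarrow> f \<in> Hom C a b \<Longrightarrow>
     FMor F a b f \<in> Hom D (FOb F a) (FOb F b)"
  unfolding is_functor_def by blast

lemma functor_ident: "is_functor C D F \<Longrightarrow> a \<in> Ob C \<Longrightarrow> FMor F a a (Ident C a) = Ident D (FOb F a)"
  unfolding is_functor_def by blast

lemma functor_cmp: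
  "is_functor C D F \<Longrightarrow> a \<in> Ob C \<Longrightarrow> b \<in> Ob C \<Longrightarrow> c \<in> Ob C \<Longrightarrow> f \<in> Hom C a b \<Longrightarrow> g \<in> Hom C b c \<Longrightarrow>
     FMor F a c (Cmp C a b c g f) =
       Cmp D (FOb F a) (FOb F b) (FOb F c) (FMor F b c g) (FMor F a b f)"
  unfolding is_functor_def by blast

lemmas functor_rules = functor_ob functor_mor functor_ident functor_cmp

lemma comp_fctr_sel [simp]:
  "FOb (comp_fctr G F) a = FOb G (FOb F a)"
  "FMor (comp_fctr G F) a b f = FMor G (FOb F a) (FOb F b) (FMor F a b f)"
  by (simp_all add: comp_fctr_def)

lemma id_fctr_sel [simp]: "FOb id_fctr a = a" "FMor id_fctr a b f = f"
  by (simp_all add: id_fctr_def)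

lemma is_functor_comp:
  assumes "is_functor C D F" "is_functor D E G"
  shows "is_functor C E (comp_fctr G F)"
  using assms unfolding is_functor_def comp_fctr_sel by (simp add: Ball_def)

lemma is_isoE:
  assumes "is_iso C a b f"
  obtains g where "f \<in> Hom C a b" "g \<in> Hom C b a" "Cmp C a b a g f = Ident C a"
    "Cmp C b a b f g = Ident C b"
  using assms unfolding is_iso_def by blast

lemma is_isoI:
  assumes "f \<in> Hom C a b" "g \<in> Hom C b a" "Cmp C a b a g f = Ident C a" "Cmp C b a b f g = Ident C b"
  shows "is_iso C a b f"
  using assms unfolding is_iso_def by blast

lemma iso_cancel_left:
  assumes C: "category C" and ob: "x \<in> Ob C" "a \<in> Ob C" "b \<in> Ob C"
    and i: "is_iso C a b i" and f: "f \<in> Hom C x a" and g: "g \<in> Hom C x a"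
    and eq: "Cmp C x a b i f = Cmp C x a b i g"
  shows "f = g"
proof -
  obtain j where i': "i \<in> Hom C a b" and j: "j \<in> Hom C b a" "Cmp C a b a j i = Ident C a"
    using i by (rule is_isoE)
  have "Cmp C x b a j (Cmp C x a b i f) = Cmp C x b a j (Cmp C x a b i g)"
    using eq by simp
  then show ?thesis
    using category_assoc[OF C ob(1,2,3,2) f i' j(1)] category_assoc[OF C ob(1,2,3,2) g i' j(1)] j(2)
      category_ident_left[OF C ob(1,2) f] category_ident_left[OF C ob(1,2) g] by simp
qed

lemma iso_cancel_right:
  assumes C: "category C" and ob: "a \<in> Ob C" "b \<in> Ob C" "x \<in> Ob C"
    and i: "is_iso C a b i" and f: "f \<in> Hom C b x" and g: "g \<in> Hom C b x"
    and eq: "Cmp C a b x f i = Cmp C a b x g i"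
  shows "f = g"
proof -
  obtain j where i': "i \<in> Hom C a b" and j: "j \<in> Hom C b a" "Cmp C b a b i j = Ident C b"
    using i by (rule is_isoE)
  have "Cmp C b a x (Cmp C a b x f i) j = Cmp C b a x (Cmp C a b x g i) j"
    using eq by simp
  then show ?thesis
    using category_assoc[OF C ob(2,1,2,3) j(1) i' f] category_assoc[OF C ob(2,1,2,3) j(1) i' g] j(2)
      category_ident_right[OF C ob(2,3) f] category_ident_right[OF C ob(2,3) g] by simp
qed

section \<open>Adjunctions\<close>

text \<open>Naturality of the transposition \<open>\<Phi>\<close> is split into its two variables here: a single square
  with both variables moving is awkward to rewrite with.\<close>

definition adjunction ::
  "('o, 'm) cat \<Rightarrow> ('p, 'n) cat \<Rightarrow> ('o, 'm, 'p, 'n) fctr \<Rightarrow> ('p, 'n, 'o, 'm) fctr \<Rightarrow>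
    ('o \<Rightarrow> 'p \<Rightarrow> 'n \<Rightarrow> 'm) \<Rightarrow> bool" where
  "adjunction C D F G \<Phi> \<longleftrightarrow>
     (\<forall>a\<in>Ob C. \<forall>b\<in>Ob D. bij_betw (\<Phi> a b) (Hom D (FOb F a) b) (Hom C a (FOb G b))) \<and>
     (\<forall>a\<in>Ob C. \<forall>b\<in>Ob D. \<forall>b'\<in>Ob D. \<forall>v\<in>Hom D b b'. \<forall>h\<in>Hom D (FOb F a) b.
        \<Phi> a b' (Cmp D (FOb F a) b b' v h) =
        Cmp C a (FOb G b) (FOb G b') (FMor G b b' v) (\<Phi> a b h)) \<and>
     (\<forall>a\<in>Ob C. \<forall>a'\<in>Ob C. \<forall>b\<in>Ob D. \<forall>u\<in>Hom C a' a. \<forall>h\<in>Hom D (FOb F a) b.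
        \<Phi> a' b (Cmp D (FOb F a') (FOb F a) b h (FMor F a' a u)) = Cmp C a' a (FOb G b) (\<Phi> a b h) u)"

lemma adjunction_bij:
  "adjunction C D F G \<Phi> \<Longrightarrow> a \<in> Ob C \<Longrightarrow> b \<in> Ob D \<Longrightarrow>
     bij_betw (\<Phi> a b) (Hom D (FOb F a) b) (Hom C a (FOb G b))"
  unfolding adjunction_def by blast

lemma adjunction_in:
  "adjunction C D F G \<Phi> \<Longrightarrow> a \<in> Ob C \<Longrightarrow> b \<in> Ob D \<Longrightarrow> h \<in> Hom D (FOb F a) b \<Longrightarrow>
     \<Phi> a b h \<in> Hom C a (FOb G b)"
  using bij_betwE[OF adjunction_bij[of C D F G \<Phi> a b]] by blast

lemma adjunction_inj:
  "adjunction C D F G \<Phi> \<Longrightarrow> a \<in> Ob C \<Longrightarrow> b \<in> Ob D \<Longrightarrow> h \<in> Hom D (FOb F a) b \<Longrightarrow>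
     h' \<in> Hom D (FOb F a) b \<Longrightarrow> \<Phi> a b h = \<Phi> a b h' \<Longrightarrow> h = h'"
  using bij_betw_imp_inj_on[OF adjunction_bij] by (meson inj_onD)

lemma adjunction_surjE:
  assumes "adjunction C D F G \<Phi>" "a \<in> Ob C" "b \<in> Ob D" "t \<in> Hom C a (FOb G b)"
  obtains h where "h \<in> Hom D (FOb F a) b" "\<Phi> a b h = t"
proof -
  have "t \<in> \<Phi> a b ` Hom D (FOb F a) b"
    using bij_betw_imp_surj_on[OF adjunction_bij[OF assms(1-3)]] assms(4) by simp
  then show thesis using that by (elim imageE) simp
qed

lemma adjunction_post:
  "adjunction C D F G \<Phi> \<Longrightarrow> a \<in> Ob C \<Longrightarrow> b \<in> Ob D \<Longrightarrow> b' \<in> Ob D \<Longrightarrow> v \<in> Hom D b b' \<Longrightarrow>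
     h \<in> Hom D (FOb F a) b \<Longrightarrow>
     \<Phi> a b' (Cmp D (FOb F a) b b' v h) = Cmp C a (FOb G b) (FOb G b') (FMor G b b' v) (\<Phi> a b h)"
  unfolding adjunction_def by blast

lemma adjunction_pre:
  "adjunction C D F G \<Phi> \<Longrightarrow> a \<in> Ob C \<Longrightarrow> a' \<in> Ob C \<Longrightarrow> b \<in> Ob D \<Longrightarrow> u \<in> Hom C a' a \<Longrightarrow>
     h \<in> Hom D (FOb F a) b \<Longrightarrow>
     \<Phi> a' b (Cmp D (FOb F a') (FOb F a) b h (FMor F a' a u)) = Cmp C a' a (FOb G b) (\<Phi> a b h) u"
  unfolding adjunction_def by blast

lemma left_adjoint_iff_adjunction:
  assumes C: "category C" and D: "category D" and F: "is_functor C D F" and G: "is_functor D C G"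
  shows "left_adjoint C D F G \<longleftrightarrow> (\<exists>\<Phi>. adjunction C D F G \<Phi>)"
proof
  assume "\<exists>\<Phi>. adjunction C D F G \<Phi>"
  then obtain \<Phi> where \<Phi>: "adjunction C D F G \<Phi>" by blast
  show "left_adjoint C D F G"
    unfolding left_adjoint_def
    by (intro exI[of _ \<Phi>] conjI ballI adjunction_bij[OF \<Phi>])
      (simp_all add: adjunction_post[OF \<Phi>, symmetric] adjunction_pre[OF \<Phi>, symmetric] category_cmp[OF D] functor_ob[OF F]
        functor_mor[OF F])
next
  assume "left_adjoint C D F G"
  then obtain \<Phi> where
    \<Phi>: "\<forall>a\<in>Ob C. \<forall>b\<in>Ob D. bij_betw (\<Phi> a b) (Hom D (FOb F a) b) (Hom C a (FOb G b))"
      "\<forall>a\<in>Ob C. \<forall>a'\<in>Ob C. \<forall>b\<in>Ob D. \<forall>b'\<in>Ob D.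
         \<forall>u\<in>Hom C a' a. \<forall>v\<in>Hom D b b'. \<forall>h\<in>Hom D (FOb F a) b.
         \<Phi> a' b' (Cmp D (FOb F a') b b' v (Cmp D (FOb F a') (FOb F a) b h (FMor F a' a u))) =
         Cmp C a' (FOb G b) (FOb G b') (FMor G b b' v) (Cmp C a' a (FOb G b) (\<Phi> a b h) u)"
    unfolding left_adjoint_def by (elim exE conjE) (rule that)
  have bij: "bij_betw (\<Phi> a b) (Hom D (FOb F a) b) (Hom C a (FOb G b))" if "a \<in> Ob C" "b \<in> Ob D" for a b
    using \<Phi>(1) that by blast
  have nat: "\<Phi> a' b' (Cmp D (FOb F a') b b' v (Cmp D (FOb F a') (FOb F a) b h (FMor F a' a u))) =
      Cmp C a' (FOb G b) (FOb G b') (FMor G b b' v) (Cmp C a' a (FOb G b) (\<Phi> a b h) u)"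
    if "a \<in> Ob C" "a' \<in> Ob C" "b \<in> Ob D" "b' \<in> Ob D" "u \<in> Hom C a' a" "v \<in> Hom D b b'"
      "h \<in> Hom D (FOb F a) b" for a a' b b' u v h
    using \<Phi>(2) that by blast
  have in_hom: "\<Phi> a b h \<in> Hom C a (FOb G b)" if "a \<in> Ob C" "b \<in> Ob D" "h \<in> Hom D (FOb F a) b" for a b h
    using bij_betwE[OF bij] that by blast
  have "adjunction C D F G \<Phi>"
    unfolding adjunction_def
  proof (intro conjI ballI)
    show "\<Phi> a b' (Cmp D (FOb F a) b b' v h) =
        Cmp C a (FOb G b) (FOb G b') (FMor G b b' v) (\<Phi> a b h)"
      if "a \<in> Ob C" "b \<in> Ob D" "b' \<in> Ob D" "v \<in> Hom D b b'" "h \<in> Hom D (FOb F a) b" for a b b' v h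
      using nat[of a a b b' "Ident C a" v h] that
      by (simp add: category_rules[OF C] category_rules[OF D] functor_rules[OF F] functor_rules[OF G] in_hom)
    show "\<Phi> a' b (Cmp D (FOb F a') (FOb F a) b h (FMor F a' a u)) = Cmp C a' a (FOb G b) (\<Phi> a b h) u"
      if "a \<in> Ob C" "a' \<in> Ob C" "b \<in> Ob D" "u \<in> Hom C a' a" "h \<in> Hom D (FOb F a) b" for a a' b u h
      using nat[of a a' b b u "Ident D b" h] that
        category_cmp[OF D functor_ob[OF F] functor_ob[OF F], of a' a b "FMor F a' a u" h]
      by (simp add: category_rules[OF C] category_rules[OF D] functor_rules[OF F] functor_rules[OF G] in_hom)
  qed (rule bij)
  then show "\<exists>\<Phi>. adjunction C D F G \<Phi>" by blast
qed

lemma left_adjoint_comp: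
  assumes C: "category C" and D: "category D" and E: "category E"
    and F: "is_functor C D F" and G: "is_functor D C G"
    and F': "is_functor D E F'" and G': "is_functor E D G'"
    and adj: "left_adjoint C D F G" and adj': "left_adjoint D E F' G'"
  shows "left_adjoint C E (comp_fctr F' F) (comp_fctr G G')"
proof -
  obtain \<Phi> where \<Phi>: "adjunction C D F G \<Phi>"
    using adj left_adjoint_iff_adjunction[OF C D F G] by blast
  obtain \<Psi> where \<Psi>: "adjunction D E F' G' \<Psi>"
    using adj' left_adjoint_iff_adjunction[OF D E F' G'] by blast
  have "adjunction C E (comp_fctr F' F) (comp_fctr G G') (\<lambda>a b h. \<Phi> a (FOb G' b) (\<Psi> (FOb F a) b h))"
    unfolding adjunction_def
  proof (intro conjI ballI)
    show "bij_betw (\<lambda>h. \<Phi> a (FOb G' b) (\<Psi> (FOb F a) b h))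
        (Hom E (FOb (comp_fctr F' F) a) b) (Hom C a (FOb (comp_fctr G G') b))"
      if "a \<in> Ob C" "b \<in> Ob E" for a b
      using bij_betw_trans[OF adjunction_bij[OF \<Psi> functor_ob[OF F that(1)] that(2)]
          adjunction_bij[OF \<Phi> that(1) functor_ob[OF G' that(2)]]] by (simp add: o_def)
  qed (simp_all add: adjunction_pre[OF \<Phi>, symmetric] adjunction_post[OF \<Phi>, symmetric]
      adjunction_pre[OF \<Psi>, symmetric] adjunction_post[OF \<Psi>, symmetric] adjunction_in[OF \<Psi>] functor_rules[OF F] functor_rules[OF G'])
  then show ?thesis
    using left_adjoint_iff_adjunction[OF C E is_functor_comp[OF F F'] is_functor_comp[OF G' G]] by blast
qed

text \<open>A cone over the image of a diagram transposes to a cone over the diagram, so the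
  mediating arrow is a transpose as well. In the converse direction of the theorem this provides the
  left exactness of the trivial action functor, which has a left adjoint.\<close>

lemma right_adjoint_preserves_finite_limits:
  assumes C: "category C" and D: "category D" and F: "is_functor C D F" and G: "is_functor D C G"
    and adj: "left_adjoint C D F G"
  shows "preserves_finite_limits D C G"
  unfolding preserves_finite_limits_def
proof (intro allI impI)
  fix J :: "(nat, nat) cat" and X l \<pi>
  assume X: "is_functor J D X" and lim: "is_limit J D X l \<pi>"
  obtain \<Phi> where \<Phi>: "adjunction C D F G \<Phi>"
    using adj left_adjoint_iff_adjunction[OF C D F G] by blast
  note bij = adjunction_bij[OF \<Phi>] and post = adjunction_post[OF \<Phi>]
  have l: "l \<in> Ob D" and \<pi>: "\<And>j. j \<in> Ob J \<Longrightarrow> \<pi> j \<in> Hom D l (FOb X j)"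
    and \<pi>c: "\<And>i j f. i \<in> Ob J \<Longrightarrow> j \<in> Ob J \<Longrightarrow> f \<in> Hom J i j \<Longrightarrow>
      Cmp D l (FOb X i) (FOb X j) (FMor X i j f) (\<pi> i) = \<pi> j"
    using lim unfolding is_limit_def is_cone_def by auto
  note XO = functor_ob[OF X] and XM = functor_mor[OF X]
  show "is_limit J C (comp_fctr G X) (FOb G l) (\<lambda>j. FMor G l (FOb X j) (\<pi> j))"
    unfolding is_limit_def
  proof (intro conjI allI impI)
    show "is_cone J C (comp_fctr G X) (FOb G l) (\<lambda>j. FMor G l (FOb X j) (\<pi> j))"
      unfolding is_cone_def
    proof (intro conjI ballI)
      fix i j f assume "i \<in> Ob J" "j \<in> Ob J" "f \<in> Hom J i j"
      then show "Cmp C (FOb G l) (FOb (comp_fctr G X) i) (FOb (comp_fctr G X) j)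
          (FMor (comp_fctr G X) i j f) (FMor G l (FOb X i) (\<pi> i)) = FMor G l (FOb X j) (\<pi> j)"
        using functor_cmp[OF G l XO XO \<pi> XM, of i j f] by (simp add: \<pi>c)
    qed (auto simp: l \<pi> XO intro!: functor_ob[OF G] functor_mor[OF G])
  next
    fix x \<xi> assume cone: "is_cone J C (comp_fctr G X) x \<xi>"
    have x: "x \<in> Ob C" and \<xi>: "\<And>j. j \<in> Ob J \<Longrightarrow> \<xi> j \<in> Hom C x (FOb G (FOb X j))"
      and \<xi>c: "\<And>i j f. i \<in> Ob J \<Longrightarrow> j \<in> Ob J \<Longrightarrow> f \<in> Hom J i j \<Longrightarrow>
        Cmp C x (FOb G (FOb X i)) (FOb G (FOb X j)) (FMor G (FOb X i) (FOb X j) (FMor X i j f)) (\<xi> i) = \<xi> j"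
      using cone unfolding is_cone_def by auto
    note Fx = functor_ob[OF F x]
    define \<zeta> where "\<zeta> j = inv_into (Hom D (FOb F x) (FOb X j)) (\<Phi> x (FOb X j)) (\<xi> j)" for j
    have \<zeta>: "\<zeta> j \<in> Hom D (FOb F x) (FOb X j)" "\<Phi> x (FOb X j) (\<zeta> j) = \<xi> j" if "j \<in> Ob J" for j
      using bij_betw_imp_surj_on[OF bij[OF x XO[OF that]]] \<xi>[OF that] unfolding \<zeta>_def
      by (auto intro: inv_into_into f_inv_into_f)
    have inj: "h = h'" if "b \<in> Ob D" "h \<in> Hom D (FOb F x) b" "h' \<in> Hom D (FOb F x) b" "\<Phi> x b h = \<Phi> x b h'"
      for b h h'
      by (rule adjunction_inj[OF \<Phi> x that])
    have "is_cone J D X (FOb F x) \<zeta>"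
      unfolding is_cone_def
    proof (intro conjI ballI)
      fix i j f assume ij: "i \<in> Ob J" "j \<in> Ob J" "f \<in> Hom J i j"
      show "Cmp D (FOb F x) (FOb X i) (FOb X j) (FMor X i j f) (\<zeta> i) = \<zeta> j"
        by (rule inj[OF XO[OF ij(2)]])
          (use ij in \<open>simp_all add: category_cmp[OF D] Fx \<zeta> XO XM x post \<xi>c\<close>)
    qed (simp_all add: Fx \<zeta>)
    then obtain u where u: "u \<in> Hom D (FOb F x) l"
      and u\<pi>: "\<And>j. j \<in> Ob J \<Longrightarrow> Cmp D (FOb F x) l (FOb X j) (\<pi> j) u = \<zeta> j"
      and uu: "\<And>w. w \<in> Hom D (FOb F x) l \<Longrightarrow>
        (\<forall>j\<in>Ob J. Cmp D (FOb F x) l (FOb X j) (\<pi> j) w = \<zeta> j) \<Longrightarrow> w = u"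
      using lim unfolding is_limit_def by metis
    show "\<exists>!u. u \<in> Hom C x (FOb G l) \<and> (\<forall>j\<in>Ob J. Cmp C x (FOb G l) (FOb (comp_fctr G X) j)
        (FMor G l (FOb X j) (\<pi> j)) u = \<xi> j)"
    proof (rule ex1I[of _ "\<Phi> x l u"])
      show "\<Phi> x l u \<in> Hom C x (FOb G l) \<and> (\<forall>j\<in>Ob J. Cmp C x (FOb G l) (FOb (comp_fctr G X) j)
        (FMor G l (FOb X j) (\<pi> j)) (\<Phi> x l u) = \<xi> j)"
        using bij_betwE[OF bij[OF x l]] u u\<pi> \<zeta> post[OF x l XO \<pi> u] by auto
    next
      fix w assume w: "w \<in> Hom C x (FOb G l) \<and> (\<forall>j\<in>Ob J. Cmp C x (FOb G l) (FOb (comp_fctr G X) j)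
        (FMor G l (FOb X j) (\<pi> j)) w = \<xi> j)"
      then obtain w' where w': "w' \<in> Hom D (FOb F x) l" "w = \<Phi> x l w'"
        using bij_betw_imp_surj_on[OF bij[OF x l]] by blast
      have "w' = u"
      proof (rule uu[OF w'(1)], rule ballI)
        fix j assume j: "j \<in> Ob J"
        show "Cmp D (FOb F x) l (FOb X j) (\<pi> j) w' = \<zeta> j"
          by (rule inj[OF XO[OF j]])
            (use j w w' in \<open>simp_all add: category_cmp[OF D Fx l XO] \<pi> \<zeta> post[OF x l XO \<pi>]\<close>)
      qed
      then show "w = \<Phi> x l u" using w' by simp
    qed
  qed
qed

section \<open>Equivalences of categories\<close>

text \<open>Most transfer arguments need one functor that is full, faithful and essentially surjective
  rather than a pair of quasi-inverse functors.\<close>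

definition equivalence_functor ::
  "('o, 'm) cat \<Rightarrow> ('p, 'n) cat \<Rightarrow> ('o, 'm, 'p, 'n) fctr \<Rightarrow> bool" where
  "equivalence_functor C D F \<longleftrightarrow> category C \<and> category D \<and> is_functor C D F \<and>
     full_functor C D F \<and> faithful_functor C F \<and> (\<forall>d\<in>Ob D. \<exists>c\<in>Ob C. \<exists>i. is_iso D (FOb F c) d i)"

lemma faithfulD:
  "faithful_functor C F \<Longrightarrow> a \<in> Ob C \<Longrightarrow> b \<in> Ob C \<Longrightarrow> f \<in> Hom C a b \<Longrightarrow> g \<in> Hom C a b \<Longrightarrow>
     FMor F a b f = FMor F a b g \<Longrightarrow> f = g"
  unfolding faithful_functor_def by (meson inj_onD)

lemma fullE:
  assumes "full_functor C D F" "a \<in> Ob C" "b \<in> Ob C" "g \<in> Hom D (FOb F a) (FOb F b)"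
  obtains f where "f \<in> Hom C a b" "FMor F a b f = g"
  using assms unfolding full_functor_def by blast

lemma iso_natural_to_id_faithful:
  assumes C: "category C" and F: "is_functor C D F" and G: "is_functor D C G"
    and n: "naturally_iso C C (comp_fctr G F) id_fctr"
  shows "faithful_functor C F"
  unfolding faithful_functor_def
proof (intro ballI inj_onI)
  fix a b f g
  assume ab: "a \<in> Ob C" "b \<in> Ob C" and fg: "f \<in> Hom C a b" "g \<in> Hom C a b" "FMor F a b f = FMor F a b g"
  obtain \<tau> where nat: "nat_trans C C (comp_fctr G F) id_fctr \<tau>"
    and iso: "\<And>a. a \<in> Ob C \<Longrightarrow> is_iso C (FOb G (FOb F a)) a (\<tau> a)"
    using n unfolding naturally_iso_def by auto
  have nt: "Cmp C (FOb G (FOb F a)) (FOb G (FOb F b)) b (\<tau> b) (FMor G (FOb F a) (FOb F b) (FMor F a b h)) =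
      Cmp C (FOb G (FOb F a)) a b h (\<tau> a)" if "h \<in> Hom C a b" for h
    using nat ab that unfolding nat_trans_def by simp
  show "f = g"
    by (rule iso_cancel_right[OF C _ ab(1,2) iso[OF ab(1)] fg(1,2)])
      (use nt fg functor_ob[OF G functor_ob[OF F ab(1)]] in \<open>simp_all flip: nt\<close>)
qed

text \<open>The isomorphism \<open>G F \<cong> 1\<close> makes \<open>F\<close> faithful, and \<open>F G \<cong> 1\<close> makes \<open>G\<close> faithful. An arrow
  \<open>g : F a \<rightarrow> F b\<close> is conjugate, after applying \<open>G\<close>, to an arrow \<open>f : a \<rightarrow> b\<close>; then \<open>G (F f) = G g\<close>
  and faithfulness of \<open>G\<close> gives \<open>F f = g\<close>.\<close>

lemma quasi_inverse_imp_equivalence_functor: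
  assumes C: "category C" and D: "category D" and F: "is_functor C D F" and G: "is_functor D C G"
    and n: "naturally_iso C C (comp_fctr G F) id_fctr" and n': "naturally_iso D D (comp_fctr F G) id_fctr"
  shows "equivalence_functor C D F"
proof -
  note fF = iso_natural_to_id_faithful[OF C F G n] and fG = iso_natural_to_id_faithful[OF D G F n']
  obtain \<tau> where nat: "nat_trans C C (comp_fctr G F) id_fctr \<tau>"
    and iso: "\<And>a. a \<in> Ob C \<Longrightarrow> is_iso C (FOb G (FOb F a)) a (\<tau> a)"
    using n unfolding naturally_iso_def by auto
  have full: "full_functor C D F"
    unfolding full_functor_def
  proof (intro ballI subsetI)
    fix a b g assume a: "a \<in> Ob C" and b: "b \<in> Ob C" and g: "g \<in> Hom D (FOb F a) (FOb F b)"
    note Fa = functor_ob[OF F a] and Fb = functor_ob[OF F b]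
    note GFa = functor_ob[OF G Fa] and GFb = functor_ob[OF G Fb]
    note Gg = functor_mor[OF G Fa Fb g]
    obtain s where s: "\<tau> a \<in> Hom C (FOb G (FOb F a)) a" "s \<in> Hom C a (FOb G (FOb F a))"
      "Cmp C (FOb G (FOb F a)) a (FOb G (FOb F a)) s (\<tau> a) = Ident C (FOb G (FOb F a))"
      using iso[OF a] by (rule is_isoE) blast
    have tb: "\<tau> b \<in> Hom C (FOb G (FOb F b)) b" using iso[OF b] by (rule is_isoE)
    let ?t = "Cmp C (FOb G (FOb F a)) (FOb G (FOb F b)) b (\<tau> b) (FMor G (FOb F a) (FOb F b) g)"
    have t: "?t \<in> Hom C (FOb G (FOb F a)) b" by (rule category_cmp[OF C GFa GFb b Gg tb])
    define f where "f = Cmp C a (FOb G (FOb F a)) b ?t s"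
    have f: "f \<in> Hom C a b" unfolding f_def by (rule category_cmp[OF C a GFa b s(2) t])
    have f\<tau>: "Cmp C (FOb G (FOb F a)) a b f (\<tau> a) = ?t"
      unfolding f_def using category_assoc[OF C GFa a GFa b s(1,2) t] s(3)
        category_ident_right[OF C GFa b t] by simp
    have "Cmp C (FOb G (FOb F a)) (FOb G (FOb F b)) b (\<tau> b) (FMor G (FOb F a) (FOb F b) (FMor F a b f)) =
      Cmp C (FOb G (FOb F a)) a b f (\<tau> a)"
      using nat a b f unfolding nat_trans_def by simp
    then have "FMor G (FOb F a) (FOb F b) (FMor F a b f) = FMor G (FOb F a) (FOb F b) g"
      using iso_cancel_left[OF C GFa GFb b iso[OF b] functor_mor[OF G Fa Fb functor_mor[OF F a b f]] Gg] f\<tau>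
      by simp
    then have "FMor F a b f = g"
      by (rule faithfulD[OF fG Fa Fb functor_mor[OF F a b f] g])
    then show "g \<in> FMor F a b ` Hom C a b" using f by blast
  qed
  have "\<forall>d\<in>Ob D. \<exists>c\<in>Ob C. \<exists>i. is_iso D (FOb F c) d i"
    using n' functor_ob[OF G] unfolding naturally_iso_def by auto
  then show ?thesis using C D F full fF unfolding equivalence_functor_def by blast
qed

lemma equivalent_cat_imp_equivalence_functor:
  assumes "equivalent_cat C D"
  obtains F where "equivalence_functor C D F"
  using assms quasi_inverse_imp_equivalence_functor unfolding equivalent_cat_def by metis

text \<open>The quasi-inverse \<open>K\<close> sends \<open>d\<close> to a chosen object with \<open>F (K d) \<cong> d\<close>, and arrows to lifts of
  their conjugates. Both adjunctions come from the same data: an arrow between \<open>c\<close> and \<open>K d\<close>, in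
  either direction, is a lift of an arrow between \<open>F c\<close> and \<open>d\<close> composed with the chosen
  isomorphism.\<close>

lemma equivalence_functor_inverse:
  assumes "equivalence_functor C D F"
  obtains K where "is_functor D C K" "left_adjoint C D F K" "left_adjoint D C K F"
    "naturally_iso C C (comp_fctr K F) id_fctr" "naturally_iso D D (comp_fctr F K) id_fctr"
proof -
  have C: "category C" and D: "category D" and F: "is_functor C D F"
    and full: "full_functor C D F" and faithful: "faithful_functor C F"
    using assms unfolding equivalence_functor_def by auto
  have "\<forall>d\<in>Ob D. \<exists>c i j. c \<in> Ob C \<and> i \<in> Hom D (FOb F c) d \<and> j \<in> Hom D d (FOb F c) \<and>
      Cmp D (FOb F c) d (FOb F c) j i = Ident D (FOb F c) \<and> Cmp D d (FOb F c) d i j = Ident D d"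
    using assms unfolding equivalence_functor_def is_iso_def by meson
  then obtain k i j where k: "\<And>d. d \<in> Ob D \<Longrightarrow> k d \<in> Ob C"
    and i: "\<And>d. d \<in> Ob D \<Longrightarrow> i d \<in> Hom D (FOb F (k d)) d"
    and j: "\<And>d. d \<in> Ob D \<Longrightarrow> j d \<in> Hom D d (FOb F (k d))"
    and ji: "\<And>d. d \<in> Ob D \<Longrightarrow> Cmp D (FOb F (k d)) d (FOb F (k d)) (j d) (i d) = Ident D (FOb F (k d))"
    and ij: "\<And>d. d \<in> Ob D \<Longrightarrow> Cmp D d (FOb F (k d)) d (i d) (j d) = Ident D d"
    by metis
  note Fk = functor_ob[OF F k]
  note FO = functor_ob[OF F] and FM = functor_mor[OF F]
  define lift where "lift c c' = inv_into (Hom C c c') (FMor F c c')" for c c'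
  have lift: "lift c c' g \<in> Hom C c c'" "FMor F c c' (lift c c' g) = g"
    if "c \<in> Ob C" "c' \<in> Ob C" "g \<in> Hom D (FOb F c) (FOb F c')" for c c' g
  proof -
    have "g \<in> FMor F c c' ` Hom C c c'" using full that unfolding full_functor_def by blast
    then show "lift c c' g \<in> Hom C c c'" "FMor F c c' (lift c c' g) = g"
      unfolding lift_def by (simp_all add: inv_into_into f_inv_into_f)
  qed
  have lift_unique: "f = lift c c' g" if "c \<in> Ob C" "c' \<in> Ob C" "f \<in> Hom C c c'" "FMor F c c' f = g" for c c' f g
    using faithfulD[OF faithful that(1-3), of "lift c c' g"] lift[OF that(1,2), of g] that functor_mor[OF F that(1-3)]
    by metis
  have rev: "Cmp D x (FOb F (k d)) d (i d) (Cmp D x d (FOb F (k d)) (j d) h) = h"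
    if "x \<in> Ob D" "d \<in> Ob D" "h \<in> Hom D x d" for x d h
    using category_assoc[OF D that(1,2) Fk[OF that(2)] that(2,3) j[OF that(2)] i[OF that(2)]] that
    by (simp add: ij category_rules[OF D])
  have rev': "Cmp D x d (FOb F (k d)) (j d) (Cmp D x (FOb F (k d)) d (i d) h) = h"
    if "x \<in> Ob D" "d \<in> Ob D" "h \<in> Hom D x (FOb F (k d))" for x d h
    using category_assoc[OF D that(1) Fk[OF that(2)] that(2) Fk[OF that(2)] that(3) i[OF that(2)] j[OF that(2)]] that
    by (simp add: ji category_rules[OF D] Fk)
  have rev2: "Cmp D d (FOb F (k d)) x (Cmp D (FOb F (k d)) d x h (i d)) (j d) = h"
    if "x \<in> Ob D" "d \<in> Ob D" "h \<in> Hom D d x" for x d h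
    using category_assoc[OF D that(2) Fk[OF that(2)] that(2,1) j[OF that(2)] i[OF that(2)] that(3)] that
    by (simp add: ij category_rules[OF D])
  have rev2': "Cmp D (FOb F (k d)) d x (Cmp D d (FOb F (k d)) x h (j d)) (i d) = h"
    if "x \<in> Ob D" "d \<in> Ob D" "h \<in> Hom D (FOb F (k d)) x" for x d h
    using category_assoc[OF D Fk[OF that(2)] that(2) Fk[OF that(2)] that(1) i[OF that(2)] j[OF that(2)] that(3)] that
    by (simp add: ji category_rules[OF D] Fk)
  define K where "K = \<lparr>FOb = k, FMor = (\<lambda>d d' g. lift (k d) (k d')
      (Cmp D (FOb F (k d)) d' (FOb F (k d')) (j d') (Cmp D (FOb F (k d)) d d' g (i d))))\<rparr>"
  have KO [simp]: "FOb K = k" by (simp add: K_def)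
  have KM: "FMor K d d' g \<in> Hom C (k d) (k d')"
    and FKM: "FMor F (k d) (k d') (FMor K d d' g) =
      Cmp D (FOb F (k d)) d' (FOb F (k d')) (j d') (Cmp D (FOb F (k d)) d d' g (i d))"
    if "d \<in> Ob D" "d' \<in> Ob D" "g \<in> Hom D d d'" for d d' g
    using lift[OF k k, of d d'] that by (simp_all add: K_def category_cmp[OF D] Fk i j)
  have iFK: "Cmp D (FOb F (k d)) (FOb F (k d')) d' (i d') (FMor F (k d) (k d') (FMor K d d' g)) =
      Cmp D (FOb F (k d)) d d' g (i d)" if "d \<in> Ob D" "d' \<in> Ob D" "g \<in> Hom D d d'" for d d' g
    using that by (simp add: FKM rev category_cmp[OF D] Fk i)
  have FKj: "Cmp D d (FOb F (k d)) (FOb F (k d')) (FMor F (k d) (k d') (FMor K d d' g)) (j d) =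
      Cmp D d d' (FOb F (k d')) (j d') g" if "d \<in> Ob D" "d' \<in> Ob D" "g \<in> Hom D d d'" for d d' g
    using that category_assoc[OF D that(1) Fk[OF that(1)] that(2) Fk[OF that(2)] j[OF that(1)]
        category_cmp[OF D Fk[OF that(1)] that(1,2) i[OF that(1)] that(3)] j[OF that(2)]]
    by (simp add: FKM rev2)
  have i_iso: "is_iso D (FOb F (k d)) d (i d)" if "d \<in> Ob D" for d
    by (rule is_isoI[OF _ j]) (use that in \<open>simp_all add: i ij ji\<close>)
  have K: "is_functor D C K"
    unfolding is_functor_def
  proof (intro conjI ballI)
    fix d assume d: "d \<in> Ob D"
    show "FMor K d d (Ident D d) = Ident C (FOb K d)"
      by (rule faithfulD[OF faithful k[OF d] k[OF d]])
        (use d in \<open>simp_all add: KM FKM category_rules[OF D] category_ident[OF C] k Fk i ji functor_ident[OF F]\<close>)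
  next
    fix a b c f g assume abc: "a \<in> Ob D" "b \<in> Ob D" "c \<in> Ob D" and f: "f \<in> Hom D a b" and g: "g \<in> Hom D b c"
    have gf: "Cmp D a b c g f \<in> Hom D a c" by (rule category_cmp[OF D abc f g])
    have m: "Cmp C (k a) (k b) (k c) (FMor K b c g) (FMor K a b f) \<in> Hom C (k a) (k c)"
      by (rule category_cmp[OF C]) (use abc f g in \<open>simp_all add: k KM\<close>)
    show "FMor K a c (Cmp D a b c g f) = Cmp C (FOb K a) (FOb K b) (FOb K c) (FMor K b c g) (FMor K a b f)"
      unfolding KO
    proof (rule faithfulD[OF faithful k k KM m], (fact abc gf)+,
        rule iso_cancel_left[OF D Fk Fk _ i_iso[of c]], (fact abc)+)
      have Kf: "FMor F (k a) (k b) (FMor K a b f) \<in> Hom D (FOb F (k a)) (FOb F (k b))"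
        and Kg: "FMor F (k b) (k c) (FMor K b c g) \<in> Hom D (FOb F (k b)) (FOb F (k c))"
        using abc f g by (auto intro!: FM k KM)
      show "Cmp D (FOb F (k a)) (FOb F (k c)) c (i c) (FMor F (k a) (k c) (FMor K a c (Cmp D a b c g f))) =
        Cmp D (FOb F (k a)) (FOb F (k c)) c (i c)
          (FMor F (k a) (k c) (Cmp C (k a) (k b) (k c) (FMor K b c g) (FMor K a b f)))"
        using abc f g iFK[OF abc(1,3) gf]
          category_assoc[OF D Fk[OF abc(1)] abc i[OF abc(1)] f g]
          category_assoc[OF D Fk[OF abc(1)] Fk[OF abc(2)] Fk[OF abc(3)] abc(3) Kf Kg i[OF abc(3)]]
          category_assoc[OF D Fk[OF abc(1)] Fk[OF abc(2)] abc(2,3) Kf i[OF abc(2)] g]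
        by (simp add: functor_cmp[OF F] k KM iFK)
    qed (use gf m abc in \<open>auto intro!: FM k KM\<close>)
  qed (simp_all add: k KM)
  have adj: "left_adjoint C D F K"
  unfolding left_adjoint_iff_adjunction[OF C D F K] adjunction_def
  proof (intro exI[of _ "\<lambda>c d h. lift c (k d) (Cmp D (FOb F c) d (FOb F (k d)) (j d) h)"] conjI ballI)
    fix a b assume ab: "a \<in> Ob C" "b \<in> Ob D"
    show "bij_betw (\<lambda>h. lift a (k b) (Cmp D (FOb F a) b (FOb F (k b)) (j b) h)) (Hom D (FOb F a) b)
        (Hom C a (FOb K b))"
    proof (rule bij_betw_byWitness[where f' = "\<lambda>f. Cmp D (FOb F a) (FOb F (k b)) b (i b) (FMor F a (k b) f)"])
      show "\<forall>f\<in>Hom C a (FOb K b). lift a (k b) (Cmp D (FOb F a) b (FOb F (k b)) (j b)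
          (Cmp D (FOb F a) (FOb F (k b)) b (i b) (FMor F a (k b) f))) = f"
        using ab lift_unique[OF ab(1) k[OF ab(2)]] by (simp add: rev' FO FM k)
    qed (use ab in \<open>auto simp: lift rev k FO FM i j category_cmp[OF D]\<close>)
  next
    fix a b b' v h assume ab: "a \<in> Ob C" "b \<in> Ob D" "b' \<in> Ob D" and v: "v \<in> Hom D b b'"
      and h: "h \<in> Hom D (FOb F a) b"
    have jh: "Cmp D (FOb F a) b (FOb F (k b)) (j b) h \<in> Hom D (FOb F a) (FOb F (k b))"
      using ab h by (simp add: category_cmp[OF D] FO Fk j)
    show "lift a (k b') (Cmp D (FOb F a) b' (FOb F (k b')) (j b') (Cmp D (FOb F a) b b' v h)) =
       Cmp C a (FOb K b) (FOb K b') (FMor K b b' v) (lift a (k b) (Cmp D (FOb F a) b (FOb F (k b)) (j b) h))"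
      by (rule sym, rule lift_unique)
        (use ab v h jh in \<open>simp_all add: k lift category_cmp[OF C] KM functor_cmp[OF F] FO Fk j FM
          category_assoc[OF D] FKj\<close>)
  next
    fix a a' b u h assume ab: "a \<in> Ob C" "a' \<in> Ob C" "b \<in> Ob D" and u: "u \<in> Hom C a' a"
      and h: "h \<in> Hom D (FOb F a) b"
    have jh: "Cmp D (FOb F a) b (FOb F (k b)) (j b) h \<in> Hom D (FOb F a) (FOb F (k b))"
      using ab h by (simp add: category_cmp[OF D] FO Fk j)
    show "lift a' (k b) (Cmp D (FOb F a') b (FOb F (k b)) (j b) (Cmp D (FOb F a') (FOb F a) b h (FMor F a' a u))) =
       Cmp C a' a (FOb K b) (lift a (k b) (Cmp D (FOb F a) b (FOb F (k b)) (j b) h)) u"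
      by (rule sym, rule lift_unique)
        (use ab u h jh in \<open>simp_all add: k lift category_cmp[OF C] functor_cmp[OF F] FO Fk j FM
          category_assoc[OF D]\<close>)
  qed
  have adj': "left_adjoint D C K F"
  unfolding left_adjoint_iff_adjunction[OF D C K F] adjunction_def
  proof (intro exI[of _ "\<lambda>d c h. Cmp D d (FOb F (k d)) (FOb F c) (FMor F (k d) c h) (j d)"] conjI ballI)
    fix a b assume ab: "a \<in> Ob D" "b \<in> Ob C"
    show "bij_betw (\<lambda>h. Cmp D a (FOb F (k a)) (FOb F b) (FMor F (k a) b h) (j a)) (Hom C (FOb K a) b)
        (Hom D a (FOb F b))"
    proof (rule bij_betw_byWitness[where f' = "\<lambda>g. lift (k a) b (Cmp D (FOb F (k a)) a (FOb F b) g (i a))"])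
      show "\<forall>h\<in>Hom C (FOb K a) b. lift (k a) b (Cmp D (FOb F (k a)) a (FOb F b)
          (Cmp D a (FOb F (k a)) (FOb F b) (FMor F (k a) b h) (j a)) (i a)) = h"
        using ab lift_unique[OF k[OF ab(1)] ab(2)] by (simp add: rev2' FO FM k)
    qed (use ab in \<open>auto simp: lift rev2 k FO FM i j category_cmp[OF D]\<close>)
  next
    fix a b b' v h assume ab: "a \<in> Ob D" "b \<in> Ob C" "b' \<in> Ob C" and v: "v \<in> Hom C b b'"
      and h: "h \<in> Hom C (FOb K a) b"
    show "Cmp D a (FOb F (k a)) (FOb F b') (FMor F (k a) b' (Cmp C (FOb K a) b b' v h)) (j a) =
       Cmp D a (FOb F b) (FOb F b') (FMor F b b' v) (Cmp D a (FOb F (k a)) (FOb F b) (FMor F (k a) b h) (j a))"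
      using ab v h by (simp add: functor_cmp[OF F] k FO FM j category_assoc[OF D])
  next
    fix a a' b u h assume ab: "a \<in> Ob D" "a' \<in> Ob D" "b \<in> Ob C" and u: "u \<in> Hom D a' a"
      and h: "h \<in> Hom C (FOb K a) b"
    have h': "h \<in> Hom C (k a) b" using h by simp
    have "Cmp D a' (FOb F (k a')) (FOb F b)
        (Cmp D (FOb F (k a')) (FOb F (k a)) (FOb F b) (FMor F (k a) b h) (FMor F (k a') (k a) (FMor K a' a u))) (j a') =
      Cmp D a' (FOb F (k a)) (FOb F b) (FMor F (k a) b h)
        (Cmp D a' (FOb F (k a')) (FOb F (k a)) (FMor F (k a') (k a) (FMor K a' a u)) (j a'))"
      by (rule category_assoc[OF D, symmetric]) (use ab u h in \<open>simp_all add: Fk FO FM KM j k\<close>)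
    also have "\<dots> = Cmp D a' (FOb F (k a)) (FOb F b) (FMor F (k a) b h) (Cmp D a' a (FOb F (k a)) (j a) u)"
      using ab u by (simp add: FKj)
    also have "\<dots> = Cmp D a' a (FOb F b) (Cmp D a (FOb F (k a)) (FOb F b) (FMor F (k a) b h) (j a)) u"
      by (rule category_assoc[OF D]) (use ab u h in \<open>simp_all add: Fk FO FM j k\<close>)
    finally show "Cmp D a' (FOb F (k a')) (FOb F b) (FMor F (k a') b (Cmp C (FOb K a') (FOb K a) b h (FMor K a' a u))) (j a') =
       Cmp D a' a (FOb F b) (Cmp D a (FOb F (k a)) (FOb F b) (FMor F (k a) b h) (j a)) u"
      using functor_cmp[OF F k[OF ab(2)] k[OF ab(1)] ab(3) KM[OF ab(2,1) u] h'] by simp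
  qed
  have n2: "naturally_iso D D (comp_fctr F K) id_fctr"
    unfolding naturally_iso_def nat_trans_def
    by (intro exI[of _ i]) (simp add: i iFK i_iso)
  have "naturally_iso C C (comp_fctr K F) id_fctr"
    unfolding naturally_iso_def nat_trans_def
  proof (intro exI[of _ "\<lambda>c. lift (k (FOb F c)) c (i (FOb F c))"] conjI ballI)
    fix a assume a: "a \<in> Ob C"
    then show "lift (k (FOb F a)) a (i (FOb F a)) \<in> Hom C (FOb (comp_fctr K F) a) (FOb id_fctr a)"
      by (simp add: lift k i FO)
    show "is_iso C (FOb (comp_fctr K F) a) (FOb id_fctr a) (lift (k (FOb F a)) a (i (FOb F a)))"
    proof (rule is_isoI)
      show "Cmp C (FOb (comp_fctr K F) a) (FOb id_fctr a) (FOb (comp_fctr K F) a)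
          (lift a (k (FOb F a)) (j (FOb F a))) (lift (k (FOb F a)) a (i (FOb F a))) =
          Ident C (FOb (comp_fctr K F) a)"
        unfolding comp_fctr_sel id_fctr_sel KO
        by (rule faithfulD[OF faithful, of "k (FOb F a)" "k (FOb F a)"])
          (use a in \<open>simp_all add: k FO lift i j category_rules[OF C] functor_cmp[OF F] functor_ident[OF F] ji\<close>)
      show "Cmp C (FOb id_fctr a) (FOb (comp_fctr K F) a) (FOb id_fctr a)
          (lift (k (FOb F a)) a (i (FOb F a))) (lift a (k (FOb F a)) (j (FOb F a))) =
          Ident C (FOb id_fctr a)"
        unfolding comp_fctr_sel id_fctr_sel KO
        by (rule faithfulD[OF faithful, of a a])
          (use a in \<open>simp_all add: k FO lift i j category_rules[OF C] functor_cmp[OF F] functor_ident[OF F] ij\<close>)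
    qed (use a in \<open>simp_all add: lift k i j FO\<close>)
  next
    fix a b f assume ab: "a \<in> Ob C" "b \<in> Ob C" and f: "f \<in> Hom C a b"
    show "Cmp C (FOb (comp_fctr K F) a) (FOb (comp_fctr K F) b) (FOb id_fctr b)
        (lift (k (FOb F b)) b (i (FOb F b))) (FMor (comp_fctr K F) a b f) =
      Cmp C (FOb (comp_fctr K F) a) (FOb id_fctr a) (FOb id_fctr b) (FMor id_fctr a b f)
        (lift (k (FOb F a)) a (i (FOb F a)))"
      unfolding comp_fctr_sel id_fctr_sel KO
      by (rule faithfulD[OF faithful, of "k (FOb F a)" b])
        (use ab f in \<open>simp_all add: k FO FM lift i j KM category_cmp[OF C] functor_cmp[OF F] iFK\<close>)
  qed
  then show thesis by (rule that[OF K adj adj' _ n2])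
qed

lemma equivalence_functor_imp_equivalent_cat:
  assumes "equivalence_functor C D F"
  shows "equivalent_cat C D"
proof -
  obtain K where "is_functor D C K" 
    "naturally_iso C C (comp_fctr K F) id_fctr" "naturally_iso D D (comp_fctr F K) id_fctr"
    using equivalence_functor_inverse[OF assms] .
  then show ?thesis using assms unfolding equivalence_functor_def equivalent_cat_def by blast
qed

section \<open>Small sets\<close>

lemma small_subset: "small v B \<Longrightarrow> A \<subseteq> B \<Longrightarrow> small v A"
  unfolding small_def using subset_imp_lepoll lesspoll_trans1 by blast

lemma small_image: "small v A \<Longrightarrow> small v (f ` A)"
  unfolding small_def using image_lepoll lesspoll_trans1 by blast

text \<open>If the universe had \<open>n\<close> elements, a set with \<open>n - 1\<close> elements would be small, but its power set
  has \<open>2 ^ (n - 1) \<ge> n\<close> elements.\<close>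

lemma universe_infinite:
  assumes "universe TYPE('v)" shows "infinite (UNIV :: 'v set)"
proof
  assume fin: "finite (UNIV :: 'v set)"
  define n where "n = card (UNIV :: 'v set)"
  have n: "n > 0" using fin unfolding n_def by (simp add: finite_UNIV_card_ge_0)
  have lt: "small TYPE('v) S \<longleftrightarrow> finite S \<and> card S < n" for S :: "'b set"
  proof -
    have "(UNIV :: 'v set) \<approx> {..<n}" unfolding n_def by (subst eqpoll_iff_card) (simp_all add: fin)
    then have "S \<prec> (UNIV :: 'v set) \<longleftrightarrow> S \<prec> {..<n}"
      by (metis lesspoll_eq_trans eqpoll_sym)
    then show ?thesis unfolding small_def lesspoll_iff_finite_card .
  qed
  obtain S :: "'v set" where S: "card S = n - 1" "finite S"
    using obtain_subset_with_card_n[of "n - 1" "UNIV :: 'v set"] fin unfolding n_def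
    by (metis diff_le_self)
  have "small TYPE('v) (Pow S)"
    using assms lt[of S] S n unfolding universe_def by simp
  then have "2 ^ (n - 1) < n" using lt[of "Pow S"] S by (simp add: card_Pow)
  moreover have "n - 1 < 2 ^ (n - 1)" by (rule less_exp)
  ultimately show False by linarith
qed

lemma small_finite: "universe TYPE('v) \<Longrightarrow> finite A \<Longrightarrow> small TYPE('v) A"
  unfolding small_def using universe_infinite finite_lesspoll_infinite by blast

lemma small_UN:
  fixes I :: "'v set" and X :: "'v \<Rightarrow> 'v set"
  shows "universe TYPE('v) \<Longrightarrow> small TYPE('v) I \<Longrightarrow> (\<And>i. i \<in> I \<Longrightarrow> small TYPE('v) (X i)) \<Longrightarrow>
    small TYPE('v) (\<Union>i\<in>I. X i)"
  unfolding universe_def by blast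

text \<open>Pairs of elements of the universe have to be elements of the universe again, so that a
  fibre product of sheaves is a sheaf of sets in the universe.\<close>

lemma universe_pairing:
  assumes "universe TYPE('v)"
  obtains pair :: "'v \<Rightarrow> 'v \<Rightarrow> 'v" and p q where "\<And>x y. p (pair x y) = x" "\<And>x y. q (pair x y) = y"
proof -
  obtain c :: "'v \<times> 'v \<Rightarrow> 'v" where "bij_betw c (UNIV \<times> UNIV) UNIV"
    using card_of_Times_same_infinite[OF universe_infinite[OF assms], folded card_of_ordIso] by blast
  then have c: "inj c" unfolding bij_betw_def by simp
  show thesis
    by (rule that[of "\<lambda>z. fst (inv_into UNIV c z)" "\<lambda>x y. c (x, y)" "\<lambda>z. snd (inv_into UNIV c z)"])
      (simp_all add: inv_into_f_f[OF c])
qed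

lemma small_pairs:
  fixes pair :: "'v \<Rightarrow> 'v \<Rightarrow> 'v"
  assumes "universe TYPE('v)" "small TYPE('v) A" "small TYPE('v) B"
  shows "small TYPE('v) {pair x y |x y. x \<in> A \<and> y \<in> B}"
proof -
  have "small TYPE('v) (\<Union>x\<in>A. pair x ` B)"
    using assms by (intro small_UN small_image)
  then show ?thesis by (rule small_subset) blast
qed

lemma Ens_sel [simp]:
  "Ob (Ens :: ('v set, 'v \<Rightarrow> 'v) cat) = {X. small TYPE('v) X}"
  "Hom Ens X Y = X \<rightarrow>\<^sub>E Y" "Ident Ens X = (\<lambda>x\<in>X. x)" "Cmp Ens X Y Z g f = compose X g f"
  by (simp_all add: Ens_def)

lemma category_Ens: "category (Ens :: ('v set, 'v \<Rightarrow> 'v) cat)"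
  unfolding category_def
proof (intro conjI ballI)
  fix a b c d :: "'v set" and f g h assume "f \<in> Hom Ens a b" "g \<in> Hom Ens b c" "h \<in> Hom Ens c d"
  then show "Cmp Ens a c d h (Cmp Ens a b c g f) = Cmp Ens a b d (Cmp Ens b c d h g) f"
    by (auto simp: compose_def PiE_iff fun_eq_iff)
qed (auto simp: compose_def PiE_iff extensional_def fun_eq_iff)

section \<open>Properties shared by all categories of sheaves\<close>

definition initial_object :: "('o, 'm) cat \<Rightarrow> 'o \<Rightarrow> bool" where
  "initial_object C I \<longleftrightarrow> I \<in> Ob C \<and> (\<forall>X\<in>Ob C. \<exists>!f. f \<in> Hom C I X)"

definition has_strict_initial :: "('o, 'm) cat \<Rightarrow> bool" where
  "has_strict_initial C \<longleftrightarrow>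
     (\<exists>I. initial_object C I \<and> (\<forall>V\<in>Ob C. Hom C V I \<noteq> {} \<longrightarrow> initial_object C V))"

definition has_equalizers :: "('o, 'm) cat \<Rightarrow> bool" where
  "has_equalizers C \<longleftrightarrow> (\<forall>X\<in>Ob C. \<forall>Y\<in>Ob C. \<forall>f\<in>Hom C X Y. \<forall>g\<in>Hom C X Y.
     \<exists>W\<in>Ob C. \<exists>k\<in>Hom C W X. Cmp C W X Y f k = Cmp C W X Y g k \<and>
       (\<forall>Z\<in>Ob C. \<forall>z\<in>Hom C Z X. Cmp C Z X Y f z = Cmp C Z X Y g z \<longrightarrow>
          (\<exists>!u. u \<in> Hom C Z W \<and> Cmp C Z W X k u = z)))"

definition has_pullbacks :: "('o, 'm) cat \<Rightarrow> bool" where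
  "has_pullbacks C \<longleftrightarrow> (\<forall>X\<in>Ob C. \<forall>U\<in>Ob C. \<forall>V\<in>Ob C. \<forall>m\<in>Hom C U X. \<forall>n\<in>Hom C V X.
     \<exists>W\<in>Ob C. \<exists>a\<in>Hom C W U. \<exists>b\<in>Hom C W V. Cmp C W U X m a = Cmp C W V X n b \<and>
       (\<forall>Z\<in>Ob C. \<forall>u\<in>Hom C Z U. \<forall>v\<in>Hom C Z V. Cmp C Z U X m u = Cmp C Z V X n v \<longrightarrow>
          (\<exists>!t. t \<in> Hom C Z W \<and> Cmp C Z W U a t = u \<and> Cmp C Z W V b t = v)))"

text \<open>The two arrows have empty intersection and no proper subobject of \<open>X\<close> contains both of them.
  Both conditions speak of arbitrary test objects, so that they are visibly invariant under
  equivalence.\<close>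

definition covers_disjointly ::
  "('o, 'm) cat \<Rightarrow> 'o \<Rightarrow> 'o \<Rightarrow> 'm \<Rightarrow> 'o \<Rightarrow> 'm \<Rightarrow> bool" where
  "covers_disjointly C X U m V n \<longleftrightarrow>
     (\<forall>W\<in>Ob C. \<forall>a\<in>Hom C W U. \<forall>b\<in>Hom C W V.
        Cmp C W U X m a = Cmp C W V X n b \<longrightarrow> initial_object C W) \<and>
     (\<forall>W\<in>Ob C. \<forall>k. is_mono C W X k \<longrightarrow> sub_le C X U m W k \<longrightarrow> sub_le C X V n W k \<longrightarrow>
        (\<exists>s\<in>Hom C X W. Cmp C X W X k s = Ident C X))"

text \<open>The arrows to be glued are restrictions of arrows \<open>c0\<close> and \<open>c1\<close> defined on all of \<open>X\<close>. Their
  values at a section therefore depend only on its image in \<open>X\<close>, so for sheaves the glued arrow can be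
  defined on the images of \<open>m\<close> and \<open>n\<close> directly.\<close>

definition glues_disjoint_covers :: "('o, 'm) cat \<Rightarrow> bool" where
  "glues_disjoint_covers C \<longleftrightarrow> (\<forall>X\<in>Ob C. \<forall>U\<in>Ob C. \<forall>V\<in>Ob C. \<forall>m\<in>Hom C U X. \<forall>n\<in>Hom C V X.
     covers_disjointly C X U m V n \<longrightarrow>
     (\<forall>Y\<in>Ob C. \<forall>c0\<in>Hom C X Y. \<forall>c1\<in>Hom C X Y.
        \<exists>h\<in>Hom C X Y. Cmp C U X Y h m = Cmp C U X Y c0 m \<and> Cmp C V X Y h n = Cmp C V X Y c1 n))"

section \<open>Sheaves on a site\<close>

lemma op_cat_sel [simp]:
  "Ob (op_cat C) = Ob C" "Hom (op_cat C) a b = Hom C b a" "Ident (op_cat C) = Ident C"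
  "Cmp (op_cat C) a b c g f = Cmp C c b a f g"
  by (simp_all add: op_cat_def)

locale site =
  fixes C :: "('v, 'v) cat" and J :: "'v \<Rightarrow> ('v \<times> 'v) set set"
  assumes C: "category C" and topology: "grothendieck_topology C J" and univ: "universe TYPE('v)"
begin

abbreviation "Sh \<equiv> sheaf_cat C J"

lemma covering_sieve:
  assumes "u \<in> Ob C" "S \<in> J u"
  shows "\<And>a f. (a, f) \<in> S \<Longrightarrow> a \<in> Ob C" "\<And>a f. (a, f) \<in> S \<Longrightarrow> f \<in> Hom C a u"
    "\<And>a f b g. (a, f) \<in> S \<Longrightarrow> b \<in> Ob C \<Longrightarrow> g \<in> Hom C b a \<Longrightarrow> (b, Cmp C b a u f g) \<in> S"
proof -
  have "is_sieve C u S" using topology assms unfolding grothendieck_topology_def by blast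
  then show "\<And>a f. (a, f) \<in> S \<Longrightarrow> a \<in> Ob C" "\<And>a f. (a, f) \<in> S \<Longrightarrow> f \<in> Hom C a u"
    "\<And>a f b g. (a, f) \<in> S \<Longrightarrow> b \<in> Ob C \<Longrightarrow> g \<in> Hom C b a \<Longrightarrow> (b, Cmp C b a u f g) \<in> S"
    unfolding is_sieve_def by auto
qed

lemma maximal_covers: "u \<in> Ob C \<Longrightarrow> maximal_sieve C u \<in> J u"
  using topology unfolding grothendieck_topology_def by blast

lemma pullback_covers:
  "u \<in> Ob C \<Longrightarrow> a \<in> Ob C \<Longrightarrow> h \<in> Hom C a u \<Longrightarrow> S \<in> J u \<Longrightarrow> pullback_sieve C a u h S \<in> J a"
  using topology unfolding grothendieck_topology_def by blast

lemma transitive_covers: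
  "u \<in> Ob C \<Longrightarrow> S \<in> J u \<Longrightarrow> is_sieve C u R \<Longrightarrow>
    (\<And>a f. (a, f) \<in> S \<Longrightarrow> pullback_sieve C a u f R \<in> J a) \<Longrightarrow> R \<in> J u"
proof -
  assume u: "u \<in> Ob C" "S \<in> J u" "is_sieve C u R"
    and loc: "\<And>a f. (a, f) \<in> S \<Longrightarrow> pullback_sieve C a u f R \<in> J a"
  have "\<forall>(a, f)\<in>S. pullback_sieve C a u f R \<in> J a" using loc by auto
  moreover have "\<forall>u\<in>Ob C. \<forall>S\<in>J u. \<forall>R. is_sieve C u R \<longrightarrow>
      (\<forall>(a, f)\<in>S. pullback_sieve C a u f R \<in> J a) \<longrightarrow> R \<in> J u"
    using topology unfolding grothendieck_topology_def by (elim conjE)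
  ultimately show "R \<in> J u" using u by blast
qed

text \<open>The objects covered by the empty sieve are those on which every sheaf has exactly one
  section; the initial sheaf lives on them.\<close>

lemma empty_covers_stable:
  assumes "{} \<in> J a" "a \<in> Ob C" "b \<in> Ob C" "f \<in> Hom C b a"
  shows "{} \<in> J b"
  using pullback_covers[OF assms(2,3,4,1)] by (simp add: pullback_sieve_def)

lemma presheaf_iff:
  "is_functor (op_cat C) (Ens :: ('v set, 'v \<Rightarrow> 'v) cat) P \<longleftrightarrow>
     (\<forall>a\<in>Ob C. small TYPE('v) (FOb P a)) \<and>
     (\<forall>a\<in>Ob C. \<forall>b\<in>Ob C. \<forall>f\<in>Hom C b a. FMor P a b f \<in> FOb P a \<rightarrow>\<^sub>E FOb P b) \<and>
     (\<forall>a\<in>Ob C. \<forall>x\<in>FOb P a. FMor P a a (Ident C a) x = x) \<and>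
     (\<forall>a\<in>Ob C. \<forall>b\<in>Ob C. \<forall>c\<in>Ob C. \<forall>f\<in>Hom C b a. \<forall>g\<in>Hom C c b. \<forall>x\<in>FOb P a.
        FMor P a c (Cmp C c b a f g) x = FMor P b c g (FMor P a b f x))" (is "?L \<longleftrightarrow> ?R")
proof
  assume L: ?L
  have m: "FMor P a b f \<in> FOb P a \<rightarrow>\<^sub>E FOb P b" if "a \<in> Ob C" "b \<in> Ob C" "f \<in> Hom C b a" for a b f
    using functor_mor[OF L, of a b f] that by simp
  show ?R
  proof (intro conjI ballI)
    fix a b c f g x assume *: "a \<in> Ob C" "b \<in> Ob C" "c \<in> Ob C" "f \<in> Hom C b a" "g \<in> Hom C c b" "x \<in> FOb P a"
    then show "FMor P a c (Cmp C c b a f g) x = FMor P b c g (FMor P a b f x)"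
      using functor_cmp[OF L, of a b c f g] by (simp add: compose_def)
  next
    fix a x assume "a \<in> Ob C" "x \<in> FOb P a"
    then show "FMor P a a (Ident C a) x = x"
      using functor_ident[OF L, of a] by simp
  qed (use functor_ob[OF L] m in auto)
next
  assume R: ?R
  show ?L
    unfolding is_functor_def
  proof (intro conjI ballI)
    fix a assume a: "a \<in> Ob (op_cat C)"
    then have "FMor P a a (Ident C a) \<in> FOb P a \<rightarrow>\<^sub>E FOb P a"
      using R category_ident[OF C] by simp
    then show "FMor P a a (Ident (op_cat C) a) = Ident Ens (FOb P a)"
      using R a by (auto simp: fun_eq_iff PiE_iff extensional_def)
  next
    fix a b c f g assume *: "a \<in> Ob (op_cat C)" "b \<in> Ob (op_cat C)" "c \<in> Ob (op_cat C)"
      "f \<in> Hom (op_cat C) a b" "g \<in> Hom (op_cat C) b c"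
    then have "FMor P a c (Cmp C c b a f g) \<in> FOb P a \<rightarrow>\<^sub>E FOb P c"
      using R category_cmp[OF C] by simp
    then show "FMor P a c (Cmp (op_cat C) a b c g f) =
       Cmp Ens (FOb P a) (FOb P b) (FOb P c) (FMor P b c g) (FMor P a b f)"
      using R * by (auto simp: fun_eq_iff PiE_iff extensional_def compose_def)
  qed (use R in auto)
qed

lemma Sh_ob: "P \<in> Ob Sh \<longleftrightarrow> is_sheaf C J P"
  by (auto simp: sheaf_cat_def full_subcat_def functor_cat_def is_sheaf_def)

lemma sheaf_rules:
  assumes "P \<in> Ob Sh"
  shows sheaf_small: "\<And>a. a \<in> Ob C \<Longrightarrow> small TYPE('v) (FOb P a)"
    and restr_in: "\<And>a b f x. a \<in> Ob C \<Longrightarrow> b \<in> Ob C \<Longrightarrow> f \<in> Hom C b a \<Longrightarrow> x \<in> FOb P a \<Longrightarrow>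
      FMor P a b f x \<in> FOb P b"
    and restr_ident: "\<And>a x. a \<in> Ob C \<Longrightarrow> x \<in> FOb P a \<Longrightarrow> FMor P a a (Ident C a) x = x"
    and restr_cmp: "\<And>a b c f g x. a \<in> Ob C \<Longrightarrow> b \<in> Ob C \<Longrightarrow> c \<in> Ob C \<Longrightarrow> f \<in> Hom C b a \<Longrightarrow>
      g \<in> Hom C c b \<Longrightarrow> x \<in> FOb P a \<Longrightarrow> FMor P a c (Cmp C c b a f g) x = FMor P b c g (FMor P a b f x)"
  using assms[unfolded Sh_ob is_sheaf_def presheaf_iff] by (auto simp: PiE_iff)

lemma sheaf_glue:
  assumes P: "P \<in> Ob Sh" and u: "u \<in> Ob C" and S: "S \<in> J u"
    and x: "\<And>a f. (a, f) \<in> S \<Longrightarrow> x a f \<in> FOb P a"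
    and m: "\<And>a f b g. (a, f) \<in> S \<Longrightarrow> b \<in> Ob C \<Longrightarrow> g \<in> Hom C b a \<Longrightarrow>
      FMor P a b g (x a f) = x b (Cmp C b a u f g)"
  shows "\<exists>y\<in>FOb P u. \<forall>a f. (a, f) \<in> S \<longrightarrow> FMor P u a f y = x a f"
proof -
  have "matching_family C P u S x" unfolding matching_family_def using x m by auto
  then have "\<exists>!y. y \<in> FOb P u \<and> (\<forall>(a, f)\<in>S. FMor P u a f y = x a f)"
    using P u S unfolding Sh_ob is_sheaf_def by blast
  then obtain y where "y \<in> FOb P u" "\<forall>(a, f)\<in>S. FMor P u a f y = x a f" by (elim ex1E conjE)
  then show ?thesis by blast
qed

lemma sheaf_separated:
  assumes P: "P \<in> Ob Sh" and u: "u \<in> Ob C" and S: "S \<in> J u" and y: "y \<in> FOb P u" "z \<in> FOb P u"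
    and eq: "\<And>a f. (a, f) \<in> S \<Longrightarrow> FMor P u a f y = FMor P u a f z"
  shows "y = z"
proof -
  have "matching_family C P u S (\<lambda>a f. FMor P u a f y)"
    unfolding matching_family_def
    using covering_sieve[OF u S] u y sheaf_rules[OF P] by auto
  then have ex1: "\<exists>!z. z \<in> FOb P u \<and> (\<forall>(a, f)\<in>S. FMor P u a f z = FMor P u a f y)"
    using P u S unfolding Sh_ob is_sheaf_def by blast
  have "\<forall>(a, f)\<in>S. FMor P u a f z = FMor P u a f y" using eq by auto
  then show ?thesis using the1_equality[OF ex1, of y] the1_equality[OF ex1, of z] y by simp
qed

lemma Sh_obI:
  assumes sm: "\<And>a. a \<in> Ob C \<Longrightarrow> small TYPE('v) (FOb P a)"
    and fn: "\<And>a b f. a \<in> Ob C \<Longrightarrow> b \<in> Ob C \<Longrightarrow> f \<in> Hom C b a \<Longrightarrow> FMor P a b f \<in> FOb P a \<rightarrow>\<^sub>E FOb P b"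
    and idn: "\<And>a x. a \<in> Ob C \<Longrightarrow> x \<in> FOb P a \<Longrightarrow> FMor P a a (Ident C a) x = x"
    and cmp: "\<And>a b c f g x. a \<in> Ob C \<Longrightarrow> b \<in> Ob C \<Longrightarrow> c \<in> Ob C \<Longrightarrow> f \<in> Hom C b a \<Longrightarrow>
      g \<in> Hom C c b \<Longrightarrow> x \<in> FOb P a \<Longrightarrow> FMor P a c (Cmp C c b a f g) x = FMor P b c g (FMor P a b f x)"
    and sep: "\<And>u S y z. u \<in> Ob C \<Longrightarrow> S \<in> J u \<Longrightarrow> y \<in> FOb P u \<Longrightarrow> z \<in> FOb P u \<Longrightarrow>
      (\<And>a f. (a, f) \<in> S \<Longrightarrow> FMor P u a f y = FMor P u a f z) \<Longrightarrow> y = z"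
    and glue: "\<And>u S x. u \<in> Ob C \<Longrightarrow> S \<in> J u \<Longrightarrow> (\<And>a f. (a, f) \<in> S \<Longrightarrow> x a f \<in> FOb P a) \<Longrightarrow>
      (\<And>a f b g. (a, f) \<in> S \<Longrightarrow> b \<in> Ob C \<Longrightarrow> g \<in> Hom C b a \<Longrightarrow>
        FMor P a b g (x a f) = x b (Cmp C b a u f g)) \<Longrightarrow>
      \<exists>y\<in>FOb P u. \<forall>a f. (a, f) \<in> S \<longrightarrow> FMor P u a f y = x a f"
  shows "P \<in> Ob Sh"
  unfolding Sh_ob is_sheaf_def presheaf_iff
proof (intro conjI ballI allI impI)
  fix u S x assume u: "u \<in> Ob C" and S: "S \<in> J u" and m: "matching_family C P u S x"
  have "\<exists>y\<in>FOb P u. \<forall>a f. (a, f) \<in> S \<longrightarrow> FMor P u a f y = x a f"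
  proof (rule glue[OF u S])
    show "x a f \<in> FOb P a" if "(a, f) \<in> S" for a f
      using m that unfolding matching_family_def by (elim conjE) (drule (1) bspec, simp)
    show "FMor P a b g (x a f) = x b (Cmp C b a u f g)" if "(a, f) \<in> S" "b \<in> Ob C" "g \<in> Hom C b a" for a f b g
    proof -
      have "\<forall>(a, f)\<in>S. \<forall>b\<in>Ob C. \<forall>g\<in>Hom C b a. FMor P a b g (x a f) = x b (Cmp C b a u f g)"
        using m unfolding matching_family_def by (elim conjE)
      from bspec[OF this that(1)] show ?thesis using that(2,3) by simp
    qed
  qed
  then obtain y where y: "y \<in> FOb P u" "\<forall>a f. (a, f) \<in> S \<longrightarrow> FMor P u a f y = x a f" by blast
  show "\<exists>!y. y \<in> FOb P u \<and> (\<forall>(a, f)\<in>S. FMor P u a f y = x a f)"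
  proof (rule ex1I[of _ y])
    show "y \<in> FOb P u \<and> (\<forall>(a, f)\<in>S. FMor P u a f y = x a f)" using y by blast
    fix z assume z: "z \<in> FOb P u \<and> (\<forall>(a, f)\<in>S. FMor P u a f z = x a f)"
    show "z = y"
    proof (rule sep[OF u S])
      fix a f assume af: "(a, f) \<in> S"
      then have "FMor P u a f z = x a f" using z by blast
      then show "FMor P u a f z = FMor P u a f y" using y(2) af by simp
    qed (use y z in simp_all)
  qed
qed (use sm fn idn cmp in auto)

lemma Sh_hom:
  assumes "P \<in> Ob Sh" "Q \<in> Ob Sh"
  shows "\<tau> \<in> Hom Sh P Q \<longleftrightarrow> \<tau> \<in> extensional (Ob C) \<and>
     (\<forall>a\<in>Ob C. \<tau> a \<in> FOb P a \<rightarrow>\<^sub>E FOb Q a) \<and>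
     (\<forall>a\<in>Ob C. \<forall>b\<in>Ob C. \<forall>f\<in>Hom C b a. \<forall>x\<in>FOb P a. \<tau> b (FMor P a b f x) = FMor Q a b f (\<tau> a x))"
    (is "_ \<longleftrightarrow> ?R")
proof -
  have "compose (FOb P a) (\<tau> b) (FMor P a b f) = compose (FOb P a) (FMor Q a b f) (\<tau> a) \<longleftrightarrow>
      (\<forall>x\<in>FOb P a. \<tau> b (FMor P a b f x) = FMor Q a b f (\<tau> a x))" for a b f
    by (auto simp: compose_def fun_eq_iff)
  then show ?thesis
    by (auto simp: sheaf_cat_def full_subcat_def functor_cat_def nat_trans_def)
qed

lemma Sh_hom_rules:
  assumes "P \<in> Ob Sh" "Q \<in> Ob Sh" "\<tau> \<in> Hom Sh P Q"
  shows Sh_hom_ext: "\<tau> \<in> extensional (Ob C)"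
    and Sh_hom_fun: "\<And>a. a \<in> Ob C \<Longrightarrow> \<tau> a \<in> FOb P a \<rightarrow>\<^sub>E FOb Q a"
    and Sh_hom_in: "\<And>a x. a \<in> Ob C \<Longrightarrow> x \<in> FOb P a \<Longrightarrow> \<tau> a x \<in> FOb Q a"
    and Sh_hom_nat: "\<And>a b f x. a \<in> Ob C \<Longrightarrow> b \<in> Ob C \<Longrightarrow> f \<in> Hom C b a \<Longrightarrow> x \<in> FOb P a \<Longrightarrow>
      \<tau> b (FMor P a b f x) = FMor Q a b f (\<tau> a x)"
  using assms(3) unfolding Sh_hom[OF assms(1,2)] by (auto simp: PiE_iff)

lemma Sh_homI:
  assumes "P \<in> Ob Sh" "Q \<in> Ob Sh"
    and "\<And>a x. a \<in> Ob C \<Longrightarrow> x \<in> FOb P a \<Longrightarrow> t a x \<in> FOb Q a"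
    and "\<And>a b f x. a \<in> Ob C \<Longrightarrow> b \<in> Ob C \<Longrightarrow> f \<in> Hom C b a \<Longrightarrow> x \<in> FOb P a \<Longrightarrow>
      t b (FMor P a b f x) = FMor Q a b f (t a x)"
  shows "(\<lambda>a\<in>Ob C. \<lambda>x\<in>FOb P a. t a x) \<in> Hom Sh P Q"
  unfolding Sh_hom[OF assms(1,2)] using assms(3,4) restr_in[OF assms(1)] by auto

lemma Sh_hom_eqI:
  assumes "P \<in> Ob Sh" "Q \<in> Ob Sh" "\<sigma> \<in> Hom Sh P Q" "\<tau> \<in> Hom Sh P Q"
    and eq: "\<And>a x. a \<in> Ob C \<Longrightarrow> x \<in> FOb P a \<Longrightarrow> \<sigma> a x = \<tau> a x"
  shows "\<sigma> = \<tau>"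
proof (rule extensionalityI[OF Sh_hom_ext[OF assms(1,2,3)] Sh_hom_ext[OF assms(1,2,4)]])
  fix a assume a: "a \<in> Ob C"
  show "\<sigma> a = \<tau> a"
    by (rule PiE_ext[OF Sh_hom_fun[OF assms(1,2,3) a] Sh_hom_fun[OF assms(1,2,4) a] eq[OF a]])
qed

lemma Sh_cmp [simp]:
  "Cmp Sh P Q R \<tau> \<sigma> = (\<lambda>a\<in>Ob C. compose (FOb P a) (\<tau> a) (\<sigma> a))"
  by (simp add: sheaf_cat_def full_subcat_def functor_cat_def)

lemma Sh_ident: "Ident Sh P = (\<lambda>a\<in>Ob C. \<lambda>x\<in>FOb P a. x)"
  by (simp add: sheaf_cat_def full_subcat_def functor_cat_def)

lemma Sh_cmp_apply: "a \<in> Ob C \<Longrightarrow> x \<in> FOb P a \<Longrightarrow> Cmp Sh P Q R \<tau> \<sigma> a x = \<tau> a (\<sigma> a x)"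
  by (simp add: compose_def)

lemma Sh_cmp_eq_iff:
  "Cmp Sh P Q R \<tau> \<sigma> = Cmp Sh P Q' R \<tau>' \<sigma>' \<longleftrightarrow>
     (\<forall>a\<in>Ob C. \<forall>x\<in>FOb P a. \<tau> a (\<sigma> a x) = \<tau>' a (\<sigma>' a x))"
proof
  assume eq: "Cmp Sh P Q R \<tau> \<sigma> = Cmp Sh P Q' R \<tau>' \<sigma>'"
  show "\<forall>a\<in>Ob C. \<forall>x\<in>FOb P a. \<tau> a (\<sigma> a x) = \<tau>' a (\<sigma>' a x)"
    using Sh_cmp_apply[of _ _ P Q R \<tau> \<sigma>] Sh_cmp_apply[of _ _ P Q' R \<tau>' \<sigma>'] unfolding eq by metis
next
  assume "\<forall>a\<in>Ob C. \<forall>x\<in>FOb P a. \<tau> a (\<sigma> a x) = \<tau>' a (\<sigma>' a x)"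
  then show "Cmp Sh P Q R \<tau> \<sigma> = Cmp Sh P Q' R \<tau>' \<sigma>'"
    by (simp add: compose_def cong: restrict_cong)
qed

lemma category_Sh: "category Sh"
  unfolding category_def
proof (intro conjI ballI)
  fix P assume P: "P \<in> Ob Sh"
  show "Ident Sh P \<in> Hom Sh P P"
    unfolding Sh_ident by (rule Sh_homI[OF P P]) auto
next
  fix P Q f assume PQ: "P \<in> Ob Sh" "Q \<in> Ob Sh" and f: "f \<in> Hom Sh P Q"
  have f': "f a x = undefined" if "a \<in> Ob C" "x \<notin> FOb P a" for a x
    using Sh_hom_fun[OF PQ f that(1)] that(2) by (auto simp: PiE_iff extensional_def)
  have f'': "f a = undefined" if "a \<notin> Ob C" for a
    using Sh_hom_ext[OF PQ f] that by (auto simp: extensional_def)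
  show "Cmp Sh P P Q f (Ident Sh P) = f"
    by (rule ext, rule ext) (simp add: Sh_ident compose_def restrict_def f' f'')
  show "Cmp Sh P Q Q (Ident Sh Q) f = f"
    by (rule ext, rule ext) (simp add: Sh_ident compose_def restrict_def f' f'' Sh_hom_in[OF PQ f])
next
  fix P Q R f g assume PQR: "P \<in> Ob Sh" "Q \<in> Ob Sh" "R \<in> Ob Sh" and f: "f \<in> Hom Sh P Q" and g: "g \<in> Hom Sh Q R"
  have "(\<lambda>a\<in>Ob C. \<lambda>x\<in>FOb P a. g a (f a x)) \<in> Hom Sh P R"
    by (rule Sh_homI[OF PQR(1,3)])
      (simp_all add: Sh_hom_in[OF PQR(1,2) f] Sh_hom_in[OF PQR(2,3) g] Sh_hom_nat[OF PQR(1,2) f]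
        Sh_hom_nat[OF PQR(2,3) g])
  then show "Cmp Sh P Q R g f \<in> Hom Sh P R" by (simp add: compose_def)
next
  fix P Q R T f g h assume "P \<in> Ob Sh" "Q \<in> Ob Sh" "R \<in> Ob Sh" "T \<in> Ob Sh" and "f \<in> Hom Sh P Q"
    and "g \<in> Hom Sh Q R" "h \<in> Hom Sh R T"
  then show "Cmp Sh P R T h (Cmp Sh P Q R g f) = Cmp Sh P Q T (Cmp Sh Q R T h g) f"
    unfolding Sh_cmp_eq_iff by (simp add: Sh_cmp_apply Sh_hom_in del: Sh_cmp)
qed

text \<open>Subsheaves are given by predicates on sections. The condition \<open>local_property\<close> below says that
  the predicate is stable under restriction and can be checked on a covering sieve.\<close>

definition subsheaf :: "('v, 'v, 'v set, 'v \<Rightarrow> 'v) fctr \<Rightarrow> ('v \<Rightarrow> 'v \<Rightarrow> bool) \<Rightarrow>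
    ('v, 'v, 'v set, 'v \<Rightarrow> 'v) fctr" where
  "subsheaf X Q = \<lparr>FOb = (\<lambda>a. {x \<in> FOb X a. Q a x}),
     FMor = (\<lambda>a b f. \<lambda>x\<in>{x \<in> FOb X a. Q a x}. FMor X a b f x)\<rparr>"

lemma subsheaf_sel:
  "FOb (subsheaf X Q) a = {x \<in> FOb X a. Q a x}"
  "x \<in> FOb X a \<Longrightarrow> Q a x \<Longrightarrow> FMor (subsheaf X Q) a b f x = FMor X a b f x"
  by (simp_all add: subsheaf_def)

definition local_property :: "('v, 'v, 'v set, 'v \<Rightarrow> 'v) fctr \<Rightarrow> ('v \<Rightarrow> 'v \<Rightarrow> bool) \<Rightarrow> bool" where
  "local_property X Q \<longleftrightarrow>
     (\<forall>a\<in>Ob C. \<forall>b\<in>Ob C. \<forall>f\<in>Hom C b a. \<forall>x\<in>FOb X a. Q a x \<longrightarrow> Q b (FMor X a b f x)) \<and>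
     (\<forall>u\<in>Ob C. \<forall>S\<in>J u. \<forall>x\<in>FOb X u. (\<forall>(a, f)\<in>S. Q a (FMor X u a f x)) \<longrightarrow> Q u x)"

lemma subsheaf:
  assumes X: "X \<in> Ob Sh" and Q: "local_property X Q"
  shows "subsheaf X Q \<in> Ob Sh"
proof (rule Sh_obI)
  have stab: "Q b (FMor X a b f x)" if "a \<in> Ob C" "b \<in> Ob C" "f \<in> Hom C b a" "x \<in> FOb X a" "Q a x" for a b f x
    using Q that unfolding local_property_def by blast
  show "small TYPE('v) (FOb (subsheaf X Q) a)" if "a \<in> Ob C" for a
    using small_subset[OF sheaf_small[OF X that], of "FOb (subsheaf X Q) a"] by (auto simp: subsheaf_sel)
  show "FMor (subsheaf X Q) a b f \<in> FOb (subsheaf X Q) a \<rightarrow>\<^sub>E FOb (subsheaf X Q) b"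
    if "a \<in> Ob C" "b \<in> Ob C" "f \<in> Hom C b a" for a b f
    using that stab restr_in[OF X] by (auto simp: subsheaf_def)
  show "FMor (subsheaf X Q) a a (Ident C a) x = x" if "a \<in> Ob C" "x \<in> FOb (subsheaf X Q) a" for a x
    using that by (auto simp: subsheaf_sel restr_ident[OF X])
  show "FMor (subsheaf X Q) a c (Cmp C c b a f g) x = FMor (subsheaf X Q) b c g (FMor (subsheaf X Q) a b f x)"
    if "a \<in> Ob C" "b \<in> Ob C" "c \<in> Ob C" "f \<in> Hom C b a" "g \<in> Hom C c b" "x \<in> FOb (subsheaf X Q) a"
    for a b c f g x
    using that stab by (auto simp: subsheaf_sel restr_cmp[OF X] restr_in[OF X])
  show "y = z" if u: "u \<in> Ob C" and S: "S \<in> J u" and y: "y \<in> FOb (subsheaf X Q) u" and z: "z \<in> FOb (subsheaf X Q) u"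
    and eq: "\<And>a f. (a, f) \<in> S \<Longrightarrow> FMor (subsheaf X Q) u a f y = FMor (subsheaf X Q) u a f z" for u S y z
    using sheaf_separated[OF X u S, of y z] y z eq by (auto simp: subsheaf_sel)
  fix u S x assume u: "u \<in> Ob C" and S: "S \<in> J u"
    and x: "\<And>a f. (a, f) \<in> S \<Longrightarrow> x a f \<in> FOb (subsheaf X Q) a"
    and m: "\<And>a f b g. (a, f) \<in> S \<Longrightarrow> b \<in> Ob C \<Longrightarrow> g \<in> Hom C b a \<Longrightarrow>
        FMor (subsheaf X Q) a b g (x a f) = x b (Cmp C b a u f g)"
  obtain y where y: "y \<in> FOb X u" "\<And>a f. (a, f) \<in> S \<Longrightarrow> FMor X u a f y = x a f"
    using sheaf_glue[OF X u S, of x] x m by (auto simp: subsheaf_sel)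
  have "Q u y" using Q u S y x unfolding local_property_def by (fastforce simp: subsheaf_sel)
  then show "\<exists>y\<in>FOb (subsheaf X Q) u. \<forall>a f. (a, f) \<in> S \<longrightarrow> FMor (subsheaf X Q) u a f y = x a f"
    using y by (auto simp: subsheaf_sel)
qed

definition incl :: "('v, 'v, 'v set, 'v \<Rightarrow> 'v) fctr \<Rightarrow> 'v \<Rightarrow> 'v \<Rightarrow> 'v" where
  "incl W = (\<lambda>a\<in>Ob C. \<lambda>x\<in>FOb W a. x)"

lemma incl_apply: "a \<in> Ob C \<Longrightarrow> x \<in> FOb W a \<Longrightarrow> incl W a x = x"
  by (simp add: incl_def)

lemma incl_hom:
  assumes X: "X \<in> Ob Sh" and Q: "local_property X Q"
  shows "incl (subsheaf X Q) \<in> Hom Sh (subsheaf X Q) X"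
  unfolding incl_def by (rule Sh_homI[OF subsheaf[OF X Q] X]) (auto simp: subsheaf_sel)

lemma subsheaf_factor:
  assumes X: "X \<in> Ob Sh" and Q: "local_property X Q" and Z: "Z \<in> Ob Sh" and z: "z \<in> Hom Sh Z X"
    and zQ: "\<And>a x. a \<in> Ob C \<Longrightarrow> x \<in> FOb Z a \<Longrightarrow> Q a (z a x)"
  shows "z \<in> Hom Sh Z (subsheaf X Q)" "Cmp Sh Z (subsheaf X Q) X (incl (subsheaf X Q)) z = z"
proof -
  show z': "z \<in> Hom Sh Z (subsheaf X Q)"
    unfolding Sh_hom[OF Z subsheaf[OF X Q]]
    using Sh_hom_rules[OF Z X z] zQ by (auto simp: subsheaf_sel PiE_iff)
  show "Cmp Sh Z (subsheaf X Q) X (incl (subsheaf X Q)) z = z"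
    by (rule Sh_hom_eqI[OF Z X category_cmp[OF category_Sh Z subsheaf[OF X Q] X z' incl_hom[OF X Q]] z])
      (use zQ Sh_hom_in[OF Z X z] in \<open>simp add: Sh_cmp_apply incl_apply subsheaf_sel del: Sh_cmp\<close>)
qed

lemma incl_cancel:
  assumes X: "X \<in> Ob Sh" and Q: "local_property X Q" and Z: "Z \<in> Ob Sh"
    and f: "f \<in> Hom Sh Z (subsheaf X Q)" and g: "g \<in> Hom Sh Z (subsheaf X Q)"
    and eq: "Cmp Sh Z (subsheaf X Q) X (incl (subsheaf X Q)) f = Cmp Sh Z (subsheaf X Q) X (incl (subsheaf X Q)) g"
  shows "f = g"
proof -
  note W = subsheaf[OF X Q]
  show ?thesis
    by (rule Sh_hom_eqI[OF Z W f g])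
      (use eq Sh_hom_in[OF Z W f] Sh_hom_in[OF Z W g] in \<open>auto simp: Sh_cmp_eq_iff incl_apply simp del: Sh_cmp\<close>)
qed

lemma Sh_has_equalizers: "has_equalizers Sh"
  unfolding has_equalizers_def
proof (intro ballI)
  fix X Y f g assume X: "X \<in> Ob Sh" and Y: "Y \<in> Ob Sh" and f: "f \<in> Hom Sh X Y" and g: "g \<in> Hom Sh X Y"
  define Q where "Q a x \<longleftrightarrow> f a x = g a x" for a x
  have Q: "local_property X Q"
    unfolding local_property_def
  proof (intro conjI ballI impI)
    fix u S x assume u: "u \<in> Ob C" and S: "S \<in> J u" and x: "x \<in> FOb X u"
      and loc: "\<forall>(a, f)\<in>S. Q a (FMor X u a f x)"
    show "Q u x"
      unfolding Q_def
    proof (rule sheaf_separated[OF Y u S])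
      fix a t assume t: "(a, t) \<in> S"
      note t' = covering_sieve(1,2)[OF u S t]
      show "FMor Y u a t (f u x) = FMor Y u a t (g u x)"
        using loc t by (auto simp: Q_def Sh_hom_nat[OF X Y f u t' x] Sh_hom_nat[OF X Y g u t' x])
    qed (use u x in \<open>auto simp: Sh_hom_in[OF X Y f] Sh_hom_in[OF X Y g]\<close>)
  qed (simp add: Q_def Sh_hom_nat[OF X Y f] Sh_hom_nat[OF X Y g])
  show "\<exists>W\<in>Ob Sh. \<exists>k\<in>Hom Sh W X. Cmp Sh W X Y f k = Cmp Sh W X Y g k \<and>
       (\<forall>Z\<in>Ob Sh. \<forall>z\<in>Hom Sh Z X. Cmp Sh Z X Y f z = Cmp Sh Z X Y g z \<longrightarrow>
          (\<exists>!u. u \<in> Hom Sh Z W \<and> Cmp Sh Z W X k u = z))"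
  proof (intro bexI[OF _ subsheaf[OF X Q]] bexI[OF _ incl_hom[OF X Q]] conjI ballI impI)
    show "Cmp Sh (subsheaf X Q) X Y f (incl (subsheaf X Q)) = Cmp Sh (subsheaf X Q) X Y g (incl (subsheaf X Q))"
      unfolding Sh_cmp_eq_iff by (simp add: incl_apply) (simp add: subsheaf_sel Q_def)
    fix Z z assume Z: "Z \<in> Ob Sh" and z: "z \<in> Hom Sh Z X" and eq: "Cmp Sh Z X Y f z = Cmp Sh Z X Y g z"
    have zQ: "Q a (z a x)" if "a \<in> Ob C" "x \<in> FOb Z a" for a x
      using eq that unfolding Sh_cmp_eq_iff Q_def by blast
    show "\<exists>!u. u \<in> Hom Sh Z (subsheaf X Q) \<and> Cmp Sh Z (subsheaf X Q) X (incl (subsheaf X Q)) u = z"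
      using subsheaf_factor[OF X Q Z z zQ] incl_cancel[OF X Q Z] by (intro ex1I[of _ z]) metis+
  qed
qed

text \<open>The fibre product consists of coded pairs of sections. Besides the universal property, the
  last conjunct records that matching sections give a section of the fibre product; an arrow-theoretic
  hypothesis on \<open>W\<close> can thereby be evaluated at single sections.\<close>

lemma Sh_pullback:
  assumes X: "X \<in> Ob Sh" and U: "U \<in> Ob Sh" and V: "V \<in> Ob Sh"
    and m: "m \<in> Hom Sh U X" and n: "n \<in> Hom Sh V X"
  shows "\<exists>W\<in>Ob Sh. \<exists>a\<in>Hom Sh W U. \<exists>b\<in>Hom Sh W V. Cmp Sh W U X m a = Cmp Sh W V X n b \<and>
       (\<forall>Z\<in>Ob Sh. \<forall>u\<in>Hom Sh Z U. \<forall>v\<in>Hom Sh Z V. Cmp Sh Z U X m u = Cmp Sh Z V X n v \<longrightarrow>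
          (\<exists>!t. t \<in> Hom Sh Z W \<and> Cmp Sh Z W U a t = u \<and> Cmp Sh Z W V b t = v)) \<and>
       (\<forall>c\<in>Ob C. \<forall>x\<in>FOb U c. \<forall>y\<in>FOb V c. m c x = n c y \<longrightarrow> FOb W c \<noteq> {})"
proof -
  obtain pair :: "'v \<Rightarrow> 'v \<Rightarrow> 'v" and p q where p [simp]: "\<And>x y. p (pair x y) = x" and q [simp]: "\<And>x y. q (pair x y) = y"
    by (rule universe_pairing[OF univ]) (rule that)
  define W :: "('v, 'v, 'v set, 'v \<Rightarrow> 'v) fctr" where
    "W = \<lparr>FOb = (\<lambda>a. {pair x y |x y. x \<in> FOb U a \<and> y \<in> FOb V a \<and> m a x = n a y}),
       FMor = (\<lambda>a b f. \<lambda>z\<in>{pair x y |x y. x \<in> FOb U a \<and> y \<in> FOb V a \<and> m a x = n a y}.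
         pair (FMor U a b f (p z)) (FMor V a b f (q z)))\<rparr>"
  have WO: "z \<in> FOb W a \<longleftrightarrow> (\<exists>x y. z = pair x y \<and> x \<in> FOb U a \<and> y \<in> FOb V a \<and> m a x = n a y)" for a z
    by (simp add: W_def)
  have WM: "FMor W a b f z = pair (FMor U a b f (p z)) (FMor V a b f (q z))" if "z \<in> FOb W a" for a b f z
    using that by (simp add: W_def)
  have Wr: "FMor W a b f z \<in> FOb W b" if abz: "a \<in> Ob C" "b \<in> Ob C" "f \<in> Hom C b a" "z \<in> FOb W a" for a b f z
  proof -
    obtain x y where xy: "z = pair x y" "x \<in> FOb U a" "y \<in> FOb V a" "m a x = n a y" using abz WO by blast
    have "m b (FMor U a b f x) = n b (FMor V a b f y)"
      using abz xy by (simp add: Sh_hom_nat[OF U X m] Sh_hom_nat[OF V X n])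
    then show ?thesis unfolding WM[OF abz(4)] WO using xy abz(1-3) restr_in[OF U] restr_in[OF V]
      by (intro exI[of _ "FMor U a b f x"] exI[of _ "FMor V a b f y"]) simp
  qed
  have Wext: "FMor W a b f \<in> extensional (FOb W a)" for a b f
    by (simp add: W_def)
  have W: "W \<in> Ob Sh"
  proof (rule Sh_obI)
    show "small TYPE('v) (FOb W a)" if "a \<in> Ob C" for a
      by (rule small_subset[OF small_pairs[OF univ sheaf_small[OF U that] sheaf_small[OF V that], of pair]])
        (auto simp: WO, blast)
    show "FMor W a b f \<in> FOb W a \<rightarrow>\<^sub>E FOb W b" if "a \<in> Ob C" "b \<in> Ob C" "f \<in> Hom C b a" for a b f
      using Wr[OF that] Wext by (auto simp: PiE_iff)
    show "FMor W a a (Ident C a) x = x" if "a \<in> Ob C" "x \<in> FOb W a" for a x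
      using that(2) by (auto simp: WM WO restr_ident[OF U that(1)] restr_ident[OF V that(1)])
    show "FMor W a c (Cmp C c b a f g) x = FMor W b c g (FMor W a b f x)"
      if "a \<in> Ob C" "b \<in> Ob C" "c \<in> Ob C" "f \<in> Hom C b a" "g \<in> Hom C c b" "x \<in> FOb W a" for a b c f g x
    proof -
      have "p x \<in> FOb U a" "q x \<in> FOb V a" using that(6) by (auto simp: WO)
      then show ?thesis
        using WM[OF Wr[OF that(1,2,4,6)], of c g] WM[OF that(6)]
        by (simp add: restr_cmp[OF U that(1-5)] restr_cmp[OF V that(1-5)])
    qed
    show "y = z" if u: "u \<in> Ob C" and S: "S \<in> J u" and y: "y \<in> FOb W u" and z: "z \<in> FOb W u"
      and eq: "\<And>a f. (a, f) \<in> S \<Longrightarrow> FMor W u a f y = FMor W u a f z" for u S y z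
    proof -
      have eq': "FMor U u a f (p y) = FMor U u a f (p z)" "FMor V u a f (q y) = FMor V u a f (q z)"
        if "(a, f) \<in> S" for a f
        using arg_cong[OF eq[OF that], of p] arg_cong[OF eq[OF that], of q] by (simp_all add: WM y z)
      show ?thesis
        using sheaf_separated[OF U u S, of "p y" "p z"] sheaf_separated[OF V u S, of "q y" "q z"] y z eq'
        by (auto simp: WO)
    qed
    fix u S x assume u: "u \<in> Ob C" and S: "S \<in> J u"
      and x: "\<And>a f. (a, f) \<in> S \<Longrightarrow> x a f \<in> FOb W a"
      and mm: "\<And>a f b g. (a, f) \<in> S \<Longrightarrow> b \<in> Ob C \<Longrightarrow> g \<in> Hom C b a \<Longrightarrow>
          FMor W a b g (x a f) = x b (Cmp C b a u f g)"
    have x': "p (x a f) \<in> FOb U a" "q (x a f) \<in> FOb V a" "m a (p (x a f)) = n a (q (x a f))"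
       "pair (p (x a f)) (q (x a f)) = x a f" if "(a, f) \<in> S" for a f
      using x[OF that] by (auto simp: WO)
    have mm': "FMor U a b g (p (x a f)) = p (x b (Cmp C b a u f g))"
        "FMor V a b g (q (x a f)) = q (x b (Cmp C b a u f g))"
      if "(a, f) \<in> S" "b \<in> Ob C" "g \<in> Hom C b a" for a f b g
      using mm[OF that, symmetric] by (simp_all add: WM x[OF that(1)])
    obtain y where y: "y \<in> FOb U u" "\<And>a f. (a, f) \<in> S \<Longrightarrow> FMor U u a f y = p (x a f)"
      using sheaf_glue[OF U u S x'(1) mm'(1)] by blast
    obtain z where z: "z \<in> FOb V u" "\<And>a f. (a, f) \<in> S \<Longrightarrow> FMor V u a f z = q (x a f)"
      using sheaf_glue[OF V u S x'(2) mm'(2)] by blast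
    have "m u y = n u z"
    proof (rule sheaf_separated[OF X u S])
      fix a t assume t: "(a, t) \<in> S"
      note t' = covering_sieve(1,2)[OF u S t]
      show "FMor X u a t (m u y) = FMor X u a t (n u z)"
        using y(2)[OF t] z(2)[OF t] x'(3)[OF t]
        by (simp flip: Sh_hom_nat[OF U X m u t' y(1)] Sh_hom_nat[OF V X n u t' z(1)])
    qed (use u y z in \<open>auto simp: Sh_hom_in[OF U X m] Sh_hom_in[OF V X n]\<close>)
    then have "pair y z \<in> FOb W u" unfolding WO using y(1) z(1) by blast
    then show "\<exists>w\<in>FOb W u. \<forall>a f. (a, f) \<in> S \<longrightarrow> FMor W u a f w = x a f"
      by (intro bexI[of _ "pair y z"]) (simp_all add: WM y z x')
  qed
  define a where "a = (\<lambda>c\<in>Ob C. \<lambda>z\<in>FOb W c. p z)"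
  define b where "b = (\<lambda>c\<in>Ob C. \<lambda>z\<in>FOb W c. q z)"
  have a: "a \<in> Hom Sh W U" and b: "b \<in> Hom Sh W V"
    unfolding a_def b_def
    by (rule Sh_homI[OF W U], (auto simp: WO)[1], simp add: WM)
      (rule Sh_homI[OF W V], (auto simp: WO)[1], simp add: WM)
  show ?thesis
  proof (intro bexI[OF _ W] bexI[OF _ a] bexI[OF _ b] conjI ballI impI)
    show "FOb W c \<noteq> {}" if "x \<in> FOb U c" "y \<in> FOb V c" "m c x = n c y" for c x y
      using that WO[of "pair x y" c] by blast
    show "Cmp Sh W U X m a = Cmp Sh W V X n b"
      unfolding Sh_cmp_eq_iff by (auto simp: a_def b_def WO)
    fix Z u v assume Z: "Z \<in> Ob Sh" and u: "u \<in> Hom Sh Z U" and v: "v \<in> Hom Sh Z V"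
      and eq: "Cmp Sh Z U X m u = Cmp Sh Z V X n v"
    define t where "t = (\<lambda>c\<in>Ob C. \<lambda>z\<in>FOb Z c. pair (u c z) (v c z))"
    have uvW: "pair (u c z) (v c z) \<in> FOb W c" if "c \<in> Ob C" "z \<in> FOb Z c" for c z
      using eq that Sh_hom_in[OF Z U u that] Sh_hom_in[OF Z V v that] unfolding Sh_cmp_eq_iff WO by blast
    have t: "t \<in> Hom Sh Z W"
      unfolding t_def
      by (rule Sh_homI[OF Z W])
        (simp_all add: uvW WM Sh_hom_nat[OF Z U u] Sh_hom_nat[OF Z V v])
    have at: "Cmp Sh Z W U a w = u \<and> Cmp Sh Z W V b w = v \<longleftrightarrow>
        (\<forall>c\<in>Ob C. \<forall>z\<in>FOb Z c. p (w c z) = u c z \<and> q (w c z) = v c z)" if w: "w \<in> Hom Sh Z W" for w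
    proof -
      have *: "a c (w c z) = p (w c z)" "b c (w c z) = q (w c z)" if "c \<in> Ob C" "z \<in> FOb Z c" for c z
        using Sh_hom_in[OF Z W w that] that by (simp_all add: a_def b_def)
      have 1: "Cmp Sh Z W U a w = u \<longleftrightarrow> (\<forall>c\<in>Ob C. \<forall>z\<in>FOb Z c. p (w c z) = u c z)"
        using Sh_cmp_apply[of _ _ Z W U a w] * 
          Sh_hom_eqI[OF Z U category_cmp[OF category_Sh Z W U w a] u] by (metis (full_types))
      have 2: "Cmp Sh Z W V b w = v \<longleftrightarrow> (\<forall>c\<in>Ob C. \<forall>z\<in>FOb Z c. q (w c z) = v c z)"
        using Sh_cmp_apply[of _ _ Z W V b w] * 
          Sh_hom_eqI[OF Z V category_cmp[OF category_Sh Z W V w b] v] by (metis (full_types))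
      show ?thesis unfolding 1 2 by blast
    qed
    show "\<exists>!t. t \<in> Hom Sh Z W \<and> Cmp Sh Z W U a t = u \<and> Cmp Sh Z W V b t = v"
    proof (rule ex1I[of _ t])
      show "t \<in> Hom Sh Z W \<and> Cmp Sh Z W U a t = u \<and> Cmp Sh Z W V b t = v"
        using t unfolding at[OF t] by (simp add: t_def)
      fix w assume w: "w \<in> Hom Sh Z W \<and> Cmp Sh Z W U a w = u \<and> Cmp Sh Z W V b w = v"
      then have w1: "w \<in> Hom Sh Z W" and w2: "\<forall>c\<in>Ob C. \<forall>z\<in>FOb Z c. p (w c z) = u c z \<and> q (w c z) = v c z"
        using at by auto
      show "w = t"
      proof (rule Sh_hom_eqI[OF Z W w1 t])
        fix c z assume c: "c \<in> Ob C" "z \<in> FOb Z c"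
        then show "w c z = t c z"
          using Sh_hom_in[OF Z W w1 c] bspec[OF bspec[OF w2 c(1)] c(2)] by (auto simp: WO t_def)
      qed
    qed
  qed
qed

lemma Sh_has_pullbacks: "has_pullbacks Sh"
  unfolding has_pullbacks_def
  by (intro ballI, drule (4) Sh_pullback, elim bexE conjE) (intro bexI conjI; assumption)

definition zero_sheaf :: "('v, 'v, 'v set, 'v \<Rightarrow> 'v) fctr" where
  "zero_sheaf = \<lparr>FOb = (\<lambda>a. if {} \<in> J a then {undefined} else {}),
     FMor = (\<lambda>a b f. \<lambda>x\<in>(if {} \<in> J a then {undefined} else {}). undefined)\<rparr>"

lemma zero_sheaf: "zero_sheaf \<in> Ob Sh"
proof (rule Sh_obI)
  fix u S and x :: "'v \<Rightarrow> 'v \<Rightarrow> 'v" assume u: "u \<in> Ob C" and S: "S \<in> J u" and x: "\<And>a f. (a, f) \<in> S \<Longrightarrow> x a f \<in> FOb zero_sheaf a"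
  have e: "{} \<in> J a" if "(a, f) \<in> S" for a f
    using x[OF that] by (auto simp: zero_sheaf_def split: if_splits)
  have "{} \<in> J u"
    by (rule transitive_covers[OF u S]) (auto simp: is_sieve_def pullback_sieve_def e)
  then show "\<exists>y\<in>FOb zero_sheaf u. \<forall>a f. (a, f) \<in> S \<longrightarrow> FMor zero_sheaf u a f y = x a f"
    using x e by (fastforce simp: zero_sheaf_def)
qed (use small_finite[OF univ] empty_covers_stable in \<open>auto simp: zero_sheaf_def split: if_splits\<close>)

lemma empty_covers_singleton:
  assumes P: "P \<in> Ob Sh" and u: "u \<in> Ob C" and e: "{} \<in> J u"
  shows "\<exists>!y. y \<in> FOb P u"
proof -
  obtain y where "y \<in> FOb P u" using sheaf_glue[OF P u e] by blast
  moreover have "z = z'" if "z \<in> FOb P u" "z' \<in> FOb P u" for z z'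
    using sheaf_separated[OF P u e that] by simp
  ultimately show ?thesis by blast
qed

text \<open>A section of \<open>P\<close> over \<open>a\<close> maps to a section of the initial sheaf, which exists only if the empty
  sieve covers \<open>a\<close>; and over such an \<open>a\<close> all sheaves have exactly one section.\<close>

lemma initial_sheaf_iff:
  assumes P: "P \<in> Ob Sh"
  shows "initial_object Sh P \<longleftrightarrow> (\<forall>a\<in>Ob C. FOb P a \<noteq> {} \<longrightarrow> {} \<in> J a)"
proof
  assume "initial_object Sh P"
  then obtain f where "f \<in> Hom Sh P zero_sheaf" using zero_sheaf unfolding initial_object_def by blast
  note f = Sh_hom_in[OF P zero_sheaf this]
  show "\<forall>a\<in>Ob C. FOb P a \<noteq> {} \<longrightarrow> {} \<in> J a"
    using f by (fastforce simp: zero_sheaf_def split: if_splits)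
next
  assume e: "\<forall>a\<in>Ob C. FOb P a \<noteq> {} \<longrightarrow> {} \<in> J a"
  show "initial_object Sh P"
    unfolding initial_object_def
  proof (intro conjI P ballI)
    fix Y assume Y: "Y \<in> Ob Sh"
    have sing: "\<exists>!y. y \<in> FOb Y a" if "a \<in> Ob C" "x \<in> FOb P a" for a x
      using e that by (intro empty_covers_singleton[OF Y]) auto
    define f where "f = (\<lambda>a\<in>Ob C. \<lambda>x\<in>FOb P a. THE y. y \<in> FOb Y a)"
    have f: "f \<in> Hom Sh P Y"
      unfolding f_def
    proof (rule Sh_homI[OF P Y])
      show t: "(THE y. y \<in> FOb Y a) \<in> FOb Y a" if "a \<in> Ob C" "x \<in> FOb P a" for a x
        using theI'[OF sing[OF that]] .
      show "(THE y. y \<in> FOb Y b) = FMor Y a b t (THE y. y \<in> FOb Y a)"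
        if "a \<in> Ob C" "b \<in> Ob C" "t \<in> Hom C b a" "x \<in> FOb P a" for a b t x
        by (rule the1_equality[OF sing[OF that(2) restr_in[OF P that]]])
          (rule restr_in[OF Y that(1-3) t[OF that(1,4)]])
    qed
    show "\<exists>!f. f \<in> Hom Sh P Y"
    proof (rule ex1I)
      show "f \<in> Hom Sh P Y" by (rule f)
      fix g assume g: "g \<in> Hom Sh P Y"
      show "g = f"
        by (rule Sh_hom_eqI[OF P Y g f]) (use sing Sh_hom_in[OF P Y g] Sh_hom_in[OF P Y f] in blast)
    qed
  qed
qed

lemma Sh_has_strict_initial: "has_strict_initial Sh"
  unfolding has_strict_initial_def
proof (intro exI[of _ zero_sheaf] conjI ballI impI)
  show "initial_object Sh zero_sheaf"
    unfolding initial_sheaf_iff[OF zero_sheaf] by (simp add: zero_sheaf_def)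
  fix V assume V: "V \<in> Ob Sh" and "Hom Sh V zero_sheaf \<noteq> {}"
  then obtain f where "f \<in> Hom Sh V zero_sheaf" by blast
  note f = Sh_hom_in[OF V zero_sheaf this]
  show "initial_object Sh V"
    unfolding initial_sheaf_iff[OF V]
    using f by (fastforce simp: zero_sheaf_def split: if_splits)
qed

text \<open>The sections that lie locally in the image of \<open>m\<close> or of \<open>n\<close> form a subsheaf containing both, so
  every section of \<open>X\<close> is of this kind. The glued arrow is defined locally by \<open>c0\<close> or \<open>c1\<close>
  accordingly. Where both apply, the images meet, the empty sieve covers, and sections of \<open>Y\<close> are
  unique.\<close>

lemma Sh_glues_disjoint_covers: "glues_disjoint_covers Sh"
  unfolding glues_disjoint_covers_def
proof (intro ballI impI)
  fix X U V m n Y c0 c1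
  assume X: "X \<in> Ob Sh" and U: "U \<in> Ob Sh" and V: "V \<in> Ob Sh" and m: "m \<in> Hom Sh U X" and n: "n \<in> Hom Sh V X"
    and cov: "covers_disjointly Sh X U m V n" and Y: "Y \<in> Ob Sh"
    and c0: "c0 \<in> Hom Sh X Y" and c1: "c1 \<in> Hom Sh X Y"
  have disj: "{} \<in> J a" if a: "a \<in> Ob C" and u: "u \<in> FOb U a" and v: "v \<in> FOb V a" and uv: "m a u = n a v" for a u v
  proof -
    obtain W s t where W: "W \<in> Ob Sh" and st: "s \<in> Hom Sh W U" "t \<in> Hom Sh W V"
      "Cmp Sh W U X m s = Cmp Sh W V X n t" and ne: "FOb W a \<noteq> {}"
      using Sh_pullback[OF X U V m n] a u v uv by blast
    have "initial_object Sh W"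
      using cov W st unfolding covers_disjointly_def by blast
    then show ?thesis using ne a unfolding initial_sheaf_iff[OF W] by blast
  qed
  note m_in = Sh_hom_in[OF U X m] and n_in = Sh_hom_in[OF V X n]
  define im where "im a x \<longleftrightarrow> x \<in> m a ` FOb U a \<or> x \<in> n a ` FOb V a" for a x
  have im_restr: "FMor X a b f x \<in> m b ` FOb U b" if "x \<in> m a ` FOb U a" "a \<in> Ob C" "b \<in> Ob C" "f \<in> Hom C b a"
    for a b f x
    using that Sh_hom_nat[OF U X m that(2-4), symmetric] restr_in[OF U that(2-4)] by auto
  have im_restr': "FMor X a b f x \<in> n b ` FOb V b" if "x \<in> n a ` FOb V a" "a \<in> Ob C" "b \<in> Ob C" "f \<in> Hom C b a"
    for a b f x
    using that Sh_hom_nat[OF V X n that(2-4), symmetric] restr_in[OF V that(2-4)] by auto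
  have im_stab: "im b (FMor X a b f x)" if "im a x" "a \<in> Ob C" "b \<in> Ob C" "f \<in> Hom C b a" for a b f x
    using that im_restr im_restr' unfolding im_def by blast
  \<comment> \<open>The arrows along which \<open>x\<close> restricts into one of the images.\<close>
  define R where "R a x = {(b, f). b \<in> Ob C \<and> f \<in> Hom C b a \<and> im b (FMor X a b f x)}" for a x
  have R_sieve: "is_sieve C a (R a x)" if "a \<in> Ob C" "x \<in> FOb X a" for a x
    unfolding is_sieve_def
    using that by (auto simp: R_def category_cmp[OF C] restr_cmp[OF X] im_stab)
  have R_pullback: "pullback_sieve C b a f (R a x) = R b (FMor X a b f x)"
    if "a \<in> Ob C" "b \<in> Ob C" "f \<in> Hom C b a" "x \<in> FOb X a" for a b f x
    using that by (auto simp: pullback_sieve_def R_def category_cmp[OF C] restr_cmp[OF X])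
  define Q where "Q a x \<longleftrightarrow> R a x \<in> J a" for a x
  have Q: "local_property X Q"
    unfolding local_property_def
  proof (intro conjI ballI impI)
    show "Q b (FMor X a b f x)" if "a \<in> Ob C" "b \<in> Ob C" "f \<in> Hom C b a" "x \<in> FOb X a" "Q a x" for a b f x
      using pullback_covers[OF that(1-3), of "R a x"] that by (simp add: Q_def R_pullback)
    fix u S x assume u: "u \<in> Ob C" and S: "S \<in> J u" and x: "x \<in> FOb X u"
      and loc: "\<forall>(a, f)\<in>S. Q a (FMor X u a f x)"
    show "Q u x"
      unfolding Q_def
    proof (rule transitive_covers[OF u S R_sieve[OF u x]])
      fix a f assume af: "(a, f) \<in> S"
      show "pullback_sieve C a u f (R u x) \<in> J a"
        unfolding R_pullback[OF u covering_sieve(1,2)[OF u S af] x] using loc af by (auto simp: Q_def)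
    qed
  qed
  let ?W = "subsheaf X Q"
  note W = subsheaf[OF X Q] and inclW = incl_hom[OF X Q]
  have max: "Q a x" if "a \<in> Ob C" "im a x" for a x
  proof -
    have "R a x = maximal_sieve C a"
      unfolding R_def maximal_sieve_def using that by (auto simp: im_stab)
    then show ?thesis using maximal_covers that by (simp add: Q_def)
  qed
  have "is_mono Sh ?W X (incl ?W)"
    unfolding is_mono_def using inclW incl_cancel[OF X Q] by blast
  moreover have "sub_le Sh X U m ?W (incl ?W)"
    unfolding sub_le_def using subsheaf_factor[OF X Q U m] max im_def by blast
  moreover have "sub_le Sh X V n ?W (incl ?W)"
    unfolding sub_le_def using subsheaf_factor[OF X Q V n] max im_def by blast
  ultimately obtain s where s: "s \<in> Hom Sh X ?W" "Cmp Sh X ?W X (incl ?W) s = Ident Sh X"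
    using cov W unfolding covers_disjointly_def by blast
  have cover: "R a x \<in> J a" if a: "a \<in> Ob C" and x: "x \<in> FOb X a" for a x
  proof -
    have "s a x \<in> FOb ?W a" by (rule Sh_hom_in[OF X W s(1) a x])
    moreover have "s a x = x"
      using Sh_cmp_apply[OF a x, of ?W X "incl ?W" s] calculation a x unfolding s(2)
      by (simp add: Sh_ident incl_apply del: Sh_cmp)
    ultimately show ?thesis by (simp add: subsheaf_sel Q_def)
  qed
  \<comment> \<open>The images may overlap where the empty sieve covers, so preferring \<open>m\<close> is harmless (\<open>fam_n\<close>).\<close>
  define fam where "fam a z = (if z \<in> m a ` FOb U a then c0 a z else c1 a z)" for a z
  have fam_in: "fam a z \<in> FOb Y a" if "a \<in> Ob C" "z \<in> FOb X a" for a z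
    using that by (simp add: fam_def Sh_hom_in[OF X Y c0] Sh_hom_in[OF X Y c1])
  have fam_n: "fam a z = c1 a z" if a: "a \<in> Ob C" and z: "z \<in> FOb X a" "z \<in> n a ` FOb V a" for a z
  proof (cases "z \<in> m a ` FOb U a")
    case True
    then have "{} \<in> J a" using disj[OF a] z by blast
    then show ?thesis
      using empty_covers_singleton[OF Y a] fam_in[OF a z(1)] Sh_hom_in[OF X Y c1 a z(1)] by blast
  qed (simp add: fam_def)
  have fam_nat: "FMor Y a b g (fam a z) = fam b (FMor X a b g z)"
    if z: "im a z" "z \<in> FOb X a" and ab: "a \<in> Ob C" "b \<in> Ob C" "g \<in> Hom C b a" for a b g z
    using z(1) unfolding im_def
  proof
    assume "z \<in> m a ` FOb U a"
    then show ?thesis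
      using im_restr[OF _ ab] Sh_hom_nat[OF X Y c0 ab z(2)] by (simp add: fam_def)
  next
    assume z': "z \<in> n a ` FOb V a"
    show ?thesis
      using fam_n[OF ab(1) z(2) z'] fam_n[OF ab(2) restr_in[OF X ab z(2)] im_restr'[OF z' ab]]
        Sh_hom_nat[OF X Y c1 ab z(2)] by simp
  qed
  have RD: "b \<in> Ob C" "f \<in> Hom C b a" "im b (FMor X a b f x)" if "(b, f) \<in> R a x" for a b f x
    using that by (auto simp: R_def)
  have ex: "\<exists>y\<in>FOb Y a. \<forall>b f. (b, f) \<in> R a x \<longrightarrow> FMor Y a b f y = fam b (FMor X a b f x)"
    if a: "a \<in> Ob C" and x: "x \<in> FOb X a" for a x
  proof -
    have 1: "fam b (FMor X a b f x) \<in> FOb Y b" if "(b, f) \<in> R a x" for b f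
      using RD[OF that] a x by (simp add: fam_in restr_in[OF X])
    have 2: "FMor Y b c g (fam b (FMor X a b f x)) = fam c (FMor X a c (Cmp C c b a f g) x)"
      if "(b, f) \<in> R a x" "c \<in> Ob C" "g \<in> Hom C c b" for b f c g
      using RD[OF that(1)] that(2,3) a x by (simp add: fam_nat restr_in[OF X] restr_cmp[OF X])
    show ?thesis by (rule sheaf_glue[OF Y a cover[OF a x] 1 2])
  qed
  obtain h where h: "\<And>a x. a \<in> Ob C \<Longrightarrow> x \<in> FOb X a \<Longrightarrow> h a x \<in> FOb Y a"
    and hR: "\<And>a x b f. a \<in> Ob C \<Longrightarrow> x \<in> FOb X a \<Longrightarrow> (b, f) \<in> R a x \<Longrightarrow>
      FMor Y a b f (h a x) = fam b (FMor X a b f x)"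
  proof -
    define h where "h a x = (SOME y. y \<in> FOb Y a \<and>
      (\<forall>b f. (b, f) \<in> R a x \<longrightarrow> FMor Y a b f y = fam b (FMor X a b f x)))" for a x
    have "h a x \<in> FOb Y a \<and> (\<forall>b f. (b, f) \<in> R a x \<longrightarrow> FMor Y a b f (h a x) = fam b (FMor X a b f x))"
      if "a \<in> Ob C" "x \<in> FOb X a" for a x
      unfolding h_def by (rule someI_ex) (use ex[OF that] in blast)
    then show thesis by (intro that[of h]) simp_all
  qed
  have h_unique: "y = h a x" if a: "a \<in> Ob C" and x: "x \<in> FOb X a" and y: "y \<in> FOb Y a"
    and yR: "\<And>b f. (b, f) \<in> R a x \<Longrightarrow> FMor Y a b f y = fam b (FMor X a b f x)" for a x y
    by (rule sheaf_separated[OF Y a cover[OF a x] y h[OF a x]]) (simp add: yR hR[OF a x])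
  define H where "H = (\<lambda>a\<in>Ob C. \<lambda>x\<in>FOb X a. h a x)"
  have H: "H \<in> Hom Sh X Y"
    unfolding H_def
  proof (rule Sh_homI[OF X Y h])
    fix a b f x assume ab: "a \<in> Ob C" "b \<in> Ob C" "f \<in> Hom C b a" and x: "x \<in> FOb X a"
    show "h b (FMor X a b f x) = FMor Y a b f (h a x)"
    proof (rule h_unique[symmetric, OF ab(2) restr_in[OF X ab x] restr_in[OF Y ab h[OF ab(1) x]]])
      fix c g assume cg: "(c, g) \<in> R b (FMor X a b f x)"
      note c = RD[OF cg]
      have "(c, Cmp C c b a f g) \<in> R a x"
        using cg unfolding R_pullback[OF ab x, symmetric] pullback_sieve_def by simp
      from hR[OF ab(1) x this] show "FMor Y b c g (FMor Y a b f (h a x)) = fam c (FMor X b c g (FMor X a b f x))"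
        using restr_cmp[OF Y ab(1,2) c(1) ab(3) c(2) h[OF ab(1) x]] restr_cmp[OF X ab(1,2) c(1) ab(3) c(2) x]
        by simp
    qed
  qed
  show "\<exists>h\<in>Hom Sh X Y. Cmp Sh U X Y h m = Cmp Sh U X Y c0 m \<and> Cmp Sh V X Y h n = Cmp Sh V X Y c1 n"
  proof (intro bexI[OF _ H] conjI, unfold Sh_cmp_eq_iff, safe)
    fix a u assume a: "a \<in> Ob C" and u: "u \<in> FOb U a"
    have "c0 a (m a u) = h a (m a u)"
    proof (rule h_unique[OF a m_in[OF a u] Sh_hom_in[OF X Y c0 a m_in[OF a u]]])
      fix b f assume "(b, f) \<in> R a (m a u)"
      note b = RD(1,2)[OF this]
      show "FMor Y a b f (c0 a (m a u)) = fam b (FMor X a b f (m a u))"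
        using im_restr[OF _ a b, of "m a u"] u Sh_hom_nat[OF X Y c0 a b m_in[OF a u]] by (simp add: fam_def)
    qed
    then show "H a (m a u) = c0 a (m a u)" using a m_in[OF a u] by (simp add: H_def)
  next
    fix a v assume a: "a \<in> Ob C" and v: "v \<in> FOb V a"
    have "c1 a (n a v) = h a (n a v)"
    proof (rule h_unique[OF a n_in[OF a v] Sh_hom_in[OF X Y c1 a n_in[OF a v]]])
      fix b f assume "(b, f) \<in> R a (n a v)"
      note b = RD(1,2)[OF this]
      show "FMor Y a b f (c1 a (n a v)) = fam b (FMor X a b f (n a v))"
        using fam_n[OF b(1) restr_in[OF X a b n_in[OF a v]] im_restr'[OF _ a b]] v
          Sh_hom_nat[OF X Y c1 a b n_in[OF a v]] by simp
    qed
    then show "H a (n a v) = c1 a (n a v)" using a n_in[OF a v] by (simp add: H_def)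
  qed
qed

end

section \<open>Transfer along an equivalence\<close>

locale equivalence =
  fixes C :: "('o, 'm) cat" and D :: "('p, 'n) cat" and F :: "('o, 'm, 'p, 'n) fctr"
  assumes eqv: "equivalence_functor C D F"
begin

lemma C: "category C" and D: "category D" and F: "is_functor C D F"
  and full: "full_functor C D F" and faithful: "faithful_functor C F"
  using eqv unfolding equivalence_functor_def by auto

lemmas F_ob = functor_ob[OF F] and F_mor = functor_mor[OF F] and F_cmp = functor_cmp[OF F]
  and F_ident = functor_ident[OF F]

lemma F_eq_iff:
  "a \<in> Ob C \<Longrightarrow> b \<in> Ob C \<Longrightarrow> f \<in> Hom C a b \<Longrightarrow> g \<in> Hom C a b \<Longrightarrow>
     FMor F a b f = FMor F a b g \<longleftrightarrow> f = g"
  using faithfulD[OF faithful] by blast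

lemma lift:
  assumes "a \<in> Ob C" "b \<in> Ob C" "g \<in> Hom D (FOb F a) (FOb F b)"
  obtains f where "f \<in> Hom C a b" "FMor F a b f = g"
  using full assms unfolding full_functor_def by blast

lemma cover_ob:
  assumes "d \<in> Ob D"
  obtains c i j where "c \<in> Ob C" "i \<in> Hom D (FOb F c) d" "j \<in> Hom D d (FOb F c)"
    "Cmp D (FOb F c) d (FOb F c) j i = Ident D (FOb F c)" "Cmp D d (FOb F c) d i j = Ident D d"
  using eqv assms unfolding equivalence_functor_def is_iso_def by blast

lemma cmp_eq_iff:
  assumes "a \<in> Ob C" "b \<in> Ob C" "b' \<in> Ob C" "c \<in> Ob C" "f \<in> Hom C a b" "g \<in> Hom C b c"
    "f' \<in> Hom C a b'" "g' \<in> Hom C b' c"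
  shows "Cmp C a b c g f = Cmp C a b' c g' f' \<longleftrightarrow>
    Cmp D (FOb F a) (FOb F b) (FOb F c) (FMor F b c g) (FMor F a b f) =
    Cmp D (FOb F a) (FOb F b') (FOb F c) (FMor F b' c g') (FMor F a b' f')"
  using assms by (simp add: category_cmp[OF C] flip: F_cmp F_eq_iff)

lemma cmp_eq_mor_iff:
  assumes "a \<in> Ob C" "b \<in> Ob C" "c \<in> Ob C" "f \<in> Hom C a b" "g \<in> Hom C b c" "h \<in> Hom C a c"
  shows "Cmp C a b c g f = h \<longleftrightarrow>
    Cmp D (FOb F a) (FOb F b) (FOb F c) (FMor F b c g) (FMor F a b f) = FMor F a c h"
  using assms by (simp add: category_cmp[OF C] flip: F_cmp F_eq_iff)

lemma initial_object_iff:
  assumes I: "I \<in> Ob C"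
  shows "initial_object C I \<longleftrightarrow> initial_object D (FOb F I)"
proof
  assume ini: "initial_object D (FOb F I)"
  show "initial_object C I"
    unfolding initial_object_def
  proof (intro conjI I ballI)
    fix X assume X: "X \<in> Ob C"
    then obtain g where g: "g \<in> Hom D (FOb F I) (FOb F X)"
      and u: "\<And>h. h \<in> Hom D (FOb F I) (FOb F X) \<Longrightarrow> h = g"
      using ini F_ob unfolding initial_object_def by metis
    obtain f where f: "f \<in> Hom C I X" by (rule lift[OF I X g])
    show "\<exists>!f. f \<in> Hom C I X"
    proof (rule ex1I, rule f)
      fix f' assume f': "f' \<in> Hom C I X"
      show "f' = f"
        using u[OF F_mor[OF I X f]] u[OF F_mor[OF I X f']] F_eq_iff[OF I X f' f] by simp
    qed
  qed
next
  assume ini: "initial_object C I"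
  show "initial_object D (FOb F I)"
    unfolding initial_object_def
  proof (intro conjI F_ob I ballI)
    fix X' assume X': "X' \<in> Ob D"
    obtain X i j where X: "X \<in> Ob C" and i: "i \<in> Hom D (FOb F X) X'" and j: "j \<in> Hom D X' (FOb F X)"
      and ij: "Cmp D X' (FOb F X) X' i j = Ident D X'"
      by (rule cover_ob[OF X'])
    obtain f where f: "f \<in> Hom C I X" using ini X unfolding initial_object_def by blast
    note FI = F_ob[OF I] and FX = F_ob[OF X]
    show "\<exists>!f. f \<in> Hom D (FOb F I) X'"
    proof (rule ex1I, rule category_cmp[OF D FI FX X' F_mor[OF I X f] i])
      fix g assume g: "g \<in> Hom D (FOb F I) X'"
      note jg = category_cmp[OF D FI X' FX g j]
      obtain f' where f': "f' \<in> Hom C I X" "FMor F I X f' = Cmp D (FOb F I) X' (FOb F X) j g"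
        using jg by (rule lift[OF I X])
      have "f' = f" using ini X f f' unfolding initial_object_def by blast
      then show "g = Cmp D (FOb F I) (FOb F X) X' i (FMor F I X f)"
        using category_assoc[OF D FI X' FX X' g j i] f'(2) ij category_ident_left[OF D FI X' g] by simp
    qed
  qed
qed

lemma has_strict_initial:
  assumes "has_strict_initial D" shows "has_strict_initial C"
proof -
  obtain I' where I': "initial_object D I'" and s: "\<And>V. V \<in> Ob D \<Longrightarrow> Hom D V I' \<noteq> {} \<Longrightarrow> initial_object D V"
    using assms unfolding has_strict_initial_def by blast
  have I'O: "I' \<in> Ob D" using I' unfolding initial_object_def by blast
  obtain I i j where I: "I \<in> Ob C" and i: "i \<in> Hom D (FOb F I) I'" and j: "j \<in> Hom D I' (FOb F I)"
    by (rule cover_ob[OF I'O])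
  have "initial_object C V" if V: "V \<in> Ob C" and f: "f \<in> Hom C V I" for V f
    unfolding initial_object_iff[OF V]
    using s[OF F_ob[OF V]] category_cmp[OF D F_ob[OF V] F_ob[OF I] I'O F_mor[OF V I f] i] by blast
  moreover have "initial_object C I"
    unfolding initial_object_iff[OF I] using s[OF F_ob[OF I]] i by blast
  ultimately show ?thesis unfolding has_strict_initial_def by blast
qed

lemma has_equalizers:
  assumes "has_equalizers D" shows "has_equalizers C"
  unfolding has_equalizers_def
proof (intro ballI)
  fix X Y f g assume X: "X \<in> Ob C" and Y: "Y \<in> Ob C" and f: "f \<in> Hom C X Y" and g: "g \<in> Hom C X Y"
  note FX = F_ob[OF X] and FY = F_ob[OF Y] and Ff = F_mor[OF X Y f] and Fg = F_mor[OF X Y g]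
  obtain W' k' where W': "W' \<in> Ob D" and k': "k' \<in> Hom D W' (FOb F X)"
    and eq: "Cmp D W' (FOb F X) (FOb F Y) (FMor F X Y f) k' = Cmp D W' (FOb F X) (FOb F Y) (FMor F X Y g) k'"
    and fac: "\<And>Z z. Z \<in> Ob D \<Longrightarrow> z \<in> Hom D Z (FOb F X) \<Longrightarrow>
      Cmp D Z (FOb F X) (FOb F Y) (FMor F X Y f) z = Cmp D Z (FOb F X) (FOb F Y) (FMor F X Y g) z \<Longrightarrow>
      \<exists>!u. u \<in> Hom D Z W' \<and> Cmp D Z W' (FOb F X) k' u = z"
    using assms[unfolded has_equalizers_def, rule_format, OF FX FY Ff Fg] by blast
  obtain W i j where W: "W \<in> Ob C" and i: "i \<in> Hom D (FOb F W) W'" and j: "j \<in> Hom D W' (FOb F W)"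
    and ji: "Cmp D (FOb F W) W' (FOb F W) j i = Ident D (FOb F W)" and ij: "Cmp D W' (FOb F W) W' i j = Ident D W'"
    by (rule cover_ob[OF W'])
  note FW = F_ob[OF W]
  obtain k where k: "k \<in> Hom C W X" and Fk: "FMor F W X k = Cmp D (FOb F W) W' (FOb F X) k' i"
    by (rule lift[OF W X category_cmp[OF D FW W' FX i k']])
  show "\<exists>W\<in>Ob C. \<exists>k\<in>Hom C W X. Cmp C W X Y f k = Cmp C W X Y g k \<and>
       (\<forall>Z\<in>Ob C. \<forall>z\<in>Hom C Z X. Cmp C Z X Y f z = Cmp C Z X Y g z \<longrightarrow>
          (\<exists>!u. u \<in> Hom C Z W \<and> Cmp C Z W X k u = z))"
  proof (intro bexI[OF _ W] bexI[OF _ k] conjI ballI impI)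
    show "Cmp C W X Y f k = Cmp C W X Y g k"
      unfolding cmp_eq_iff[OF W X X Y k f k g] Fk
      using category_assoc[OF D FW W' FX FY i k' Ff] category_assoc[OF D FW W' FX FY i k' Fg] eq by simp
    fix Z z assume Z: "Z \<in> Ob C" and z: "z \<in> Hom C Z X" and fz: "Cmp C Z X Y f z = Cmp C Z X Y g z"
    note FZ = F_ob[OF Z]
    obtain u' where u': "u' \<in> Hom D (FOb F Z) W'" "Cmp D (FOb F Z) W' (FOb F X) k' u' = FMor F Z X z"
      and uu: "\<And>w. w \<in> Hom D (FOb F Z) W' \<Longrightarrow> Cmp D (FOb F Z) W' (FOb F X) k' w = FMor F Z X z \<Longrightarrow> w = u'"
      using fac[OF FZ F_mor[OF Z X z]] fz[unfolded cmp_eq_iff[OF Z X X Y z f z g]] by blast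
    obtain u where u: "u \<in> Hom C Z W" "FMor F Z W u = Cmp D (FOb F Z) W' (FOb F W) j u'"
      by (rule lift[OF Z W category_cmp[OF D FZ W' FW u'(1) j]])
    have key: "Cmp C Z W X k w = z \<longleftrightarrow> Cmp D (FOb F Z) (FOb F W) W' i (FMor F Z W w) = u'"
      if w: "w \<in> Hom C Z W" for w
      unfolding cmp_eq_mor_iff[OF Z W X w k z] Fk
        category_assoc[OF D FZ FW W' FX F_mor[OF Z W w] i k', symmetric]
      using uu[OF category_cmp[OF D FZ FW W' F_mor[OF Z W w] i]] u'(2) by auto
    show "\<exists>!u. u \<in> Hom C Z W \<and> Cmp C Z W X k u = z"
    proof (rule ex1I[of _ u])
      show "u \<in> Hom C Z W \<and> Cmp C Z W X k u = z"
        unfolding key[OF u(1)] u(2)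
        using u(1) category_assoc[OF D FZ W' FW W' u'(1) j i] ij category_ident_left[OF D FZ W' u'(1)]
        by simp
      fix w assume w: "w \<in> Hom C Z W \<and> Cmp C Z W X k w = z"
      then have w1: "w \<in> Hom C Z W" and w2: "Cmp D (FOb F Z) (FOb F W) W' i (FMor F Z W w) = u'"
        using key by auto
      have "FMor F Z W w = Cmp D (FOb F Z) W' (FOb F W) j u'"
        using category_assoc[OF D FZ FW W' FW F_mor[OF Z W w1] i j] w2 ji
          category_ident_left[OF D FZ FW F_mor[OF Z W w1]] by simp
      then show "w = u" using u F_eq_iff[OF Z W w1 u(1)] by simp
    qed
  qed
qed

lemma has_pullbacks:
  assumes "has_pullbacks D" shows "has_pullbacks C"
  unfolding has_pullbacks_def
proof (intro ballI)
  fix X U V m n assume X: "X \<in> Ob C" and U: "U \<in> Ob C" and V: "V \<in> Ob C"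
    and m: "m \<in> Hom C U X" and n: "n \<in> Hom C V X"
  note FX = F_ob[OF X] and FU = F_ob[OF U] and FV = F_ob[OF V]
    and Fm = F_mor[OF U X m] and Fn = F_mor[OF V X n]
  obtain W' a' b' where W': "W' \<in> Ob D" and a': "a' \<in> Hom D W' (FOb F U)" and b': "b' \<in> Hom D W' (FOb F V)"
    and eq: "Cmp D W' (FOb F U) (FOb F X) (FMor F U X m) a' = Cmp D W' (FOb F V) (FOb F X) (FMor F V X n) b'"
    and fac: "\<And>Z u v. Z \<in> Ob D \<Longrightarrow> u \<in> Hom D Z (FOb F U) \<Longrightarrow> v \<in> Hom D Z (FOb F V) \<Longrightarrow>
      Cmp D Z (FOb F U) (FOb F X) (FMor F U X m) u = Cmp D Z (FOb F V) (FOb F X) (FMor F V X n) v \<Longrightarrow>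
      \<exists>!t. t \<in> Hom D Z W' \<and> Cmp D Z W' (FOb F U) a' t = u \<and> Cmp D Z W' (FOb F V) b' t = v"
    using assms[unfolded has_pullbacks_def, rule_format, OF FX FU FV Fm Fn] by blast
  obtain W i j where W: "W \<in> Ob C" and i: "i \<in> Hom D (FOb F W) W'" and j: "j \<in> Hom D W' (FOb F W)"
    and ji: "Cmp D (FOb F W) W' (FOb F W) j i = Ident D (FOb F W)" and ij: "Cmp D W' (FOb F W) W' i j = Ident D W'"
    by (rule cover_ob[OF W'])
  note FW = F_ob[OF W]
  obtain a where a: "a \<in> Hom C W U" and Fa: "FMor F W U a = Cmp D (FOb F W) W' (FOb F U) a' i"
    by (rule lift[OF W U category_cmp[OF D FW W' FU i a']])
  obtain b where b: "b \<in> Hom C W V" and Fb: "FMor F W V b = Cmp D (FOb F W) W' (FOb F V) b' i"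
    by (rule lift[OF W V category_cmp[OF D FW W' FV i b']])
  show "\<exists>W\<in>Ob C. \<exists>a\<in>Hom C W U. \<exists>b\<in>Hom C W V. Cmp C W U X m a = Cmp C W V X n b \<and>
       (\<forall>Z\<in>Ob C. \<forall>u\<in>Hom C Z U. \<forall>v\<in>Hom C Z V. Cmp C Z U X m u = Cmp C Z V X n v \<longrightarrow>
          (\<exists>!t. t \<in> Hom C Z W \<and> Cmp C Z W U a t = u \<and> Cmp C Z W V b t = v))"
  proof (intro bexI[OF _ W] bexI[OF _ a] bexI[OF _ b] conjI ballI impI)
    show "Cmp C W U X m a = Cmp C W V X n b"
      unfolding cmp_eq_iff[OF W U V X a m b n] Fa Fb
      using category_assoc[OF D FW W' FU FX i a' Fm] category_assoc[OF D FW W' FV FX i b' Fn] eq by simp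
    fix Z u v assume Z: "Z \<in> Ob C" and u: "u \<in> Hom C Z U" and v: "v \<in> Hom C Z V"
      and uv: "Cmp C Z U X m u = Cmp C Z V X n v"
    note FZ = F_ob[OF Z]
    obtain t' where t': "t' \<in> Hom D (FOb F Z) W'" "Cmp D (FOb F Z) W' (FOb F U) a' t' = FMor F Z U u"
        "Cmp D (FOb F Z) W' (FOb F V) b' t' = FMor F Z V v"
      and tt: "\<And>w. w \<in> Hom D (FOb F Z) W' \<Longrightarrow> Cmp D (FOb F Z) W' (FOb F U) a' w = FMor F Z U u \<Longrightarrow>
         Cmp D (FOb F Z) W' (FOb F V) b' w = FMor F Z V v \<Longrightarrow> w = t'"
      using fac[OF FZ F_mor[OF Z U u] F_mor[OF Z V v]] uv[unfolded cmp_eq_iff[OF Z U V X u m v n]] by blast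
    obtain t where t: "t \<in> Hom C Z W" "FMor F Z W t = Cmp D (FOb F Z) W' (FOb F W) j t'"
      by (rule lift[OF Z W category_cmp[OF D FZ W' FW t'(1) j]])
    have key: "Cmp C Z W U a w = u \<and> Cmp C Z W V b w = v \<longleftrightarrow>
        Cmp D (FOb F Z) (FOb F W) W' i (FMor F Z W w) = t'"
      if w: "w \<in> Hom C Z W" for w
      unfolding cmp_eq_mor_iff[OF Z W U w a u] cmp_eq_mor_iff[OF Z W V w b v] Fa Fb
        category_assoc[OF D FZ FW W' FU F_mor[OF Z W w] i a', symmetric]
        category_assoc[OF D FZ FW W' FV F_mor[OF Z W w] i b', symmetric]
      using tt[OF category_cmp[OF D FZ FW W' F_mor[OF Z W w] i]] t'(2,3) by auto
    show "\<exists>!t. t \<in> Hom C Z W \<and> Cmp C Z W U a t = u \<and> Cmp C Z W V b t = v"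
    proof (rule ex1I[of _ t])
      show "t \<in> Hom C Z W \<and> Cmp C Z W U a t = u \<and> Cmp C Z W V b t = v"
        unfolding key[OF t(1)] t(2)
        using t(1) category_assoc[OF D FZ W' FW W' t'(1) j i] ij category_ident_left[OF D FZ W' t'(1)]
        by simp
      fix w assume w: "w \<in> Hom C Z W \<and> Cmp C Z W U a w = u \<and> Cmp C Z W V b w = v"
      then have w1: "w \<in> Hom C Z W" and w2: "Cmp D (FOb F Z) (FOb F W) W' i (FMor F Z W w) = t'"
        using key by auto
      have "FMor F Z W w = Cmp D (FOb F Z) W' (FOb F W) j t'"
        using category_assoc[OF D FZ FW W' FW F_mor[OF Z W w1] i j] w2 ji
          category_ident_left[OF D FZ FW F_mor[OF Z W w1]] by simp
      then show "w = t" using t F_eq_iff[OF Z W w1 t(1)] by simp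
    qed
  qed
qed

lemma is_mono_reflect:
  assumes a: "a \<in> Ob C" and b: "b \<in> Ob C" and m: "m \<in> Hom C a b" and mono: "is_mono D (FOb F a) (FOb F b) (FMor F a b m)"
  shows "is_mono C a b m"
  unfolding is_mono_def
proof (intro conjI m ballI impI)
  fix x f g assume x: "x \<in> Ob C" and f: "f \<in> Hom C x a" and g: "g \<in> Hom C x a"
    and eq: "Cmp C x a b m f = Cmp C x a b m g"
  have "FMor F x a f = FMor F x a g"
    using mono F_ob[OF x] F_mor[OF x a f] F_mor[OF x a g] eq[unfolded cmp_eq_iff[OF x a a b f m g m]]
    unfolding is_mono_def by blast
  then show "f = g" using F_eq_iff[OF x a f g] by simp
qed

lemma is_mono_preserve:
  assumes a: "a \<in> Ob C" and b: "b \<in> Ob C" and mono: "is_mono C a b m"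
  shows "is_mono D (FOb F a) (FOb F b) (FMor F a b m)"
proof -
  have m: "m \<in> Hom C a b" using mono unfolding is_mono_def by blast
  note Fa = F_ob[OF a] and Fb = F_ob[OF b] and Fm = F_mor[OF a b m]
  show ?thesis
    unfolding is_mono_def
  proof (intro conjI Fm ballI impI)
    fix x' f' g' assume x': "x' \<in> Ob D" and f': "f' \<in> Hom D x' (FOb F a)" and g': "g' \<in> Hom D x' (FOb F a)"
      and eq: "Cmp D x' (FOb F a) (FOb F b) (FMor F a b m) f' = Cmp D x' (FOb F a) (FOb F b) (FMor F a b m) g'"
    obtain x i j where x: "x \<in> Ob C" and i: "i \<in> Hom D (FOb F x) x'" and j: "j \<in> Hom D x' (FOb F x)"
      and ji: "Cmp D (FOb F x) x' (FOb F x) j i = Ident D (FOb F x)" and ij: "Cmp D x' (FOb F x) x' i j = Ident D x'"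
      by (rule cover_ob[OF x'])
    note Fx = F_ob[OF x]
    obtain f where f: "f \<in> Hom C x a" "FMor F x a f = Cmp D (FOb F x) x' (FOb F a) f' i"
      by (rule lift[OF x a category_cmp[OF D Fx x' Fa i f']])
    obtain g where g: "g \<in> Hom C x a" "FMor F x a g = Cmp D (FOb F x) x' (FOb F a) g' i"
      by (rule lift[OF x a category_cmp[OF D Fx x' Fa i g']])
    have "Cmp C x a b m f = Cmp C x a b m g"
      unfolding cmp_eq_iff[OF x a a b f(1) m g(1) m] f(2) g(2)
      using category_assoc[OF D Fx x' Fa Fb i f' Fm] category_assoc[OF D Fx x' Fa Fb i g' Fm] eq by simp
    then have "f = g" using mono x f g unfolding is_mono_def by blast
    then have "Cmp D (FOb F x) x' (FOb F a) f' i = Cmp D (FOb F x) x' (FOb F a) g' i" using f g by simp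
    moreover have "is_iso D (FOb F x) x' i" by (rule is_isoI[OF i j ji ij])
    ultimately show "f' = g'" using iso_cancel_right[OF D Fx x' Fa _ f' g'] by blast
  qed
qed

lemma sub_le_iff:
  assumes X: "X \<in> Ob C" and U: "U \<in> Ob C" and V: "V \<in> Ob C" and m: "m \<in> Hom C U X" and n: "n \<in> Hom C V X"
  shows "sub_le C X U m V n \<longleftrightarrow>
    sub_le D (FOb F X) (FOb F U) (FMor F U X m) (FOb F V) (FMor F V X n)"
proof
  assume "sub_le C X U m V n"
  then obtain f where f: "f \<in> Hom C U V" "Cmp C U V X n f = m" unfolding sub_le_def by blast
  then show "sub_le D (FOb F X) (FOb F U) (FMor F U X m) (FOb F V) (FMor F V X n)"
    unfolding sub_le_def using cmp_eq_mor_iff[OF U V X f(1) n m] F_mor[OF U V f(1)] by blast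
next
  assume "sub_le D (FOb F X) (FOb F U) (FMor F U X m) (FOb F V) (FMor F V X n)"
  then obtain g where g: "g \<in> Hom D (FOb F U) (FOb F V)"
    "Cmp D (FOb F U) (FOb F V) (FOb F X) (FMor F V X n) g = FMor F U X m" unfolding sub_le_def by blast
  obtain f where f: "f \<in> Hom C U V" "FMor F U V f = g" by (rule lift[OF U V g(1)])
  then show "sub_le C X U m V n"
    unfolding sub_le_def using cmp_eq_mor_iff[OF U V X f(1) n m] g by blast
qed

text \<open>Test objects of \<open>D\<close> over \<open>F X\<close> can be replaced by images of objects of \<open>C\<close> over \<open>X\<close>: every
  arrow to \<open>F X\<close> is, up to an isomorphism of its source, the image of an arrow to \<open>X\<close>.\<close>

lemma cover_arrow:
  assumes X: "X \<in> Ob C" and W': "W' \<in> Ob D" and k': "k' \<in> Hom D W' (FOb F X)"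
  obtains W k i j where "W \<in> Ob C" "k \<in> Hom C W X" "i \<in> Hom D (FOb F W) W'" "j \<in> Hom D W' (FOb F W)"
    "Cmp D (FOb F W) W' (FOb F W) j i = Ident D (FOb F W)" "Cmp D W' (FOb F W) W' i j = Ident D W'"
    "Cmp D (FOb F W) W' (FOb F X) k' i = FMor F W X k" "Cmp D W' (FOb F W) (FOb F X) (FMor F W X k) j = k'"
    "is_mono D W' (FOb F X) k' \<longrightarrow> is_mono C W X k"
proof -
  obtain W i j where W: "W \<in> Ob C" and i: "i \<in> Hom D (FOb F W) W'" and j: "j \<in> Hom D W' (FOb F W)"
    and ji: "Cmp D (FOb F W) W' (FOb F W) j i = Ident D (FOb F W)" and ij: "Cmp D W' (FOb F W) W' i j = Ident D W'"
    by (rule cover_ob[OF W'])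
  note FW = F_ob[OF W] and FX = F_ob[OF X]
  obtain k where k: "k \<in> Hom C W X" and Fk: "FMor F W X k = Cmp D (FOb F W) W' (FOb F X) k' i"
    by (rule lift[OF W X category_cmp[OF D FW W' FX i k']])
  have iso: "is_iso D (FOb F W) W' i" by (rule is_isoI[OF i j ji ij])
  have "is_mono C W X k" if mono: "is_mono D W' (FOb F X) k'"
  proof (rule is_mono_reflect[OF W X k], unfold is_mono_def, intro conjI F_mor[OF W X k] ballI impI)
    fix x f g assume x: "x \<in> Ob D" and f: "f \<in> Hom D x (FOb F W)" and g: "g \<in> Hom D x (FOb F W)"
      and eq: "Cmp D x (FOb F W) (FOb F X) (FMor F W X k) f = Cmp D x (FOb F W) (FOb F X) (FMor F W X k) g"
    have "Cmp D x (FOb F W) W' i f = Cmp D x (FOb F W) W' i g"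
      using mono eq x category_cmp[OF D x FW W' f i] category_cmp[OF D x FW W' g i]
        category_assoc[OF D x FW W' FX f i k'] category_assoc[OF D x FW W' FX g i k']
      unfolding is_mono_def Fk by simp
    then show "f = g" by (rule iso_cancel_left[OF D x FW W' iso f g])
  qed
  then have "is_mono D W' (FOb F X) k' \<longrightarrow> is_mono C W X k" by blast
  moreover have "Cmp D W' (FOb F W) (FOb F X) (FMor F W X k) j = k'"
    unfolding Fk using category_assoc[OF D W' FW W' FX j i k'] ij category_ident_right[OF D W' FX k'] by simp
  ultimately show thesis by (rule that[OF W k i j ji ij Fk[symmetric], rotated])
qed

lemma sub_le_reindex:
  assumes X: "X \<in> Ob D" and Y: "Y \<in> Ob D" and W: "W \<in> Ob D" and W': "W' \<in> Ob D" and k: "k \<in> Hom D W X"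
    and i: "i \<in> Hom D W' W" and le: "sub_le D X Y m W' (Cmp D W' W X k i)"
  shows "sub_le D X Y m W k"
proof -
  obtain f where f: "f \<in> Hom D Y W'" "Cmp D Y W' X (Cmp D W' W X k i) f = m"
    using le unfolding sub_le_def by blast
  then show ?thesis
    unfolding sub_le_def
    using category_assoc[OF D Y W' W X f(1) i k] category_cmp[OF D Y W' W f(1) i] by auto
qed

lemma glues_disjoint_covers:
  assumes glue: "glues_disjoint_covers D" shows "glues_disjoint_covers C"
  unfolding glues_disjoint_covers_def
proof (intro ballI impI)
  fix X U V m n Y c0 c1
  assume X: "X \<in> Ob C" and U: "U \<in> Ob C" and V: "V \<in> Ob C" and m: "m \<in> Hom C U X" and n: "n \<in> Hom C V X"
    and cov: "covers_disjointly C X U m V n" and Y: "Y \<in> Ob C"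
    and c0: "c0 \<in> Hom C X Y" and c1: "c1 \<in> Hom C X Y"
  note FX = F_ob[OF X] and FU = F_ob[OF U] and FV = F_ob[OF V] and FY = F_ob[OF Y]
    and Fm = F_mor[OF U X m] and Fn = F_mor[OF V X n]
  have "covers_disjointly D (FOb F X) (FOb F U) (FMor F U X m) (FOb F V) (FMor F V X n)"
    unfolding covers_disjointly_def
  proof (intro conjI ballI allI impI)
    fix W' a' b' assume W': "W' \<in> Ob D" and a': "a' \<in> Hom D W' (FOb F U)" and b': "b' \<in> Hom D W' (FOb F V)"
      and eq: "Cmp D W' (FOb F U) (FOb F X) (FMor F U X m) a' = Cmp D W' (FOb F V) (FOb F X) (FMor F V X n) b'"
    obtain W a i j where W: "W \<in> Ob C" and a: "a \<in> Hom C W U" and i: "i \<in> Hom D (FOb F W) W'"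
      and j: "j \<in> Hom D W' (FOb F W)" and ji: "Cmp D (FOb F W) W' (FOb F W) j i = Ident D (FOb F W)"
      and ij: "Cmp D W' (FOb F W) W' i j = Ident D W'"
      and Fa: "Cmp D (FOb F W) W' (FOb F U) a' i = FMor F W U a"
      by (rule cover_arrow[OF U W' a'])
    note FW = F_ob[OF W]
    obtain b where b: "b \<in> Hom C W V" "FMor F W V b = Cmp D (FOb F W) W' (FOb F V) b' i"
      by (rule lift[OF W V category_cmp[OF D FW W' FV i b']])
    have "Cmp C W U X m a = Cmp C W V X n b"
      unfolding cmp_eq_iff[OF W U V X a m b(1) n] Fa[symmetric] b(2)
      using category_assoc[OF D FW W' FU FX i a' Fm] category_assoc[OF D FW W' FV FX i b' Fn] eq by simp
    then have "initial_object C W" using cov W a b(1) unfolding covers_disjointly_def by blast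
    then have ini: "initial_object D (FOb F W)" using initial_object_iff[OF W] by blast
    show "initial_object D W'"
      unfolding initial_object_def
    proof (intro conjI W' ballI)
      fix Z assume Z: "Z \<in> Ob D"
      obtain t where t: "t \<in> Hom D (FOb F W) Z" and tt: "\<And>s. s \<in> Hom D (FOb F W) Z \<Longrightarrow> s = t"
        using ini Z unfolding initial_object_def by metis
      show "\<exists>!f. f \<in> Hom D W' Z"
      proof (rule ex1I, rule category_cmp[OF D W' FW Z j t])
        fix s assume s: "s \<in> Hom D W' Z"
        show "s = Cmp D W' (FOb F W) Z t j"
          using tt[OF category_cmp[OF D FW W' Z i s]] category_assoc[OF D W' FW W' Z j i s] ij
            category_ident_right[OF D W' Z s] by simp
      qed
    qed
  next
    fix W' k' assume W': "W' \<in> Ob D" and mono: "is_mono D W' (FOb F X) k'"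
      and leU: "sub_le D (FOb F X) (FOb F U) (FMor F U X m) W' k'"
      and leV: "sub_le D (FOb F X) (FOb F V) (FMor F V X n) W' k'"
    have k': "k' \<in> Hom D W' (FOb F X)" using mono unfolding is_mono_def by blast
    obtain W k i j where W: "W \<in> Ob C" and k: "k \<in> Hom C W X" and i: "i \<in> Hom D (FOb F W) W'"
      and j: "j \<in> Hom D W' (FOb F W)" and Fk: "Cmp D (FOb F W) W' (FOb F X) k' i = FMor F W X k"
      and kj: "Cmp D W' (FOb F W) (FOb F X) (FMor F W X k) j = k'"
      and mono': "is_mono D W' (FOb F X) k' \<longrightarrow> is_mono C W X k"
      by (rule cover_arrow[OF X W' k'])
    note FW = F_ob[OF W] and Fkm = F_mor[OF W X k]
    have "sub_le C X U m W k" "sub_le C X V n W k"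
      unfolding sub_le_iff[OF X U W m k] sub_le_iff[OF X V W n k]
      using sub_le_reindex[OF FX _ FW W' Fkm j] leU leV FU FV by (auto simp: kj)
    then obtain s where s: "s \<in> Hom C X W" "Cmp C X W X k s = Ident C X"
      using cov W mp[OF mono' mono] unfolding covers_disjointly_def by blast
    note Fs = F_mor[OF X W s(1)]
    have "Cmp D (FOb F X) W' (FOb F X) k' (Cmp D (FOb F X) (FOb F W) W' i (FMor F X W s)) = Ident D (FOb F X)"
      using category_assoc[OF D FX FW W' FX Fs i k'] Fk
        cmp_eq_mor_iff[OF X W X s(1) k category_ident[OF C X]] s(2) F_ident[OF X] by simp
    then show "\<exists>s\<in>Hom D (FOb F X) W'. Cmp D (FOb F X) W' (FOb F X) k' s = Ident D (FOb F X)"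
      using category_cmp[OF D FX FW W' Fs i] by blast
  qed
  then obtain h' where h': "h' \<in> Hom D (FOb F X) (FOb F Y)"
    "Cmp D (FOb F U) (FOb F X) (FOb F Y) h' (FMor F U X m) =
     Cmp D (FOb F U) (FOb F X) (FOb F Y) (FMor F X Y c0) (FMor F U X m)"
    "Cmp D (FOb F V) (FOb F X) (FOb F Y) h' (FMor F V X n) =
     Cmp D (FOb F V) (FOb F X) (FOb F Y) (FMor F X Y c1) (FMor F V X n)"
    using glue[unfolded glues_disjoint_covers_def, rule_format, OF FX FU FV Fm Fn _ FY F_mor[OF X Y c0] F_mor[OF X Y c1]]
    by blast
  obtain h where h: "h \<in> Hom C X Y" "FMor F X Y h = h'" by (rule lift[OF X Y h'(1)])
  show "\<exists>h\<in>Hom C X Y. Cmp C U X Y h m = Cmp C U X Y c0 m \<and> Cmp C V X Y h n = Cmp C V X Y c1 n"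
    by (rule bexI[OF _ h(1)])
      (use h' in \<open>simp add: cmp_eq_iff[OF U X X Y m h(1) m c0] cmp_eq_iff[OF V X X Y n h(1) n c1] h(2)\<close>)
qed

lemma boolean_topos:
  assumes bool: "boolean_topos D" shows "boolean_topos C"
  unfolding boolean_topos_def
proof (intro ballI allI impI)
  fix X U m assume X: "X \<in> Ob C" and U: "U \<in> Ob C" and mono: "is_mono C U X m"
  have m: "m \<in> Hom C U X" using mono unfolding is_mono_def by blast
  note FX = F_ob[OF X] and FU = F_ob[OF U] and Fm = F_mor[OF U X m]
  obtain V' n' where V': "V' \<in> Ob D" and n'm: "is_mono D V' (FOb F X) n'"
    and comp: "complementary_subobjects D (FOb F X) (FOb F U) (FMor F U X m) V' n'"
    using bool FX FU is_mono_preserve[OF U X mono] unfolding boolean_topos_def by blast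
  have n': "n' \<in> Hom D V' (FOb F X)" using n'm unfolding is_mono_def by blast
  obtain V n i j where V: "V \<in> Ob C" and n: "n \<in> Hom C V X" and i: "i \<in> Hom D (FOb F V) V'"
      and j: "j \<in> Hom D V' (FOb F V)" and Fn: "Cmp D (FOb F V) V' (FOb F X) n' i = FMor F V X n"
      and nj: "Cmp D V' (FOb F V) (FOb F X) (FMor F V X n) j = n'"
      and mono': "is_mono D V' (FOb F X) n' \<longrightarrow> is_mono C V X n"
    by (rule cover_arrow[OF X V' n'])
  note FV = F_ob[OF V] and Fnm = F_mor[OF V X n]
  have dest: "k \<in> Hom C W X" if "is_mono C W X k" for W k using that unfolding is_mono_def by blast
  have "complementary_subobjects C X U m V n"
    unfolding complementary_subobjects_def
  proof (intro conjI ballI allI impI)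
    fix W k Z z assume W: "W \<in> Ob C" and k: "is_mono C W X k" and kU: "sub_le C X W k U m"
      and kV: "sub_le C X W k V n" and Z: "Z \<in> Ob C" and z: "is_mono C Z X z"
    have "sub_le D (FOb F X) (FOb F W) (FMor F W X k) V' n'"
      using kV unfolding sub_le_iff[OF X W V dest[OF k] n] Fn[symmetric]
      by (rule sub_le_reindex[OF FX F_ob[OF W] V' FV n' i])
    then show "sub_le C X W k Z z"
      using comp kU is_mono_preserve[OF W X k] is_mono_preserve[OF Z X z] F_ob[OF W] F_ob[OF Z]
      unfolding sub_le_iff[OF X W U dest[OF k] m] sub_le_iff[OF X W Z dest[OF k] dest[OF z]]
        complementary_subobjects_def by blast
  next
    fix W k Z z assume W: "W \<in> Ob C" and k: "is_mono C W X k" and kU: "sub_le C X U m W k"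
      and kV: "sub_le C X V n W k" and Z: "Z \<in> Ob C" and z: "is_mono C Z X z"
    obtain f where f: "f \<in> Hom D (FOb F V) (FOb F W)"
      "Cmp D (FOb F V) (FOb F W) (FOb F X) (FMor F W X k) f = FMor F V X n"
      using kV unfolding sub_le_iff[OF X V W n dest[OF k]] unfolding sub_le_def by blast
    have "sub_le D (FOb F X) V' n' (FOb F W) (FMor F W X k)"
      unfolding sub_le_def
      using category_assoc[OF D V' FV F_ob[OF W] FX j f(1) F_mor[OF W X dest[OF k]]] f(2) nj
        category_cmp[OF D V' FV F_ob[OF W] j f(1)] by auto
    then show "sub_le C X Z z W k"
      using comp kU is_mono_preserve[OF W X k] is_mono_preserve[OF Z X z] F_ob[OF W] F_ob[OF Z]
      unfolding sub_le_iff[OF X U W m dest[OF k]] sub_le_iff[OF X Z W dest[OF z] dest[OF k]]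
        complementary_subobjects_def by blast
  qed
  then show "\<exists>V\<in>Ob C. \<exists>n. is_mono C V X n \<and> complementary_subobjects C X U m V n"
    using V mp[OF mono' n'm] by blast
qed

end

section \<open>A category with a representable point\<close>

text \<open>The assumptions \<open>ev\<close> and \<open>transpose\<close> are the adjunction between \<open>X \<mapsto> Hom A X\<close> and \<open>R\<close>, stated
  through its counit: \<open>ev S : Hom A (R S) \<rightarrow> S\<close> is the universal function to \<open>S\<close>. In this form the
  points may be arbitrary arrows of \<open>E\<close>, which are not elements of the universe \<open>'v\<close>.\<close>

locale representable_point =
  fixes E :: "('o, 'm) cat" and A :: 'o and R :: "'v set \<Rightarrow> 'o" and ev :: "'v set \<Rightarrow> 'm \<Rightarrow> 'v"
  assumes univ: "universe TYPE('v)" and E: "category E" and A: "A \<in> Ob E"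
    and equalizers: "has_equalizers E" and pullbacks: "has_pullbacks E"
    and strict_initial: "has_strict_initial E" and boolean: "boolean_topos E"
    and points_small: "X \<in> Ob E \<Longrightarrow> small TYPE('v) (Hom E A X)"
    and R: "small TYPE('v) S \<Longrightarrow> R S \<in> Ob E"
    and ev: "small TYPE('v) S \<Longrightarrow> y \<in> Hom E A (R S) \<Longrightarrow> ev S y \<in> S"
    and transpose: "small TYPE('v) S \<Longrightarrow> X \<in> Ob E \<Longrightarrow> h \<in> Hom E A X \<rightarrow> S \<Longrightarrow>
      \<exists>!t. t \<in> Hom E X (R S) \<and> (\<forall>x\<in>Hom E A X. ev S (Cmp E A X (R S) t x) = h x)"
begin

abbreviation "pts X \<equiv> Hom E A X"
abbreviation "app X Y f x \<equiv> Cmp E A X Y f x"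
abbreviation "act X x e \<equiv> Cmp E A A X x e"
abbreviation "idA \<equiv> Ident E A"

lemmas cmp_in = category_cmp[OF E] and assoc = category_assoc[OF E] and ident_in = category_ident[OF E]
  and ident_left = category_ident_left[OF E] and ident_right = category_ident_right[OF E]

lemma idA: "idA \<in> pts A" by (rule ident_in[OF A])

lemma app_in: "X \<in> Ob E \<Longrightarrow> Y \<in> Ob E \<Longrightarrow> f \<in> Hom E X Y \<Longrightarrow> x \<in> pts X \<Longrightarrow> app X Y f x \<in> pts Y"
  by (rule cmp_in[OF A])

lemma act_in: "X \<in> Ob E \<Longrightarrow> x \<in> pts X \<Longrightarrow> e \<in> pts A \<Longrightarrow> act X x e \<in> pts X"
  by (rule cmp_in[OF A A])

lemma app_cmp: "X \<in> Ob E \<Longrightarrow> Y \<in> Ob E \<Longrightarrow> Z \<in> Ob E \<Longrightarrow> f \<in> Hom E X Y \<Longrightarrow> g \<in> Hom E Y Z \<Longrightarrow> x \<in> pts X \<Longrightarrow>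
    app X Z (Cmp E X Y Z g f) x = app Y Z g (app X Y f x)"
  using assoc[OF A, of X Y Z x f g] by simp

lemma app_act: "X \<in> Ob E \<Longrightarrow> Y \<in> Ob E \<Longrightarrow> f \<in> Hom E X Y \<Longrightarrow> x \<in> pts X \<Longrightarrow> e \<in> pts A \<Longrightarrow>
    app X Y f (act X x e) = act Y (app X Y f x) e"
  using assoc[OF A A, of X Y e x f] by simp

lemma act_act: "X \<in> Ob E \<Longrightarrow> x \<in> pts X \<Longrightarrow> e \<in> pts A \<Longrightarrow> d \<in> pts A \<Longrightarrow>
    act X (act X x e) d = act X x (act A e d)"
  using assoc[OF A A A, of X d e x] by simp

lemma act_id: "X \<in> Ob E \<Longrightarrow> x \<in> pts X \<Longrightarrow> act X x idA = x"
  by (rule ident_right[OF A])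

lemma app_id: "X \<in> Ob E \<Longrightarrow> x \<in> pts X \<Longrightarrow> app X X (Ident E X) x = x"
  by (rule ident_left[OF A])

subsection \<open>Maps into the objects \<open>R S\<close>\<close>

definition tr :: "'v set \<Rightarrow> 'o \<Rightarrow> ('m \<Rightarrow> 'v) \<Rightarrow> 'm" where
  "tr S X h = (THE t. t \<in> Hom E X (R S) \<and> (\<forall>x\<in>pts X. ev S (app X (R S) t x) = h x))"

lemma tr:
  assumes "small TYPE('v) S" "X \<in> Ob E" "h \<in> pts X \<rightarrow> S"
  shows tr_in: "tr S X h \<in> Hom E X (R S)"
    and ev_tr: "\<And>x. x \<in> pts X \<Longrightarrow> ev S (app X (R S) (tr S X h) x) = h x"
  using theI'[OF transpose[OF assms]] unfolding tr_def by auto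

lemma maps_into_R_eqI:
  assumes S: "small TYPE('v) S" and X: "X \<in> Ob E" and t: "t \<in> Hom E X (R S)" and t': "t' \<in> Hom E X (R S)"
    and eq: "\<And>x. x \<in> pts X \<Longrightarrow> ev S (app X (R S) t x) = ev S (app X (R S) t' x)"
  shows "t = t'"
proof -
  have "(\<lambda>x. ev S (app X (R S) t x)) \<in> pts X \<rightarrow> S"
    using ev[OF S app_in[OF X R[OF S] t]] by blast
  from transpose[OF S X this] show ?thesis using t t' eq by metis
qed

lemma two_values:
  obtains a b :: 'v where "a \<noteq> b" "small TYPE('v) {a, b}"
proof -
  obtain a :: 'v where "a \<noteq> undefined"
    using ex_new_if_finite[OF universe_infinite[OF univ], of "{undefined}"] by auto
  then show thesis by (rule that) (rule small_finite[OF univ], simp)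
qed

subsection \<open>Initial objects and complements\<close>

lemma initial_source:
  assumes V: "initial_object E V" and W: "W \<in> Ob E" and f: "f \<in> Hom E W V"
  shows "initial_object E W"
proof -
  obtain I where I: "initial_object E I" "\<And>V. V \<in> Ob E \<Longrightarrow> Hom E V I \<noteq> {} \<Longrightarrow> initial_object E V"
    using strict_initial unfolding has_strict_initial_def by blast
  have VO: "V \<in> Ob E" and IO: "I \<in> Ob E" using V I unfolding initial_object_def by auto
  then obtain g where "g \<in> Hom E V I" using V unfolding initial_object_def by blast
  then show ?thesis using I(2)[OF W] cmp_in[OF W VO IO f] by blast
qed

lemma initial_unique:
  "initial_object E V \<Longrightarrow> X \<in> Ob E \<Longrightarrow> f \<in> Hom E V X \<Longrightarrow> g \<in> Hom E V X \<Longrightarrow> f = g"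
  unfolding initial_object_def by blast

text \<open>If an initial object had a point, then \<open>A\<close> would be initial by strictness. But \<open>A\<close> has the
  point \<open>1\<close>, on which two different constant functions differ, so there are two arrows from \<open>A\<close> to
  \<open>R {a, b}\<close>.\<close>

lemma initial_no_points:
  assumes V: "initial_object E V" shows "pts V = {}"
proof (rule ccontr)
  assume "pts V \<noteq> {}"
  then have ini: "initial_object E A" using initial_source[OF V A] by blast
  obtain a b :: 'v where ab: "a \<noteq> b" and S: "small TYPE('v) {a, b}" by (rule two_values)
  let ?ta = "tr {a, b} A (\<lambda>_. a)" and ?tb = "tr {a, b} A (\<lambda>_. b)"
  have "?ta = ?tb" by (rule initial_unique[OF ini R[OF S]]) (auto intro!: tr_in[OF S A])
  then show False
    using ab ev_tr[OF S A, of "\<lambda>_. a", OF _ idA] ev_tr[OF S A, of "\<lambda>_. b", OF _ idA] by simp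
qed

lemma initial_mono:
  assumes V: "initial_object E V" and X: "X \<in> Ob E"
  obtains k where "is_mono E V X k"
proof -
  obtain k where k: "k \<in> Hom E V X" using V X unfolding initial_object_def by blast
  have VO: "V \<in> Ob E" using V unfolding initial_object_def by blast
  have "is_mono E V X k"
    unfolding is_mono_def using k initial_unique[OF initial_source[OF V] VO] by blast
  then show thesis by (rule that)
qed

lemma ident_mono: "X \<in> Ob E \<Longrightarrow> is_mono E X X (Ident E X)"
  unfolding is_mono_def by (simp add: ident_in ident_left)

lemma monoD:
  assumes "is_mono E a b m"
  shows mono_in: "m \<in> Hom E a b"
    and mono_cancel: "\<And>x f g. x \<in> Ob E \<Longrightarrow> f \<in> Hom E x a \<Longrightarrow> g \<in> Hom E x a \<Longrightarrow>
      Cmp E x a b m f = Cmp E x a b m g \<Longrightarrow> f = g"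
  using assms unfolding is_mono_def by auto

lemma equalizer:
  assumes "X \<in> Ob E" "Y \<in> Ob E" "f \<in> Hom E X Y" "g \<in> Hom E X Y"
  obtains W k where "W \<in> Ob E" "is_mono E W X k" "Cmp E W X Y f k = Cmp E W X Y g k"
    "\<forall>Z\<in>Ob E. \<forall>z\<in>Hom E Z X. Cmp E Z X Y f z = Cmp E Z X Y g z \<longrightarrow>
      (\<exists>u\<in>Hom E Z W. Cmp E Z W X k u = z)"
proof -
  obtain W k where W: "W \<in> Ob E" and k: "k \<in> Hom E W X" and eq: "Cmp E W X Y f k = Cmp E W X Y g k"
    and fac: "\<And>Z z. Z \<in> Ob E \<Longrightarrow> z \<in> Hom E Z X \<Longrightarrow> Cmp E Z X Y f z = Cmp E Z X Y g z \<Longrightarrow>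
      \<exists>!u. u \<in> Hom E Z W \<and> Cmp E Z W X k u = z"
    using equalizers[unfolded has_equalizers_def, rule_format, OF assms] by blast
  have "is_mono E W X k"
    unfolding is_mono_def
  proof (intro conjI k ballI impI)
    fix Z u u' assume Z: "Z \<in> Ob E" and u: "u \<in> Hom E Z W" "u' \<in> Hom E Z W"
      and uu: "Cmp E Z W X k u = Cmp E Z W X k u'"
    have ku: "Cmp E Z W X k u \<in> Hom E Z X" using cmp_in[OF Z W assms(1) u(1) k] .
    have "Cmp E Z X Y f (Cmp E Z W X k u) = Cmp E Z X Y g (Cmp E Z W X k u)"
      using assoc[OF Z W assms(1,2) u(1) k assms(3)] assoc[OF Z W assms(1,2) u(1) k assms(4)] eq by simp
    from fac[OF Z ku this] show "u = u'" using u uu by metis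
  qed
  then show thesis using that[OF W _ eq] fac by blast
qed

text \<open>The intersection of two complementary subobjects is contained in every subobject, in
  particular in the initial one, so strictness makes it initial.\<close>

lemma complementary_covers:
  assumes X: "X \<in> Ob E" and U: "U \<in> Ob E" and V: "V \<in> Ob E" and mm: "is_mono E U X m" and nm: "is_mono E V X n"
    and comp: "complementary_subobjects E X U m V n"
  shows "covers_disjointly E X U m V n"
  unfolding covers_disjointly_def
proof (intro conjI ballI allI impI)
  note m = mono_in[OF mm] and n = mono_in[OF nm]
  fix W a b assume W: "W \<in> Ob E" and a: "a \<in> Hom E W U" and b: "b \<in> Hom E W V"
    and eq: "Cmp E W U X m a = Cmp E W V X n b"
  obtain P a' b' where P: "P \<in> Ob E" and a': "a' \<in> Hom E P U" and b': "b' \<in> Hom E P V"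
    and eq': "Cmp E P U X m a' = Cmp E P V X n b'"
    and fac: "\<And>Z u v. Z \<in> Ob E \<Longrightarrow> u \<in> Hom E Z U \<Longrightarrow> v \<in> Hom E Z V \<Longrightarrow>
      Cmp E Z U X m u = Cmp E Z V X n v \<Longrightarrow>
      \<exists>!t. t \<in> Hom E Z P \<and> Cmp E Z P U a' t = u \<and> Cmp E Z P V b' t = v"
    using pullbacks[unfolded has_pullbacks_def, rule_format, OF X U V m n] by blast
  have "is_mono E P X (Cmp E P U X m a')"
    unfolding is_mono_def
  proof (intro conjI ballI impI, rule cmp_in[OF P U X a' m])
    fix Z f g assume Z: "Z \<in> Ob E" and f: "f \<in> Hom E Z P" and g: "g \<in> Hom E Z P"
      and fg: "Cmp E Z P X (Cmp E P U X m a') f = Cmp E Z P X (Cmp E P U X m a') g"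
    note af = cmp_in[OF Z P U f a'] and ag = cmp_in[OF Z P U g a']
      and bf = cmp_in[OF Z P V f b'] and bg = cmp_in[OF Z P V g b']
    have 1: "Cmp E Z P U a' f = Cmp E Z P U a' g"
      using mono_cancel[OF mm Z af ag] fg assoc[OF Z P U X f a' m] assoc[OF Z P U X g a' m] by simp
    have 2: "Cmp E Z P V b' f = Cmp E Z P V b' g"
      using mono_cancel[OF nm Z bf bg] fg[unfolded eq'] assoc[OF Z P V X f b' n] assoc[OF Z P V X g b' n] by simp
    have "Cmp E Z U X m (Cmp E Z P U a' f) = Cmp E Z V X n (Cmp E Z P V b' f)"
      using assoc[OF Z P U X f a' m] assoc[OF Z P V X f b' n] eq' by simp
    from fac[OF Z af bf this] show "f = g" using f g 1 2 by metis
  qed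
  moreover have "sub_le E X P (Cmp E P U X m a') U m" "sub_le E X P (Cmp E P U X m a') V n"
    unfolding sub_le_def using a' b' eq' by auto
  moreover obtain I where I: "initial_object E I"
    using strict_initial unfolding has_strict_initial_def by blast
  moreover have IO: "I \<in> Ob E" using I unfolding initial_object_def by blast
  moreover obtain z where "is_mono E I X z" using initial_mono[OF I X] .
  ultimately have "sub_le E X P (Cmp E P U X m a') I z"
    using comp P unfolding complementary_subobjects_def by blast
  then obtain f where "f \<in> Hom E P I" unfolding sub_le_def by blast
  moreover obtain t where "t \<in> Hom E W P" using fac[OF W a b eq] by blast
  ultimately show "initial_object E W" using initial_source[OF initial_source[OF I P] W] by blast
next
  fix W k assume W: "W \<in> Ob E" and k: "is_mono E W X k" "sub_le E X U m W k" "sub_le E X V n W k"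
  have "sub_le E X X (Ident E X) W k"
    using comp W k X ident_mono[OF X] unfolding complementary_subobjects_def by blast
  then show "\<exists>s\<in>Hom E X W. Cmp E X W X k s = Ident E X" unfolding sub_le_def by blast
qed

text \<open>A point in both parts would make \<open>A\<close> initial. If a point \<open>x\<close> were in neither, the indicator
  function of \<open>x\<close> and a constant function would define two arrows \<open>X \<rightarrow> R {a, b}\<close> that agree on both
  parts, hence on the equalizer that contains them, hence everywhere.\<close>

lemma covers_disjointly_points:
  assumes X: "X \<in> Ob E" and U: "U \<in> Ob E" and V: "V \<in> Ob E" and m: "m \<in> Hom E U X" and n: "n \<in> Hom E V X"
    and cov: "covers_disjointly E X U m V n" and x: "x \<in> pts X"
  shows "x \<in> app U X m ` pts U \<longleftrightarrow> x \<notin> app V X n ` pts V"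
proof
  assume "x \<in> app U X m ` pts U"
  then obtain u where u: "u \<in> pts U" "x = app U X m u" by blast
  show "x \<notin> app V X n ` pts V"
  proof
    assume "x \<in> app V X n ` pts V"
    then obtain v where v: "v \<in> pts V" "x = app V X n v" by blast
    have "initial_object E A" using cov A u v unfolding covers_disjointly_def by metis
    then show False using initial_no_points idA by blast
  qed
next
  assume xV: "x \<notin> app V X n ` pts V"
  show "x \<in> app U X m ` pts U"
  proof (rule ccontr)
    assume xU: "x \<notin> app U X m ` pts U"
    obtain a b :: 'v where ab: "a \<noteq> b" and S: "small TYPE('v) {a, b}" by (rule two_values)
    note RS = R[OF S]
    have tin: "tr {a, b} X h \<in> Hom E X (R {a, b})" if "h \<in> pts X \<rightarrow> {a, b}" for h
      by (rule tr_in[OF S X that])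
    define g where "g y = (if y = x then b else a)" for y
    have g: "g \<in> pts X \<rightarrow> {a, b}" and c: "(\<lambda>_. a) \<in> pts X \<rightarrow> {a, b}" by (auto simp: g_def)
    obtain W k where W: "W \<in> Ob E" and k: "is_mono E W X k"
      and eq: "Cmp E W X (R {a, b}) (tr {a, b} X g) k = Cmp E W X (R {a, b}) (tr {a, b} X (\<lambda>_. a)) k"
      and fac0: "\<forall>Z\<in>Ob E. \<forall>z\<in>Hom E Z X.
        Cmp E Z X (R {a, b}) (tr {a, b} X g) z = Cmp E Z X (R {a, b}) (tr {a, b} X (\<lambda>_. a)) z \<longrightarrow>
        (\<exists>u\<in>Hom E Z W. Cmp E Z W X k u = z)"
      by (rule equalizer[OF X RS tin[OF g] tin[OF c]])
    note fac = fac0[rule_format]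
    have le: "sub_le E X Z z W k" if Z: "Z \<in> Ob E" and z: "z \<in> Hom E Z X" and xz: "x \<notin> app Z X z ` pts Z" for Z z
    proof -
      have "Cmp E Z X (R {a, b}) (tr {a, b} X g) z = Cmp E Z X (R {a, b}) (tr {a, b} X (\<lambda>_. a)) z"
      proof (rule maps_into_R_eqI[OF S Z])
        fix y assume y: "y \<in> pts Z"
        note zy = app_in[OF Z X z y]
        have "app Z X z y \<noteq> x" using xz y by blast
        then show "ev {a, b} (app Z (R {a, b}) (Cmp E Z X (R {a, b}) (tr {a, b} X g) z) y) =
          ev {a, b} (app Z (R {a, b}) (Cmp E Z X (R {a, b}) (tr {a, b} X (\<lambda>_. a)) z) y)"
          unfolding app_cmp[OF Z X RS z tin[OF g] y] app_cmp[OF Z X RS z tin[OF c] y]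
            ev_tr[OF S X g zy] ev_tr[OF S X c zy] by (simp add: g_def)
      qed (auto intro!: cmp_in[OF Z X RS z] tin g)
      from fac[OF Z z this] show ?thesis unfolding sub_le_def .
    qed
    obtain s where s: "s \<in> Hom E X W" "Cmp E X W X k s = Ident E X"
      using cov W k le[OF U m xU] le[OF V n xV] unfolding covers_disjointly_def by blast
    note k' = mono_in[OF k]
    have "tr {a, b} X g = tr {a, b} X (\<lambda>_. a)"
      using assoc[OF X W X RS s(1) k' tin[OF g]] assoc[OF X W X RS s(1) k' tin[OF c]] s(2) eq
        ident_right[OF X RS tin[OF g]] ident_right[OF X RS tin[OF c]] by simp
    then show False
      using ab ev_tr[OF S X g x] ev_tr[OF S X c x] by (simp add: g_def)
  qed
qed

lemma complement:
  assumes X: "X \<in> Ob E" and U: "U \<in> Ob E" and m: "is_mono E U X m"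
  obtains V n where "V \<in> Ob E" "is_mono E V X n" "covers_disjointly E X U m V n"
    "\<forall>x\<in>pts X. x \<in> app U X m ` pts U \<longleftrightarrow> x \<notin> app V X n ` pts V"
proof -
  obtain V n where V: "V \<in> Ob E" and n: "is_mono E V X n" and c: "complementary_subobjects E X U m V n"
    using boolean X U m unfolding boolean_topos_def by blast
  note cov = complementary_covers[OF X U V m n c]
  show thesis
    by (rule that[OF V n cov]) (use covers_disjointly_points[OF X U V mono_in[OF m] mono_in[OF n] cov] in blast)
qed

subsection \<open>Subobjects given by sets of points\<close>

text \<open>The subobject is the equalizer of the two arrows \<open>Z \<rightarrow> R {a, b}\<close> given by the indicator
  function of \<open>B\<close> and by a constant. An arrow equalizes them if and only if it sends all
  points into \<open>B\<close>.\<close>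

lemma subobject_of_points:
  assumes Z: "Z \<in> Ob E"
  obtains W k where "W \<in> Ob E" "is_mono E W Z k"
    "\<forall>X\<in>Ob E. \<forall>f\<in>Hom E X Z.
      (\<exists>u\<in>Hom E X W. Cmp E X W Z k u = f) \<longleftrightarrow> (\<forall>x\<in>pts X. app X Z f x \<in> B)"
proof -
  obtain a b :: 'v where ab: "a \<noteq> b" and S: "small TYPE('v) {a, b}" by (rule two_values)
  note RS = R[OF S]
  have tin: "tr {a, b} Z h \<in> Hom E Z (R {a, b})" if "h \<in> pts Z \<rightarrow> {a, b}" for h
    by (rule tr_in[OF S Z that])
  define g where "g y = (if y \<in> B then a else b)" for y
  have g: "g \<in> pts Z \<rightarrow> {a, b}" and c: "(\<lambda>_. a) \<in> pts Z \<rightarrow> {a, b}" by (auto simp: g_def)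
  obtain W k where W: "W \<in> Ob E" and k: "is_mono E W Z k"
    and eq: "Cmp E W Z (R {a, b}) (tr {a, b} Z g) k = Cmp E W Z (R {a, b}) (tr {a, b} Z (\<lambda>_. a)) k"
    and fac0: "\<forall>X\<in>Ob E. \<forall>z\<in>Hom E X Z.
      Cmp E X Z (R {a, b}) (tr {a, b} Z g) z = Cmp E X Z (R {a, b}) (tr {a, b} Z (\<lambda>_. a)) z \<longrightarrow>
      (\<exists>u\<in>Hom E X W. Cmp E X W Z k u = z)"
    by (rule equalizer[OF Z RS tin[OF g] tin[OF c]])
  note fac = fac0[rule_format]
  have char: "Cmp E X Z (R {a, b}) (tr {a, b} Z g) f = Cmp E X Z (R {a, b}) (tr {a, b} Z (\<lambda>_. a)) f \<longleftrightarrow>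
      (\<forall>x\<in>pts X. app X Z f x \<in> B)" (is "?l = ?r \<longleftrightarrow> _") if X: "X \<in> Ob E" and f: "f \<in> Hom E X Z" for X f
  proof -
    have e: "ev {a, b} (app X (R {a, b}) ?l x) = g (app X Z f x)"
      "ev {a, b} (app X (R {a, b}) ?r x) = a" if x: "x \<in> pts X" for x
      unfolding app_cmp[OF X Z RS f tin[OF g] x] app_cmp[OF X Z RS f tin[OF c] x]
        ev_tr[OF S Z g app_in[OF X Z f x]] ev_tr[OF S Z c app_in[OF X Z f x]] by simp_all
    have "?l = ?r \<longleftrightarrow> (\<forall>x\<in>pts X. g (app X Z f x) = a)"
    proof
      assume "?l = ?r"
      then show "\<forall>x\<in>pts X. g (app X Z f x) = a" using e by metis
    next
      assume "\<forall>x\<in>pts X. g (app X Z f x) = a"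
      then show "?l = ?r"
        by (intro maps_into_R_eqI[OF S X] cmp_in[OF X Z RS f] tin g c) (simp add: e)
    qed
    then show ?thesis using ab by (auto simp: g_def)
  qed
  show thesis
  proof (rule that[OF W k], intro ballI)
    fix X f assume X: "X \<in> Ob E" and f: "f \<in> Hom E X Z"
    show "(\<exists>u\<in>Hom E X W. Cmp E X W Z k u = f) \<longleftrightarrow> (\<forall>x\<in>pts X. app X Z f x \<in> B)"
      unfolding char[OF X f, symmetric]
    proof
      assume "\<exists>u\<in>Hom E X W. Cmp E X W Z k u = f"
      then obtain u where u: "u \<in> Hom E X W" "Cmp E X W Z k u = f" by blast
      show "Cmp E X Z (R {a, b}) (tr {a, b} Z g) f = Cmp E X Z (R {a, b}) (tr {a, b} Z (\<lambda>_. a)) f"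
        using assoc[OF X W Z RS u(1) mono_in[OF k] tin[OF g]] assoc[OF X W Z RS u(1) mono_in[OF k] tin[OF c]] eq u(2)
        by simp
    qed (rule fac[OF X f])
  qed
qed

text \<open>A point \<open>z\<close> factors through the subobject if all \<open>z \<circ> e\<close> lie in \<open>B\<close>, because the points of \<open>A\<close>
  are its endomorphisms. For invariant \<open>B\<close> this just means that \<open>z\<close> lies in \<open>B\<close>.\<close>

lemma invariant_subobject:
  assumes Z: "Z \<in> Ob E" and inv: "\<And>z e. z \<in> B \<Longrightarrow> e \<in> pts A \<Longrightarrow> act Z z e \<in> B" and B: "B \<subseteq> pts Z"
  obtains W k where "W \<in> Ob E" "is_mono E W Z k" "app W Z k ` pts W = B"
    "\<forall>X\<in>Ob E. \<forall>f\<in>Hom E X Z. (\<forall>x\<in>pts X. app X Z f x \<in> B) \<longrightarrow>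
      (\<exists>u\<in>Hom E X W. Cmp E X W Z k u = f)"
proof -
  obtain W k where W: "W \<in> Ob E" and k: "is_mono E W Z k"
    and fac0: "\<forall>X\<in>Ob E. \<forall>f\<in>Hom E X Z.
      (\<exists>u\<in>Hom E X W. Cmp E X W Z k u = f) \<longleftrightarrow> (\<forall>x\<in>pts X. app X Z f x \<in> B)"
    by (rule subobject_of_points[OF Z, of B])
  note fac = bspec[OF bspec[OF fac0]]
  have "app W Z k ` pts W = B"
  proof (intro equalityI subsetI)
    fix z assume "z \<in> app W Z k ` pts W"
    then show "z \<in> B"
      using fac[OF W mono_in[OF k]] ident_in[OF W] ident_right[OF W Z mono_in[OF k]] by blast
  next
    fix z assume z: "z \<in> B"
    then have "\<forall>e\<in>pts A. act Z z e \<in> B" using inv by blast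
    then have "\<exists>u\<in>pts W. app W Z k u = z" using fac[OF A, of z] z B by blast
    then show "z \<in> app W Z k ` pts W" by blast
  qed
  then show thesis using that[OF W k] fac by blast
qed

subsection \<open>Objects with a prescribed action on points\<close>

text \<open>A point of \<open>R S\<close> amounts to a function from the endomorphisms of \<open>A\<close> to \<open>S\<close>. The object sought is
  the subobject of \<open>R S\<close> whose points are the orbit maps \<open>e \<mapsto> \<beta> s e\<close>; evaluation at the identity
  identifies them with \<open>S\<close>. In other words, an action on \<open>S\<close> is a coalgebra structure for the comonad
  \<open>S \<mapsto> pts (R S)\<close>.\<close>

lemma object_of_action:
  fixes S :: "'v set"
  assumes S: "small TYPE('v) S" and \<beta>: "\<And>s e. s \<in> S \<Longrightarrow> e \<in> pts A \<Longrightarrow> \<beta> s e \<in> S"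
    and one: "\<And>s. s \<in> S \<Longrightarrow> \<beta> s idA = s"
    and mult: "\<And>s e d. s \<in> S \<Longrightarrow> e \<in> pts A \<Longrightarrow> d \<in> pts A \<Longrightarrow> \<beta> (\<beta> s e) d = \<beta> s (act A e d)"
  obtains X \<psi> where "X \<in> Ob E" "bij_betw \<psi> (pts X) S"
    "\<forall>x\<in>pts X. \<forall>e\<in>pts A. \<psi> (act X x e) = \<beta> (\<psi> x) e"
proof -
  note RS = R[OF S]
  \<comment> \<open>These \<open>y\<close> correspond to the orbit maps \<open>e \<mapsto> \<beta> s e\<close>, with \<open>s = ev S y\<close>.\<close>
  define B where "B = {y \<in> pts (R S). \<forall>e\<in>pts A. ev S (act (R S) y e) = \<beta> (ev S y) e}"
  have inv: "act (R S) y e \<in> B" if y: "y \<in> B" and e: "e \<in> pts A" for y e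
  proof -
    have y': "y \<in> pts (R S)" "\<And>e. e \<in> pts A \<Longrightarrow> ev S (act (R S) y e) = \<beta> (ev S y) e"
      using y by (auto simp: B_def)
    show ?thesis
      unfolding B_def
    proof (intro CollectI conjI ballI act_in[OF RS y'(1) e])
      fix d assume d: "d \<in> pts A"
      show "ev S (act (R S) (act (R S) y e) d) = \<beta> (ev S (act (R S) y e)) d"
        using act_act[OF RS y'(1) e d] y'(2)[OF act_in[OF A e d]] y'(2)[OF e] mult[OF ev[OF S y'(1)] e d] by simp
    qed
  qed
  obtain X k where X: "X \<in> Ob E" and k: "is_mono E X (R S) k" and img: "app X (R S) k ` pts X = B"
    by (rule invariant_subobject[OF RS inv]) (auto simp: B_def)
  note k' = mono_in[OF k]
  have kB: "app X (R S) k x \<in> pts (R S)" "ev S (act (R S) (app X (R S) k x) e) = \<beta> (ev S (app X (R S) k x)) e"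
    if "x \<in> pts X" "e \<in> pts A" for x e
    using img that unfolding B_def by blast+
  have eq: "\<forall>x\<in>pts X. \<forall>e\<in>pts A. ev S (app X (R S) k (act X x e)) = \<beta> (ev S (app X (R S) k x)) e"
    using kB(2) app_act[OF X RS k'] by simp
  have bij: "bij_betw (\<lambda>x. ev S (app X (R S) k x)) (pts X) S"
      unfolding bij_betw_def
    proof (intro conjI inj_onI equalityI subsetI)
      fix x y assume x: "x \<in> pts X" and y: "y \<in> pts X" and eq: "ev S (app X (R S) k x) = ev S (app X (R S) k y)"
      have "app X (R S) k x = app X (R S) k y"
        by (rule maps_into_R_eqI[OF S A kB(1)[OF x idA] kB(1)[OF y idA]]) (simp add: kB(2) x y eq)
      then show "x = y" by (rule mono_cancel[OF k A x y])
    next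
      fix s assume s: "s \<in> S"
      have h: "\<beta> s \<in> pts A \<rightarrow> S" using \<beta>[OF s] by blast
      define y where "y = tr S A (\<beta> s)"
      have y: "y \<in> pts (R S)" and evy: "\<And>e. e \<in> pts A \<Longrightarrow> ev S (act (R S) y e) = \<beta> s e"
        unfolding y_def using tr_in[OF S A h] ev_tr[OF S A h] by auto
      have "ev S y = s" using evy[OF idA] act_id[OF RS y] one[OF s] by simp
      then have "y \<in> B" unfolding B_def using y evy by simp
      then obtain x where "x \<in> pts X" "y = app X (R S) k x" using img by blast
      then show "s \<in> (\<lambda>x. ev S (app X (R S) k x)) ` pts X"
        using \<open>ev S y = s\<close> by blast
    qed (use ev[OF S kB(1)[OF _ idA]] in blast)
  show thesis by (rule that[OF X bij eq])
qed

end

subsection \<open>Conservative points\<close>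

locale conservative_point = representable_point E A R ev
  for E :: "('o, 'm) cat" and A and R :: "'v set \<Rightarrow> 'o" and ev +
  assumes no_points_initial: "V \<in> Ob E \<Longrightarrow> Hom E A V = {} \<Longrightarrow> initial_object E V"
begin

text \<open>The complement of such a subobject has no points, so it is initial and is contained in the
  subobject itself.\<close>

lemma mono_onto_points_split:
  assumes X: "X \<in> Ob E" and U: "U \<in> Ob E" and m: "is_mono E U X m" and onto: "app U X m ` pts U = pts X"
  obtains s where "s \<in> Hom E X U" "Cmp E X U X m s = Ident E X"
proof -
  obtain V n where V: "V \<in> Ob E" and n: "is_mono E V X n" and cov: "covers_disjointly E X U m V n"
    and disj: "\<forall>x\<in>pts X. x \<in> app U X m ` pts U \<longleftrightarrow> x \<notin> app V X n ` pts V"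
    by (rule complement[OF X U m])
  have "pts V = {}"
    using disj app_in[OF V X mono_in[OF n]] onto by blast
  then have ini: "initial_object E V" by (rule no_points_initial[OF V])
  then obtain f where f: "f \<in> Hom E V U" using U unfolding initial_object_def by blast
  have "Cmp E V U X m f = n"
    by (rule initial_unique[OF ini X cmp_in[OF V U X f mono_in[OF m]] mono_in[OF n]])
  then have "sub_le E X V n U m" unfolding sub_le_def using f by blast
  moreover have "sub_le E X U m U m"
    unfolding sub_le_def using ident_in[OF U] ident_right[OF U X mono_in[OF m]] by blast
  ultimately show thesis using that cov U m unfolding covers_disjointly_def by blast
qed

text \<open>The equalizer of \<open>f\<close> and \<open>g\<close> contains all points.\<close>

lemma arrows_eqI:
  assumes X: "X \<in> Ob E" and Y: "Y \<in> Ob E" and f: "f \<in> Hom E X Y" and g: "g \<in> Hom E X Y"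
    and eq: "\<And>x. x \<in> pts X \<Longrightarrow> app X Y f x = app X Y g x"
  shows "f = g"
proof -
  obtain W k where W: "W \<in> Ob E" and k: "is_mono E W X k" and fk: "Cmp E W X Y f k = Cmp E W X Y g k"
    and fac0: "\<forall>Z\<in>Ob E. \<forall>z\<in>Hom E Z X. Cmp E Z X Y f z = Cmp E Z X Y g z \<longrightarrow>
      (\<exists>u\<in>Hom E Z W. Cmp E Z W X k u = z)"
    by (rule equalizer[OF X Y f g])
  note fac = fac0[rule_format]
  note k' = mono_in[OF k]
  have "app W X k ` pts W = pts X"
  proof (intro equalityI subsetI)
    fix x assume "x \<in> pts X"
    then show "x \<in> app W X k ` pts W" using fac[OF A _ eq] by blast
  qed (use app_in[OF W X k'] in blast)
  then obtain s where s: "s \<in> Hom E X W" "Cmp E X W X k s = Ident E X"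
    by (rule mono_onto_points_split[OF X W k])
  show ?thesis
    using assoc[OF X W X Y s(1) k' f] assoc[OF X W X Y s(1) k' g] fk s(2)
      ident_right[OF X Y f] ident_right[OF X Y g] by simp
qed

text \<open>Injectivity on points makes \<open>f\<close> a monomorphism since arrows are determined on points, and
  surjectivity makes it split.\<close>

lemma bij_on_points_iso:
  assumes X: "X \<in> Ob E" and Y: "Y \<in> Ob E" and f: "f \<in> Hom E X Y" and bij: "bij_betw (app X Y f) (pts X) (pts Y)"
  shows "is_iso E X Y f"
proof -
  have inj: "x = x'" if "x \<in> pts X" "x' \<in> pts X" "app X Y f x = app X Y f x'" for x x'
    using bij_betw_imp_inj_on[OF bij] that by (meson inj_onD)
  have mono: "is_mono E X Y f"
    unfolding is_mono_def
  proof (intro conjI f ballI impI)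
    fix Z u v assume Z: "Z \<in> Ob E" and u: "u \<in> Hom E Z X" and v: "v \<in> Hom E Z X"
      and uv: "Cmp E Z X Y f u = Cmp E Z X Y f v"
    show "u = v"
    proof (rule arrows_eqI[OF Z X u v])
      fix z assume z: "z \<in> pts Z"
      show "app Z X u z = app Z X v z"
        by (rule inj[OF app_in[OF Z X u z] app_in[OF Z X v z]])
          (use uv in \<open>simp flip: app_cmp[OF Z X Y u f z] app_cmp[OF Z X Y v f z]\<close>)
    qed
  qed
  obtain s where s: "s \<in> Hom E Y X" "Cmp E Y X Y f s = Ident E Y"
    by (rule mono_onto_points_split[OF Y X mono bij_betw_imp_surj_on[OF bij]])
  have "Cmp E X Y X s f = Ident E X"
    by (rule mono_cancel[OF mono X cmp_in[OF X Y X f s(1)] ident_in[OF X]])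
      (use assoc[OF X Y X Y f s(1) f] s(2) ident_left[OF X Y f] ident_right[OF X Y f] in simp)
  then show ?thesis by (rule is_isoI[OF f s(1) _ s(2)])
qed

text \<open>The points of the form \<open>e \<circ> d\<close> are the points of a subobject of \<open>A\<close>. The identity lies in it or
  in its complement; in the second case all of \<open>A\<close>, and in particular the point \<open>e\<close>, would lie in the
  complement.\<close>

lemma endomorphism_right_inverse:
  assumes e: "e \<in> pts A"
  obtains d where "d \<in> pts A" "act A e d = idA"
proof -
  define B where "B = act A e ` pts A"
  have inv: "act A b d \<in> B" if "b \<in> B" "d \<in> pts A" for b d
    using that act_act[OF A e _ that(2)] act_in[OF A] unfolding B_def by auto
  have B: "B \<subseteq> pts A" unfolding B_def using act_in[OF A e] by blast
  have eB: "e \<in> B" unfolding B_def using idA act_id[OF A e] by force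
  obtain W k where W: "W \<in> Ob E" and k: "is_mono E W A k" and img: "app W A k ` pts W = B"
    by (rule invariant_subobject[OF A inv B])
  obtain V n where V: "V \<in> Ob E" and n: "is_mono E V A n"
    and disj0: "\<forall>x\<in>pts A. x \<in> app W A k ` pts W \<longleftrightarrow> x \<notin> app V A n ` pts V"
    by (rule complement[OF A W k])
  note disj = bspec[OF disj0]
  have "idA \<in> B"
  proof (rule ccontr)
    assume "idA \<notin> B"
    then obtain v where v: "v \<in> pts V" "idA = app V A n v" using disj[OF idA] img by blast
    have "app V A n (act V v e) = e"
      using app_act[OF V A mono_in[OF n] v(1) e] v(2)[symmetric] ident_left[OF A A e] by simp
    then have "e \<in> app V A n ` pts V" using act_in[OF V v(1) e] by force
    then show False using disj[OF e] img eB by blast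
  qed
  then show thesis using that unfolding B_def by force
qed

lemma endomorphism_iso: "e \<in> pts A \<Longrightarrow> is_iso E A A e"
proof -
  assume e: "e \<in> pts A"
  obtain d where d: "d \<in> pts A" "act A e d = idA" by (rule endomorphism_right_inverse[OF e])
  obtain c where c: "c \<in> pts A" "act A d c = idA" by (rule endomorphism_right_inverse[OF d(1)])
  have "e = c"
    using act_act[OF A e d(1) c(1)] d(2) c(2) act_id[OF A e] ident_left[OF A A c(1)] by simp
  then show "is_iso E A A e" using is_isoI[OF e d(1)] c(2) d(2) by simp
qed

lemma Aut_op_carrier: "carrier (Aut_op E A) = pts A"
  using endomorphism_iso by (auto simp: Aut_op_def is_iso_def)

lemma group_Aut_op: "group (Aut_op E A)"
proof (rule groupI, unfold Aut_op_carrier)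
  fix x y z assume "x \<in> pts A" "y \<in> pts A" "z \<in> pts A"
  then show "x \<otimes>\<^bsub>Aut_op E A\<^esub> y \<otimes>\<^bsub>Aut_op E A\<^esub> z = x \<otimes>\<^bsub>Aut_op E A\<^esub> (y \<otimes>\<^bsub>Aut_op E A\<^esub> z)"
    by (simp add: Aut_op_def act_act[OF A])
next
  fix x assume x: "x \<in> pts A"
  obtain d where "d \<in> pts A" "act A x d = idA" by (rule endomorphism_right_inverse[OF x])
  then show "\<exists>y\<in>pts A. y \<otimes>\<^bsub>Aut_op E A\<^esub> x = \<one>\<^bsub>Aut_op E A\<^esub>" by (auto simp: Aut_op_def)
qed (auto simp: Aut_op_def idA act_in[OF A] act_id[OF A])

text \<open>The arrow \<open>\<eta> : Y \<rightarrow> R (pts Y)\<close> identifies \<open>Y\<close> with the invariant subobject \<open>W\<close> of its points. The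
  arrow \<open>X \<rightarrow> R (pts Y)\<close> defined by \<open>\<phi>\<close> sends a point \<open>x\<close> to \<open>\<eta> (\<phi> x)\<close> because \<open>\<phi>\<close> is equivariant, so
  it factors through \<open>W\<close>.\<close>

lemma equivariant_map_arrow:
  assumes X: "X \<in> Ob E" and Y: "Y \<in> Ob E" and \<phi>: "\<phi> \<in> pts X \<rightarrow> pts Y"
    and equiv: "\<And>x e. x \<in> pts X \<Longrightarrow> e \<in> pts A \<Longrightarrow> \<phi> (act X x e) = act Y (\<phi> x) e"
  obtains f where "f \<in> Hom E X Y" "\<forall>x\<in>pts X. app X Y f x = \<phi> x"
proof -
  have "pts Y \<lesssim> (UNIV :: 'v set)"
    using points_small[OF Y] unfolding small_def by (rule lesspoll_imp_lepoll)
  then obtain j :: "_ \<Rightarrow> 'v" where j: "inj_on j (pts Y)" unfolding lepoll_def by blast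
  \<comment> \<open>\<open>S\<close> is a copy of \<open>pts Y\<close> inside the universe, to which \<open>R\<close> can be applied.\<close>
  define S where "S = j ` pts Y"
  have S: "small TYPE('v) S" unfolding S_def by (rule small_image[OF points_small[OF Y]])
  note RS = R[OF S]
  have jS: "j \<in> pts Y \<rightarrow> S" and j\<phi>S: "(\<lambda>x. j (\<phi> x)) \<in> pts X \<rightarrow> S" using \<phi> by (auto simp: S_def)
  define \<eta> where "\<eta> = tr S Y j"
  define q where "q = tr S X (\<lambda>x. j (\<phi> x))"
  have \<eta>: "\<eta> \<in> Hom E Y (R S)" and ev\<eta>: "\<And>y. y \<in> pts Y \<Longrightarrow> ev S (app Y (R S) \<eta> y) = j y"
    unfolding \<eta>_def using tr_in[OF S Y jS] ev_tr[OF S Y jS] by auto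
  have q: "q \<in> Hom E X (R S)" and evq: "\<And>x. x \<in> pts X \<Longrightarrow> ev S (app X (R S) q x) = j (\<phi> x)"
    unfolding q_def using tr_in[OF S X j\<phi>S] ev_tr[OF S X j\<phi>S] by auto
  have \<eta>_inj: "y = y'" if "y \<in> pts Y" "y' \<in> pts Y" "app Y (R S) \<eta> y = app Y (R S) \<eta> y'" for y y'
    using that ev\<eta> inj_onD[OF j] by metis
  have q\<eta>: "app X (R S) q x = app Y (R S) \<eta> (\<phi> x)" if x: "x \<in> pts X" for x
  proof (rule maps_into_R_eqI[OF S A])
    have \<phi>x: "\<phi> x \<in> pts Y" using \<phi> x by blast
    show "app X (R S) q x \<in> pts (R S)" by (rule app_in[OF X RS q x])
    show "app Y (R S) \<eta> (\<phi> x) \<in> pts (R S)" by (rule app_in[OF Y RS \<eta> \<phi>x])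
    show "ev S (act (R S) (app X (R S) q x) e) = ev S (act (R S) (app Y (R S) \<eta> (\<phi> x)) e)" if e: "e \<in> pts A" for e
      using app_act[OF X RS q x e] app_act[OF Y RS \<eta> \<phi>x e] evq[OF act_in[OF X x e]] ev\<eta>[OF act_in[OF Y \<phi>x e]]
        equiv[OF x e] by simp
  qed
  define B where "B = app Y (R S) \<eta> ` pts Y"
  have inv: "act (R S) b e \<in> B" if "b \<in> B" "e \<in> pts A" for b e
    using that app_act[OF Y RS \<eta> _ that(2)] act_in[OF Y _ that(2)] unfolding B_def by force
  have B: "B \<subseteq> pts (R S)" unfolding B_def using app_in[OF Y RS \<eta>] by blast
  obtain W k where W: "W \<in> Ob E" and k: "is_mono E W (R S) k" and img: "app W (R S) k ` pts W = B"
    and fac0: "\<forall>Z\<in>Ob E. \<forall>f\<in>Hom E Z (R S). (\<forall>z\<in>pts Z. app Z (R S) f z \<in> B) \<longrightarrow>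
      (\<exists>u\<in>Hom E Z W. Cmp E Z W (R S) k u = f)"
    by (rule invariant_subobject[OF RS inv B])
  note fac = fac0[rule_format]
  note k' = mono_in[OF k]
  obtain u where u: "u \<in> Hom E Y W" "Cmp E Y W (R S) k u = \<eta>" using fac[OF Y \<eta>] unfolding B_def by blast
  have ku: "app W (R S) k (app Y W u y) = app Y (R S) \<eta> y" if "y \<in> pts Y" for y
    using app_cmp[OF Y W RS u(1) k' that] u(2) by simp
  have "bij_betw (app Y W u) (pts Y) (pts W)"
    unfolding bij_betw_def
  proof (intro conjI inj_onI equalityI subsetI)
    fix y y' assume "y \<in> pts Y" "y' \<in> pts Y" "app Y W u y = app Y W u y'"
    then show "y = y'" using \<eta>_inj ku by metis
  next
    fix w assume w: "w \<in> pts W"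
    then have "app W (R S) k w \<in> B" using img by blast
    then obtain y where y: "y \<in> pts Y" "app W (R S) k w = app Y (R S) \<eta> y" unfolding B_def by blast
    then have "w = app Y W u y"
      using mono_cancel[OF k A w app_in[OF Y W u(1) y(1)]] ku[OF y(1)] by simp
    then show "w \<in> app Y W u ` pts Y" using y by blast
  qed (use app_in[OF Y W u(1)] in blast)
  then have "is_iso E Y W u" by (rule bij_on_points_iso[OF Y W u(1)])
  then obtain u' where u': "u' \<in> Hom E W Y" "Cmp E W Y W u u' = Ident E W" by (rule is_isoE)
  have "app X (R S) q x \<in> B" if "x \<in> pts X" for x
    unfolding q\<eta>[OF that] B_def using \<phi> that by blast
  then obtain w where w: "w \<in> Hom E X W" "Cmp E X W (R S) k w = q" using fac[OF X q] by blast
  show thesis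
  proof (rule that[OF cmp_in[OF X W Y w(1) u'(1)]], rule ballI)
    fix x assume x: "x \<in> pts X"
    note wx = app_in[OF X W w(1) x]
    note uwx = app_in[OF W Y u'(1) wx]
    have "app W (R S) k (app Y W u (app W Y u' (app X W w x))) = app W (R S) k (app X W w x)"
      using app_cmp[OF W Y W u'(1) u(1) wx] u'(2) app_id[OF W wx] by simp
    also have "\<dots> = app Y (R S) \<eta> (\<phi> x)" using app_cmp[OF X W RS w(1) k' x] w(2) q\<eta>[OF x] by simp
    finally have "app W Y u' (app X W w x) = \<phi> x"
      using \<eta>_inj[OF uwx] \<phi> x ku[OF uwx] by auto
    then show "app X Y (Cmp E X W Y u' w) x = \<phi> x" using app_cmp[OF X W Y w(1) u'(1) x] by simp
  qed
qed

end

subsection \<open>Connectedness\<close>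

text \<open>For \<open>n = 0\<close> this is the empty category, for \<open>n = 2\<close> the category of parallel arrows
  indexed by \<open>M\<close>. In each composite one of the
  factors is an identity, which is coded by \<open>0\<close>, so composition can be addition.\<close>

definition arrows_category :: "nat \<Rightarrow> nat set \<Rightarrow> (nat, nat) cat" where
  "arrows_category n M = \<lparr>Ob = {..<n},
     Hom = (\<lambda>i j. if i = j then {0} else if i = 0 \<and> j = 1 then M else {}),
     Ident = (\<lambda>i. 0), Cmp = (\<lambda>i j k g f. g + f)\<rparr>"

lemma finite_arrows_category: "finite M \<Longrightarrow> finite_category (arrows_category n M)"
  by (auto simp: finite_category_def category_def arrows_category_def)

context representable_point
begin

lemma preserves_terminal:
  assumes I: "is_functor Ens E I" and lim: "preserves_finite_limits Ens E I" and X: "X \<in> Ob E"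
  shows "\<exists>!u. u \<in> Hom E X (FOb I {a :: 'v})"
proof -
  let ?J = "arrows_category 0 {}"
  define D :: "(nat, nat, 'v set, 'v \<Rightarrow> 'v) fctr" where "D = \<lparr>FOb = (\<lambda>_. {}), FMor = (\<lambda>_ _ _ _. undefined)\<rparr>"
  have J: "finite_category ?J" by (rule finite_arrows_category) simp
  have D: "is_functor ?J Ens D" by (simp add: is_functor_def arrows_category_def)
  have "is_limit ?J Ens D {a} (\<lambda>_ _. undefined)"
    unfolding is_limit_def
  proof (intro conjI allI impI)
    fix x :: "'v set" and \<xi> :: "nat \<Rightarrow> 'v \<Rightarrow> 'v"
    show "\<exists>!u. u \<in> Hom Ens x {a} \<and>
       (\<forall>j\<in>Ob ?J. Cmp Ens x {a} (FOb D j) (\<lambda>_. undefined) u = \<xi> j)"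
      by (intro ex1I[of _ "\<lambda>_\<in>x. a"]) (auto simp: arrows_category_def PiE_iff extensional_def fun_eq_iff)
  qed (simp add: is_cone_def arrows_category_def small_finite[OF univ])
  then have "is_limit ?J E (comp_fctr I D) (FOb I {a}) (\<lambda>j. FMor I {a} (FOb D j) (\<lambda>_. undefined))"
    using lim J D unfolding preserves_finite_limits_def by blast
  moreover have "is_cone ?J E (comp_fctr I D) X (\<lambda>_. undefined)"
    using X by (simp add: is_cone_def arrows_category_def)
  ultimately have "\<exists>!u. u \<in> Hom E X (FOb I {a}) \<and> (\<forall>j\<in>Ob ?J. Cmp E X (FOb I {a}) (FOb (comp_fctr I D) j)
      (FMor I {a} (FOb D j) (\<lambda>_. undefined)) u = (\<lambda>_. undefined) j)"
    unfolding is_limit_def by blast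
  then show ?thesis by (simp add: arrows_category_def)
qed

text \<open>The two functions from a one-element set to a two-element set have empty equalizer, and
  left exactness carries this to \<open>E\<close>.\<close>

lemma preserves_empty_equalizer:
  assumes I: "is_functor Ens E I" and lim: "preserves_finite_limits Ens E I" and ab: "(a :: 'v) \<noteq> b"
    and W: "W \<in> Ob E" and u: "u \<in> Hom E W (FOb I {a})"
    and eq: "Cmp E W (FOb I {a}) (FOb I {a, b}) (FMor I {a} {a, b} (\<lambda>x\<in>{a}. a)) u =
      Cmp E W (FOb I {a}) (FOb I {a, b}) (FMor I {a} {a, b} (\<lambda>x\<in>{a}. b)) u"
  shows "Hom E W (FOb I {}) \<noteq> {}"
proof -
  define J where "J = arrows_category 2 {0, 1}"
  define X where "X i = (if i = 0 then {a} else {a, b})" for i :: nat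
  define D :: "(nat, nat, 'v set, 'v \<Rightarrow> 'v) fctr" where
    "D = \<lparr>FOb = X, FMor = (\<lambda>i j f. if i = j then (\<lambda>x\<in>X i. x) else (\<lambda>x\<in>{a}. if f = 0 then a else b))\<rparr>"
  have JF: "finite_category J" unfolding J_def by (rule finite_arrows_category) simp
  have sm: "small TYPE('v) {}" "small TYPE('v) {a}" "small TYPE('v) {a, b}"
    by (auto intro: small_finite[OF univ])
  have JOb: "Ob J = {0, 1}" by (auto simp: J_def arrows_category_def)
  have D: "is_functor J Ens D"
    unfolding is_functor_def JOb
    by (auto simp: D_def X_def J_def arrows_category_def compose_def fun_eq_iff sm small_finite[OF univ])
  have "is_limit J Ens D {} (\<lambda>_ _. undefined)"
    unfolding is_limit_def
  proof (intro conjI allI impI)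
    show "is_cone J Ens D {} (\<lambda>_ _. undefined)"
      by (auto simp: is_cone_def JOb D_def X_def compose_def small_finite[OF univ])
    fix x \<xi> assume c: "is_cone J Ens D x \<xi>"
    have c0: "\<xi> 0 \<in> x \<rightarrow>\<^sub>E {a}" using c by (simp add: is_cone_def JOb D_def X_def)
    have c1: "compose x (FMor D 0 1 0) (\<xi> 0) = \<xi> 1" "compose x (FMor D 0 1 1) (\<xi> 0) = \<xi> 1"
      using c by (auto simp: is_cone_def JOb J_def arrows_category_def)
    have "x = {}"
    proof (rule ccontr)
      assume "x \<noteq> {}"
      then obtain y where y: "y \<in> x" by blast
      then have "\<xi> 0 y = a" using c0 by auto
      then have "a = b" using fun_cong[OF c1(1), of y] fun_cong[OF c1(2), of y] y by (simp add: compose_def D_def)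
      with ab show False ..
    qed
    moreover have "\<xi> j = (\<lambda>_. undefined)" if "j \<in> {0, 1}" for j
      using c that \<open>x = {}\<close> by (auto simp: is_cone_def JOb)
    ultimately show "\<exists>!u. u \<in> Hom Ens x {} \<and> (\<forall>j\<in>Ob J. Cmp Ens x {} (FOb D j) (\<lambda>_. undefined) u = \<xi> j)"
      by (intro ex1I[of _ "\<lambda>_. undefined"]) (auto simp: JOb compose_def)
  qed
  then have L: "is_limit J E (comp_fctr I D) (FOb I {}) (\<lambda>j. FMor I {} (FOb D j) (\<lambda>_. undefined))"
    using lim JF D unfolding preserves_finite_limits_def by blast
  let ?c = "\<lambda>c. FMor I {a} {a, b} (\<lambda>x\<in>{a}. c)"
  define \<xi> where "\<xi> j = (if j = 0 then u else Cmp E W (FOb I {a}) (FOb I {a, b}) (?c a) u)" for j :: nat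
  have IO: "FOb I {a} \<in> Ob E" "FOb I {a, b} \<in> Ob E" using functor_ob[OF I] sm by auto
  have cm: "?c c \<in> Hom E (FOb I {a}) (FOb I {a, b})" if "c \<in> {a, b}" for c
    using functor_mor[OF I, of "{a}" "{a, b}" "\<lambda>x\<in>{a}. c"] that sm by auto
  have \<xi>1: "\<xi> 1 \<in> Hom E W (FOb I {a, b})" using cmp_in[OF W IO u cm] by (simp add: \<xi>_def)
  have Iid: "FMor I S S (\<lambda>x\<in>S. x) = Ident E (FOb I S)" if "small TYPE('v) S" for S
    using functor_ident[OF I, of S] that by simp
  have "is_cone J E (comp_fctr I D) W \<xi>"
    unfolding is_cone_def JOb
  proof (intro conjI W ballI)
    show "\<xi> j \<in> Hom E W (FOb (comp_fctr I D) j)" if "j \<in> {0, 1}" for j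
      using that u \<xi>1 by (auto simp: D_def X_def \<xi>_def)
    fix i j f assume "i \<in> {0, 1}" "j \<in> {0, 1}" "f \<in> Hom J i j"
    then consider "i = 0" "j = 0" | "i = 1" "j = 1" | "i = 0" "j = 1" "f = 0" | "i = 0" "j = 1" "f = 1"
      by (auto simp: J_def arrows_category_def split: if_splits)
    then show "Cmp E W (FOb (comp_fctr I D) i) (FOb (comp_fctr I D) j) (FMor (comp_fctr I D) i j f) (\<xi> i) = \<xi> j"
      using u \<xi>1 eq ident_left[OF W IO(1) u] ident_left[OF W IO(2) \<xi>1] Iid[OF sm(2)] Iid[OF sm(3)]
      by cases (simp_all add: D_def X_def \<xi>_def)
  qed
  then show ?thesis using L unfolding is_limit_def by blast
qed

text \<open>Let \<open>V'\<close> be the complement of the subterminal object \<open>R {}\<close> in \<open>1\<close>. Gluing the two injections of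
  \<open>1\<close> into \<open>1 + 1\<close> along \<open>R {}\<close> and \<open>V'\<close> gives an arrow \<open>1 \<rightarrow> 1 + 1\<close>, which is one of the injections by
  connectedness. So the two injections agree on \<open>V'\<close> or on \<open>R {}\<close>, and that part is initial. As \<open>R {}\<close>
  has no points, \<open>V'\<close> contains the point of \<open>1\<close>, so it is \<open>R {}\<close> that is initial; and an object without
  points has an arrow to \<open>R {}\<close>.\<close>

lemma connected_no_points_initial:
  assumes conn: "connected_topos TYPE('v) E" and glue: "glues_disjoint_covers E"
    and V: "V \<in> Ob E" and noV: "pts V = {}"
  shows "initial_object E V"
proof -
  obtain \<gamma> where \<gamma>: "geometric_morphism E (Ens :: ('v set, 'v \<Rightarrow> 'v) cat) \<gamma>"
    and full: "full_functor (Ens :: ('v set, 'v \<Rightarrow> 'v) cat) E (inverse_image \<gamma>)"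
    using conn unfolding connected_topos_def by blast
  define I where "I = inverse_image \<gamma>"
  have I: "is_functor Ens E I" and D: "is_functor E Ens (direct_image \<gamma>)"
    and adj: "left_adjoint Ens E I (direct_image \<gamma>)" and lim: "preserves_finite_limits Ens E I"
    using \<gamma> unfolding geometric_morphism_def I_def by auto
  obtain \<Phi> where \<Phi>: "adjunction Ens E I (direct_image \<gamma>) \<Phi>"
    using adj left_adjoint_iff_adjunction[OF category_Ens E I D] by blast
  have sm0: "small TYPE('v) ({} :: 'v set)" by (rule small_finite[OF univ]) simp
  have Z: "FOb I {} \<in> Ob E" using functor_ob[OF I] sm0 by simp
  have Zini: "initial_object E (FOb I {})"
    unfolding initial_object_def
  proof (intro conjI Z ballI)
    fix X assume X: "X \<in> Ob E"
    have b: "bij_betw (\<Phi> {} X) (Hom E (FOb I {}) X) {\<lambda>_. undefined}"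
      using adjunction_bij[OF \<Phi> _ X, of "{}"] sm0 by simp
    then have "card (Hom E (FOb I {}) X) = 1" using bij_betw_same_card[OF b] by simp
    then show "\<exists>!f. f \<in> Hom E (FOb I {}) X" by (metis card_1_singletonE empty_iff insert_iff)
  qed
  obtain a b :: 'v where ab: "a \<noteq> b" and sm2: "small TYPE('v) {a, b}" by (rule two_values)
  have sm1: "small TYPE('v) {a}" by (rule small_finite[OF univ]) simp
  define T where "T = FOb I {a}"
  define T2 where "T2 = FOb I {a, b}"
  define c where "c x = FMor I {a} {a, b} (\<lambda>_\<in>{a}. x)" for x
  have T: "T \<in> Ob E" and T2: "T2 \<in> Ob E" unfolding T_def T2_def using functor_ob[OF I] sm1 sm2 by auto
  have c: "c x \<in> Hom E T T2" if "x \<in> {a, b}" for x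
    unfolding c_def T_def T2_def using functor_mor[OF I, of "{a}" "{a, b}"] sm1 sm2 that by auto
  have to_T: "\<exists>!u. u \<in> Hom E X T" if "X \<in> Ob E" for X
    unfolding T_def by (rule preserves_terminal[OF I lim that])
  have to_initial: "initial_object E W" if W: "W \<in> Ob E" and u: "u \<in> Hom E W T"
    and eq: "Cmp E W T T2 (c a) u = Cmp E W T T2 (c b) u" for W u
    using preserves_empty_equalizer[OF I lim ab W, of u] u eq initial_source[OF Zini W]
    unfolding T_def T2_def c_def by blast
  note S = R[OF sm0]
  have noS: "pts (R {}) = {}" using ev[OF sm0] by blast
  obtain m where m: "m \<in> Hom E (R {}) T" using to_T[OF S] by blast
  have m_mono: "is_mono E (R {}) T m"
    unfolding is_mono_def
  proof (intro conjI m ballI impI)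
    fix X f g assume X: "X \<in> Ob E" and f: "f \<in> Hom E X (R {})" and g: "g \<in> Hom E X (R {})"
    show "f = g" by (rule maps_into_R_eqI[OF sm0 X f g]) (use app_in[OF X S f] noS in blast)
  qed
  obtain V' n where V': "V' \<in> Ob E" and n: "is_mono E V' T n" and cov: "covers_disjointly E T (R {}) m V' n"
    and cmpl: "\<forall>x\<in>pts T. x \<in> app (R {}) T m ` pts (R {}) \<longleftrightarrow> x \<notin> app V' T n ` pts V'"
    by (rule complement[OF T S m_mono])
  note n' = mono_in[OF n]
  have "pts V' \<noteq> {}" using to_T[OF A] cmpl noS by blast
  then have notV': "\<not> initial_object E V'" using initial_no_points by blast
  obtain h where h: "h \<in> Hom E T T2" "Cmp E (R {}) T T2 h m = Cmp E (R {}) T T2 (c a) m"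
    "Cmp E V' T T2 h n = Cmp E V' T T2 (c b) n"
    using glue[unfolded glues_disjoint_covers_def, rule_format, OF T S V' m n' cov T2 c c] by blast
  obtain k where k: "k \<in> {a} \<rightarrow>\<^sub>E {a, b}" "FMor I {a} {a, b} k = h"
    using fullE[OF full, of "{a}" "{a, b}" h] sm1 sm2 h(1) unfolding T_def T2_def I_def by auto
  have "k = (\<lambda>_\<in>{a}. k a)" using k(1) by (auto simp: PiE_iff extensional_def fun_eq_iff)
  then have hk: "h = c (k a)" unfolding c_def using k(2) by simp
  have "k a \<in> {a, b}" using k(1) by auto
  \<comment> \<open>Otherwise the two injections agree on \<open>V'\<close>, which would make it initial although it has a point.\<close>
  moreover have "k a \<noteq> a"
  proof
    assume "k a = a"
    then show False using to_initial[OF V' n'] h(3) hk notV' by simp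
  qed
  ultimately have "initial_object E (R {})" using to_initial[OF S m] h(2) hk by simp
  moreover have "tr {} V (\<lambda>_. undefined) \<in> Hom E V (R {})" by (rule tr_in[OF sm0 V]) (simp add: noV)
  ultimately show ?thesis by (rule initial_source[OF _ V])
qed

end

section \<open>Sets with a group action\<close>

locale gsets = fixes G :: "('g, 'r) monoid_scheme" assumes G: "group G"
begin

abbreviation BG :: "('v set \<times> ('g \<Rightarrow> 'v \<Rightarrow> 'v), 'v \<Rightarrow> 'v) cat" where "BG \<equiv> classifying_topos G"

lemma BG_ob_iff:
  "(P :: 'v set \<times> ('g \<Rightarrow> 'v \<Rightarrow> 'v)) \<in> Ob BG \<longleftrightarrow>
     small TYPE('v) (fst P) \<and> snd P \<in> extensional (carrier G) \<and>
     (\<forall>g\<in>carrier G. snd P g \<in> fst P \<rightarrow>\<^sub>E fst P) \<and> (\<forall>x\<in>fst P. snd P \<one>\<^bsub>G\<^esub> x = x) \<and>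
     (\<forall>g\<in>carrier G. \<forall>h\<in>carrier G. \<forall>x\<in>fst P. snd P (g \<otimes>\<^bsub>G\<^esub> h) x = snd P g (snd P h x))"
proof -
  obtain X \<alpha> where P: "P = (X, \<alpha>)" by (cases P)
  interpret group G by (rule G)
  have "group_action G X \<alpha> \<longleftrightarrow> (\<forall>g\<in>carrier G. \<alpha> g \<in> X \<rightarrow>\<^sub>E X) \<and> (\<forall>x\<in>X. \<alpha> \<one>\<^bsub>G\<^esub> x = x) \<and>
     (\<forall>g\<in>carrier G. \<forall>h\<in>carrier G. \<forall>x\<in>X. \<alpha> (g \<otimes>\<^bsub>G\<^esub> h) x = \<alpha> g (\<alpha> h x))" (is "_ \<longleftrightarrow> ?R")
  proof
    assume "group_action G X \<alpha>"
    then interpret group_action G X \<alpha> .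
    have "\<alpha> g \<in> X \<rightarrow>\<^sub>E X" if "g \<in> carrier G" for g
      using bij_prop0[OF that] by (auto simp: Bij_def bij_betw_def PiE_iff)
    moreover have "\<alpha> \<one>\<^bsub>G\<^esub> x = x" if "x \<in> X" for x using id_eq_one that by (metis restrict_apply')
    ultimately show ?R using composition_rule by blast
  next
    assume R: ?R
    have bij: "\<alpha> g \<in> Bij X" if g: "g \<in> carrier G" for g
    proof -
      have "bij_betw (\<alpha> g) X X"
        by (rule bij_betw_byWitness[where f' = "\<alpha> (inv\<^bsub>G\<^esub> g)"])
          (use R g in \<open>auto simp: PiE_iff simp flip: R[THEN conjunct2, THEN conjunct2, rule_format]\<close>)
      then show ?thesis using R g by (auto simp: Bij_def PiE_iff)
    qed
    have "\<alpha> \<in> hom G (BijGroup X)"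
    proof (rule homI)
      fix g h assume gh: "g \<in> carrier G" "h \<in> carrier G"
      have "\<alpha> (g \<otimes>\<^bsub>G\<^esub> h) = compose X (\<alpha> g) (\<alpha> h)"
        by (rule extensionalityI[of _ X]) (use bij[OF m_closed[OF gh]] R gh in \<open>auto simp: Bij_def compose_def\<close>)
      then show "\<alpha> (g \<otimes>\<^bsub>G\<^esub> h) = \<alpha> g \<otimes>\<^bsub>BijGroup X\<^esub> \<alpha> h"
        by (simp add: BijGroup_def bij gh)
    qed (simp add: BijGroup_def bij)
    then show "group_action G X \<alpha>"
      by (intro group_action.intro group_hom.intro group_BijGroup G group_hom_axioms.intro)
  qed
  then show ?thesis unfolding P classifying_topos_def by auto
qed

lemma BG_rules:
  assumes "(P :: 'v set \<times> ('g \<Rightarrow> 'v \<Rightarrow> 'v)) \<in> Ob BG"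
  shows BG_small: "small TYPE('v) (fst P)"
    and action_in: "\<And>g x. g \<in> carrier G \<Longrightarrow> x \<in> fst P \<Longrightarrow> snd P g x \<in> fst P"
    and action_one: "\<And>x. x \<in> fst P \<Longrightarrow> snd P \<one>\<^bsub>G\<^esub> x = x"
    and action_mult: "\<And>g h x. g \<in> carrier G \<Longrightarrow> h \<in> carrier G \<Longrightarrow> x \<in> fst P \<Longrightarrow>
      snd P (g \<otimes>\<^bsub>G\<^esub> h) x = snd P g (snd P h x)"
  using assms unfolding BG_ob_iff by auto

lemma BG_obI:
  assumes "small TYPE('v) (X :: 'v set)" "\<And>g x. g \<in> carrier G \<Longrightarrow> x \<in> X \<Longrightarrow> \<alpha> g x \<in> X"
    "\<And>x. x \<in> X \<Longrightarrow> \<alpha> \<one>\<^bsub>G\<^esub> x = x"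
    "\<And>g h x. g \<in> carrier G \<Longrightarrow> h \<in> carrier G \<Longrightarrow> x \<in> X \<Longrightarrow> \<alpha> (g \<otimes>\<^bsub>G\<^esub> h) x = \<alpha> g (\<alpha> h x)"
  shows "(X, \<lambda>g\<in>carrier G. \<lambda>x\<in>X. \<alpha> g x) \<in> Ob BG"
  using assms monoid.m_closed[OF group.is_monoid[OF G]] monoid.one_closed[OF group.is_monoid[OF G]]
  unfolding BG_ob_iff by auto

lemma action_inv:
  assumes P: "(P :: 'v set \<times> ('g \<Rightarrow> 'v \<Rightarrow> 'v)) \<in> Ob BG" and g: "g \<in> carrier G" and x: "x \<in> fst P"
  shows "snd P (inv\<^bsub>G\<^esub> g) (snd P g x) = x" "snd P g (snd P (inv\<^bsub>G\<^esub> g) x) = x"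
  using action_mult[OF P _ _ x, of "inv\<^bsub>G\<^esub> g" g] action_mult[OF P _ _ x, of g "inv\<^bsub>G\<^esub> g"] action_one[OF P x] g
    group.inv_closed[OF G g] group.l_inv[OF G g] group.r_inv[OF G g] by simp_all

lemma BG_hom:
  "f \<in> Hom BG P Q \<longleftrightarrow> f \<in> fst P \<rightarrow>\<^sub>E fst Q \<and> (\<forall>g\<in>carrier G. \<forall>x\<in>fst P. f (snd P g x) = snd Q g (f x))"
  by (auto simp: classifying_topos_def case_prod_beta)

lemma BG_hom_rules:
  assumes "f \<in> Hom BG P Q"
  shows BG_hom_fun: "f \<in> fst P \<rightarrow>\<^sub>E fst Q"
    and BG_hom_in: "\<And>x. x \<in> fst P \<Longrightarrow> f x \<in> fst Q"
    and equivariant: "\<And>g x. g \<in> carrier G \<Longrightarrow> x \<in> fst P \<Longrightarrow> f (snd P g x) = snd Q g (f x)"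
  using assms unfolding BG_hom by auto

lemma BG_cmp [simp]: "Cmp BG P Q T g f = compose (fst P) g f"
  by (simp add: classifying_topos_def case_prod_beta)

lemma BG_ident [simp]: "Ident BG P = (\<lambda>x\<in>fst P. x)"
  by (simp add: classifying_topos_def case_prod_beta)

lemma BG_hom_eqI:
  "f \<in> Hom BG P Q \<Longrightarrow> g \<in> Hom BG P Q \<Longrightarrow> (\<And>x. x \<in> fst P \<Longrightarrow> f x = g x) \<Longrightarrow> f = g"
  unfolding BG_hom by (meson PiE_ext)

lemma category_BG: "category (BG :: ('v set \<times> ('g \<Rightarrow> 'v \<Rightarrow> 'v), 'v \<Rightarrow> 'v) cat)"
  unfolding category_def
proof (intro conjI ballI)
  fix P :: "'v set \<times> ('g \<Rightarrow> 'v \<Rightarrow> 'v)" assume P: "P \<in> Ob BG"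
  show "Ident BG P \<in> Hom BG P P" unfolding BG_hom using action_in[OF P] by auto
next
  fix P Q T :: "'v set \<times> ('g \<Rightarrow> 'v \<Rightarrow> 'v)" and f g
  assume P: "P \<in> Ob BG" and f: "f \<in> Hom BG P Q" and g: "g \<in> Hom BG Q T"
  show "Cmp BG P Q T g f \<in> Hom BG P T"
    unfolding BG_hom using action_in[OF P] BG_hom_rules[OF f] BG_hom_rules[OF g] by (auto simp: compose_def)
next
  fix P Q :: "'v set \<times> ('g \<Rightarrow> 'v \<Rightarrow> 'v)" and f assume f: "f \<in> Hom BG P Q"
  show "Cmp BG P P Q f (Ident BG P) = f" "Cmp BG P Q Q (Ident BG Q) f = f"
    using BG_hom_fun[OF f] by (auto simp: compose_def PiE_iff extensional_def fun_eq_iff)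
next
  fix P Q T W :: "'v set \<times> ('g \<Rightarrow> 'v \<Rightarrow> 'v)" and f g h assume f: "f \<in> Hom BG P Q"
  show "Cmp BG P T W h (Cmp BG P Q T g f) = Cmp BG P Q W (Cmp BG Q T W h g) f"
    using BG_hom_in[OF f] by (auto simp: compose_def fun_eq_iff)
qed

lemma BG_isoI:
  assumes P: "(P :: 'v set \<times> ('g \<Rightarrow> 'v \<Rightarrow> 'v)) \<in> Ob BG" and Q: "Q \<in> Ob BG" and f: "f \<in> Hom BG P Q" and bij: "bij_betw f (fst P) (fst Q)"
  shows "is_iso BG P Q f"
proof -
  define k where "k = (\<lambda>y\<in>fst Q. inv_into (fst P) f y)"
  have k: "k y \<in> fst P" "f (k y) = y" if "y \<in> fst Q" for y
    using that bij_betw_imp_surj_on[OF bij] unfolding k_def by (auto intro: inv_into_into f_inv_into_f)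
  have kf: "k (f x) = x" if "x \<in> fst P" for x
    using that BG_hom_in[OF f that] bij_betw_imp_inj_on[OF bij] unfolding k_def by simp
  have "k (snd Q g y) = snd P g (k y)" if g: "g \<in> carrier G" and y: "y \<in> fst Q" for g y
    using kf[OF action_in[OF P g k(1)[OF y]]] equivariant[OF f g k(1)[OF y]] k(2)[OF y] by simp
  then have "k \<in> Hom BG Q P" unfolding BG_hom using k by (auto simp: k_def)
  then show ?thesis
    by (intro is_isoI[OF f]) (use k kf in \<open>auto simp: compose_def fun_eq_iff\<close>)
qed

end

section \<open>The equivalence with sets with a group action\<close>

context conservative_point
begin

text \<open>The set underlying the image of \<open>X\<close> is \<open>P X\<close>, a copy of \<open>pts X\<close> inside the universe. Composition of
  points with automorphisms is a right action of \<open>Aut(A)\<close>, that is a left action of \<open>Aut(A)\<close> with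
  opposite multiplication. The group is taken up to isomorphism to cover both \<open>Aut_op E A\<close> itself and
  a copy of it inside the universe.\<close>

lemma equivalent_to_gsets:
  fixes G :: "('g, 'r) monoid_scheme"
  assumes P: "is_functor E Ens P" and rep: "represented_by E A (P :: ('o, 'm, 'v set, 'v \<Rightarrow> 'v) fctr)"
    and G: "group G" and \<iota>: "\<iota> \<in> iso G (Aut_op E A)"
  shows "equivalent_cat E (classifying_topos G :: ('v set \<times> ('g \<Rightarrow> 'v \<Rightarrow> 'v), 'v \<Rightarrow> 'v) cat)"
proof -
  interpret gsets G by (rule gsets.intro[OF G])
  interpret group G by (rule G)
  have \<iota>_bij: "bij_betw \<iota> (carrier G) (pts A)" using \<iota> Aut_op_carrier by (simp add: iso_def)
  have \<iota>_in: "\<iota> g \<in> pts A" if "g \<in> carrier G" for g using \<iota>_bij that by (auto simp: bij_betw_def)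
  have \<iota>_mult: "\<iota> (g \<otimes>\<^bsub>G\<^esub> h) = act A (\<iota> h) (\<iota> g)" if "g \<in> carrier G" "h \<in> carrier G" for g h
    using \<iota> that by (simp add: iso_def hom_def Aut_op_def)
  have \<iota>_one: "\<iota> \<one>\<^bsub>G\<^esub> = idA"
    using hom_one[OF _ G group_Aut_op] \<iota> by (simp add: iso_def Aut_op_def)
  obtain \<phi> where "\<forall>X\<in>Ob E. bij_betw (\<phi> X) (pts X) (FOb P X)"
    and "\<forall>X\<in>Ob E. \<forall>Y\<in>Ob E. \<forall>f\<in>Hom E X Y. \<forall>x\<in>pts X. \<phi> Y (app X Y f x) = FMor P X Y f (\<phi> X x)"
    using rep unfolding represented_by_def by blast
  note \<phi>_bij = this(1)[rule_format] and \<phi>_nat = this(2)[rule_format]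
  have \<phi>_in: "\<phi> X x \<in> FOb P X" if "X \<in> Ob E" "x \<in> pts X" for X x
    using \<phi>_bij[OF that(1)] that(2) by (auto simp: bij_betw_def)
  define \<rho> where "\<rho> X = inv_into (pts X) (\<phi> X)" for X
  have \<rho>: "\<rho> X y \<in> pts X" "\<phi> X (\<rho> X y) = y" if "X \<in> Ob E" "y \<in> FOb P X" for X y
  proof -
    have "y \<in> \<phi> X ` pts X" using that bij_betw_imp_surj_on[OF \<phi>_bij[OF that(1)]] by simp
    then show "\<rho> X y \<in> pts X" "\<phi> X (\<rho> X y) = y"
      unfolding \<rho>_def by (simp_all add: inv_into_into f_inv_into_f)
  qed
  have \<rho>\<phi>: "\<rho> X (\<phi> X x) = x" if "X \<in> Ob E" "x \<in> pts X" for X x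
    unfolding \<rho>_def by (rule inv_into_f_f[OF bij_betw_imp_inj_on[OF \<phi>_bij[OF that(1)]] that(2)])
  define F where "F = \<lparr>FOb = (\<lambda>X. (FOb P X, \<lambda>g\<in>carrier G. \<lambda>y\<in>FOb P X. \<phi> X (act X (\<rho> X y) (\<iota> g)))),
     FMor = FMor P\<rparr>"
  have F_fst: "fst (FOb F X) = FOb P X" for X by (simp add: F_def)
  have F_act: "snd (FOb F X) g (\<phi> X x) = \<phi> X (act X x (\<iota> g))" if "X \<in> Ob E" "x \<in> pts X" "g \<in> carrier G" for X x g
    using that by (simp add: F_def \<phi>_in \<rho>\<phi>)
  have F_ob: "FOb F X \<in> Ob BG" if X: "X \<in> Ob E" for X
  proof -
    have "(FOb P X, \<lambda>g\<in>carrier G. \<lambda>y\<in>FOb P X. \<phi> X (act X (\<rho> X y) (\<iota> g))) \<in> Ob BG"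
      by (rule BG_obI) (use functor_ob[OF P X] X in \<open>simp_all add: \<phi>_in act_in \<rho> \<rho>\<phi> \<iota>_in \<iota>_one act_id
        \<iota>_mult act_act\<close>)
    then show ?thesis by (simp add: F_def)
  qed
  have ptE: "\<exists>x\<in>pts X. y = \<phi> X x" if "X \<in> Ob E" "y \<in> FOb P X" for X y
    using \<rho>[OF that] by metis
  have F_hom: "f \<in> Hom BG (FOb F X) (FOb F Y) \<longleftrightarrow> f \<in> FOb P X \<rightarrow>\<^sub>E FOb P Y \<and>
      (\<forall>g\<in>carrier G. \<forall>x\<in>pts X. f (\<phi> X (act X x (\<iota> g))) = snd (FOb F Y) g (f (\<phi> X x)))"
    if X: "X \<in> Ob E" for X Y f
    unfolding BG_hom F_fst
  proof (intro conj_cong refl ball_cong)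
    fix g assume g: "g \<in> carrier G"
    show "(\<forall>x\<in>FOb P X. f (snd (FOb F X) g x) = snd (FOb F Y) g (f x)) =
        (\<forall>x\<in>pts X. f (\<phi> X (act X x (\<iota> g))) = snd (FOb F Y) g (f (\<phi> X x)))"
    proof
      assume "\<forall>x\<in>FOb P X. f (snd (FOb F X) g x) = snd (FOb F Y) g (f x)"
      then show "\<forall>x\<in>pts X. f (\<phi> X (act X x (\<iota> g))) = snd (FOb F Y) g (f (\<phi> X x))"
        using \<phi>_in[OF X] F_act[OF X _ g] by metis
    next
      assume "\<forall>x\<in>pts X. f (\<phi> X (act X x (\<iota> g))) = snd (FOb F Y) g (f (\<phi> X x))"
      then show "\<forall>x\<in>FOb P X. f (snd (FOb F X) g x) = snd (FOb F Y) g (f x)"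
        using ptE[OF X] F_act[OF X _ g] by metis
    qed
  qed
  have P_fun: "FMor P X Y f \<in> FOb P X \<rightarrow>\<^sub>E FOb P Y" if "X \<in> Ob E" "Y \<in> Ob E" "f \<in> Hom E X Y" for X Y f
    using functor_mor[OF P that] by simp
  have F: "is_functor E BG F"
    unfolding is_functor_def
  proof (intro conjI ballI F_ob)
    fix X Y f assume X: "X \<in> Ob E" and Y: "Y \<in> Ob E" and f: "f \<in> Hom E X Y"
    have "FMor P X Y f (\<phi> X (act X x (\<iota> g))) = snd (FOb F Y) g (FMor P X Y f (\<phi> X x))"
      if g: "g \<in> carrier G" and x: "x \<in> pts X" for g x
      using F_act[OF Y app_in[OF X Y f x] g] app_act[OF X Y f x \<iota>_in[OF g]]
      by (simp flip: \<phi>_nat[OF X Y f x] \<phi>_nat[OF X Y f act_in[OF X x \<iota>_in[OF g]]])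
    then show "FMor F X Y f \<in> Hom BG (FOb F X) (FOb F Y)"
      unfolding F_hom[OF X] using P_fun[OF X Y f] by (simp add: F_def)
  qed (use functor_ident[OF P] functor_cmp[OF P] in \<open>simp_all add: F_def\<close>)
  have full: "full_functor E BG F"
    unfolding full_functor_def
  proof (intro ballI subsetI)
    fix X Y h assume X: "X \<in> Ob E" and Y: "Y \<in> Ob E" and h: "h \<in> Hom BG (FOb F X) (FOb F Y)"
    have h1: "h \<in> FOb P X \<rightarrow>\<^sub>E FOb P Y"
      and h2: "\<And>g x. g \<in> carrier G \<Longrightarrow> x \<in> pts X \<Longrightarrow> h (\<phi> X (act X x (\<iota> g))) = snd (FOb F Y) g (h (\<phi> X x))"
      using h unfolding F_hom[OF X] by auto
    have hx: "h (\<phi> X x) \<in> FOb P Y" if "x \<in> pts X" for x using h1 \<phi>_in[OF X that] by blast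
    define k where "k x = \<rho> Y (h (\<phi> X x))" for x
    have k: "k x \<in> pts Y" "\<phi> Y (k x) = h (\<phi> X x)" if "x \<in> pts X" for x
      unfolding k_def using \<rho>[OF Y hx[OF that]] by auto
    have "k (act X x e) = act Y (k x) e" if x: "x \<in> pts X" and e: "e \<in> pts A" for x e
    proof -
      have "e \<in> \<iota> ` carrier G" using bij_betw_imp_surj_on[OF \<iota>_bij] e by simp
      then obtain g where g: "g \<in> carrier G" "\<iota> g = e" by auto
      have "\<phi> Y (k (act X x e)) = \<phi> Y (act Y (k x) e)"
        using k(2)[OF act_in[OF X x e]] h2[OF g(1) x] F_act[OF Y k(1)[OF x] g(1)] k(2)[OF x] g(2) by simp
      then show ?thesis
        using \<rho>\<phi>[OF Y k(1)[OF act_in[OF X x e]]] \<rho>\<phi>[OF Y act_in[OF Y k(1)[OF x] e]] by metis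
    qed
    note k_act = this
    have "k \<in> pts X \<rightarrow> pts Y" using k(1) by blast
    then obtain f where f: "f \<in> Hom E X Y" "\<forall>x\<in>pts X. app X Y f x = k x"
      by (rule equivariant_map_arrow[OF X Y _ k_act])
    have "FMor P X Y f = h"
    proof (rule PiE_ext[OF P_fun[OF X Y f(1)] h1])
      fix y assume "y \<in> FOb P X"
      then obtain x where x: "x \<in> pts X" "y = \<phi> X x" using ptE[OF X] by blast
      then show "FMor P X Y f y = h y"
        using \<phi>_nat[OF X Y f(1) x(1)] f(2) k(2)[OF x(1)] by simp
    qed
    then show "h \<in> FMor F X Y ` Hom E X Y" using f(1) by (auto simp: F_def)
  qed
  have faithful: "faithful_functor E F"
    unfolding faithful_functor_def
  proof (intro ballI inj_onI)
    fix X Y f f' assume X: "X \<in> Ob E" and Y: "Y \<in> Ob E" and f: "f \<in> Hom E X Y" and f': "f' \<in> Hom E X Y"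
      and eq: "FMor F X Y f = FMor F X Y f'"
    show "f = f'"
    proof (rule arrows_eqI[OF X Y f f'])
      fix x assume x: "x \<in> pts X"
      have "\<phi> Y (app X Y f x) = \<phi> Y (app X Y f' x)"
        using \<phi>_nat[OF X Y f x] \<phi>_nat[OF X Y f' x] eq by (simp add: F_def)
      then show "app X Y f x = app X Y f' x"
        using \<rho>\<phi>[OF Y app_in[OF X Y f x]] \<rho>\<phi>[OF Y app_in[OF X Y f' x]] by metis
    qed
  qed
  have "\<exists>X\<in>Ob E. \<exists>i. is_iso BG (FOb F X) Q i" if Q: "Q \<in> Ob BG" for Q :: "'v set \<times> ('g \<Rightarrow> 'v \<Rightarrow> 'v)"
  proof -
    define \<kappa> where "\<kappa> = inv_into (carrier G) \<iota>"
    have \<kappa>: "\<kappa> e \<in> carrier G" "\<iota> (\<kappa> e) = e" if "e \<in> pts A" for e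
    proof -
      have "e \<in> \<iota> ` carrier G" using that bij_betw_imp_surj_on[OF \<iota>_bij] by simp
      then show "\<kappa> e \<in> carrier G" "\<iota> (\<kappa> e) = e"
        unfolding \<kappa>_def by (simp_all add: inv_into_into f_inv_into_f)
    qed
    have \<kappa>\<iota>: "\<kappa> (\<iota> g) = g" if "g \<in> carrier G" for g
      unfolding \<kappa>_def by (rule inv_into_f_f[OF bij_betw_imp_inj_on[OF \<iota>_bij] that])
    have \<kappa>_act: "\<kappa> (act A e d) = \<kappa> d \<otimes>\<^bsub>G\<^esub> \<kappa> e" if "e \<in> pts A" "d \<in> pts A" for e d
      using \<kappa>\<iota>[OF m_closed[OF \<kappa>(1)[OF that(2)] \<kappa>(1)[OF that(1)]]] \<iota>_mult[OF \<kappa>(1)[OF that(2)] \<kappa>(1)[OF that(1)]]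
        \<kappa>(2) that by simp
    have \<kappa>_id: "\<kappa> idA = \<one>\<^bsub>G\<^esub>" using \<kappa>\<iota>[OF one_closed] \<iota>_one by simp
    obtain X \<psi> where X: "X \<in> Ob E" and \<psi>: "bij_betw \<psi> (pts X) (fst Q)"
      and \<psi>_act: "\<forall>x\<in>pts X. \<forall>e\<in>pts A. \<psi> (act X x e) = snd Q (\<kappa> e) (\<psi> x)"
      by (rule object_of_action[OF BG_small[OF Q], of "\<lambda>s e. snd Q (\<kappa> e) s"])
        (simp_all add: action_in[OF Q] \<kappa> \<kappa>_id action_one[OF Q] \<kappa>_act action_mult[OF Q])
    define i where "i = (\<lambda>y\<in>FOb P X. \<psi> (\<rho> X y))"
    have i\<phi>: "i (\<phi> X x) = \<psi> x" if "x \<in> pts X" for x using that X by (simp add: i_def \<phi>_in \<rho>\<phi>)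
    have bij: "bij_betw i (FOb P X) (fst Q)"
    proof -
      have "bij_betw (\<rho> X) (FOb P X) (pts X)" unfolding \<rho>_def by (rule bij_betw_inv_into[OF \<phi>_bij[OF X]])
      from bij_betw_trans[OF this \<psi>] show ?thesis
        by (rule bij_betw_cong[THEN iffD1, rotated]) (simp add: i_def)
    qed
    have "i \<in> Hom BG (FOb F X) Q"
      unfolding BG_hom F_fst
    proof (intro conjI ballI)
      show "i \<in> FOb P X \<rightarrow>\<^sub>E fst Q" using bij_betw_imp_funcset[OF bij] by (simp add: PiE_iff Pi_iff) (simp add: i_def)
      fix g y assume g: "g \<in> carrier G" and "y \<in> FOb P X"
      then obtain x where x: "x \<in> pts X" "y = \<phi> X x" using ptE[OF X] by blast
      show "i (snd (FOb F X) g y) = snd Q g (i y)"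
        using F_act[OF X x(1) g] i\<phi>[OF x(1)] i\<phi>[OF act_in[OF X x(1) \<iota>_in[OF g]]] \<psi>_act x \<iota>_in[OF g] \<kappa>\<iota>[OF g]
        by simp
    qed
    from BG_isoI[OF F_ob[OF X] Q this] bij have "is_iso BG (FOb F X) Q i" by (simp add: F_fst)
    then show ?thesis using X by blast
  qed
  then have "equivalence_functor E BG F"
    unfolding equivalence_functor_def using E category_BG F full faithful by blast
  then show ?thesis by (rule equivalence_functor_imp_equivalent_cat)
qed

end

lemma group_transport:
  fixes j :: "'a \<Rightarrow> 'b"
  assumes H: "group H" and j: "inj_on j (carrier H)"
  obtains G :: "'b monoid" and \<iota> where "group G" "carrier G = j ` carrier H" "\<iota> \<in> iso G H"
proof -
  interpret H: group H by (rule H)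
  define k where "k = inv_into (carrier H) j"
  have kj: "k (j x) = x" if "x \<in> carrier H" for x unfolding k_def by (rule inv_into_f_f[OF j that])
  define G where "G = \<lparr>carrier = j ` carrier H, mult = (\<lambda>x y. j (k x \<otimes>\<^bsub>H\<^esub> k y)), one = j \<one>\<^bsub>H\<^esub>\<rparr>"
  have "group G"
  proof (rule groupI)
    fix x assume "x \<in> carrier G"
    then obtain y where y: "y \<in> carrier H" "x = j y" by (auto simp: G_def)
    then have "j (inv\<^bsub>H\<^esub> y) \<in> carrier G" "j (inv\<^bsub>H\<^esub> y) \<otimes>\<^bsub>G\<^esub> x = \<one>\<^bsub>G\<^esub>" by (auto simp: G_def kj)
    then show "\<exists>z\<in>carrier G. z \<otimes>\<^bsub>G\<^esub> x = \<one>\<^bsub>G\<^esub>" by blast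
  qed (auto simp: G_def kj H.m_assoc)
  moreover have "k \<in> iso G H"
    unfolding iso_def hom_def bij_betw_def inj_on_def by (auto simp: G_def kj image_image)
  moreover have "carrier G = j ` carrier H" by (simp add: G_def)
  ultimately show thesis by (intro that)
qed

section \<open>The classifying topos of a group is connected atomic\<close>

context gsets
begin

definition trivial_action :: "('v set, 'v \<Rightarrow> 'v, 'v set \<times> ('g \<Rightarrow> 'v \<Rightarrow> 'v), 'v \<Rightarrow> 'v) fctr" where
  "trivial_action = \<lparr>FOb = (\<lambda>S. (S, \<lambda>g\<in>carrier G. \<lambda>x\<in>S. x)), FMor = (\<lambda>S T f. f)\<rparr>"

definition fixed_points :: "('v set \<times> ('g \<Rightarrow> 'v \<Rightarrow> 'v), 'v \<Rightarrow> 'v, 'v set, 'v \<Rightarrow> 'v) fctr" where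
  "fixed_points = \<lparr>FOb = (\<lambda>P. {x \<in> fst P. \<forall>g\<in>carrier G. snd P g x = x}),
     FMor = (\<lambda>P Q f. \<lambda>x\<in>{x \<in> fst P. \<forall>g\<in>carrier G. snd P g x = x}. f x)\<rparr>"

definition orbit_of :: "'v set \<times> ('g \<Rightarrow> 'v \<Rightarrow> 'v) \<Rightarrow> 'v \<Rightarrow> 'v set" where
  "orbit_of P x = (\<lambda>g. snd P g x) ` carrier G"

text \<open>Orbits are represented by chosen elements, so that the set of orbits is a subset of the given
  set and hence of the universe.\<close>

definition orbit_rep :: "'v set \<times> ('g \<Rightarrow> 'v \<Rightarrow> 'v) \<Rightarrow> 'v \<Rightarrow> 'v" where
  "orbit_rep P x = (SOME y. y \<in> orbit_of P x)"

definition orbit_reps :: "('v set \<times> ('g \<Rightarrow> 'v \<Rightarrow> 'v), 'v \<Rightarrow> 'v, 'v set, 'v \<Rightarrow> 'v) fctr" where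
  "orbit_reps = \<lparr>FOb = (\<lambda>P. orbit_rep P ` fst P),
     FMor = (\<lambda>P Q f. \<lambda>x\<in>orbit_rep P ` fst P. orbit_rep Q (f x))\<rparr>"

lemma one_in: "\<one>\<^bsub>G\<^esub> \<in> carrier G" by (rule monoid.one_closed[OF group.is_monoid[OF G]])

lemma mult_in: "g \<in> carrier G \<Longrightarrow> h \<in> carrier G \<Longrightarrow> g \<otimes>\<^bsub>G\<^esub> h \<in> carrier G"
  by (rule monoid.m_closed[OF group.is_monoid[OF G]])

lemma trivial_action_fst: "fst (FOb trivial_action S) = S"
  and trivial_action_snd: "g \<in> carrier G \<Longrightarrow> x \<in> S \<Longrightarrow> snd (FOb trivial_action S) g x = x"
  and trivial_action_mor: "FMor trivial_action S T f = f"
  by (simp_all add: trivial_action_def)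

lemma trivial_action_hom: "Hom BG (FOb trivial_action S) (FOb trivial_action T) = S \<rightarrow>\<^sub>E T"
proof -
  have "h \<in> Hom BG (FOb trivial_action S) (FOb trivial_action T) \<longleftrightarrow> h \<in> S \<rightarrow>\<^sub>E T" for h
    by (simp add: BG_hom trivial_action_fst trivial_action_snd PiE_iff) (metis trivial_action_snd)
  then show ?thesis by blast
qed

lemma trivial_action: "is_functor Ens BG (trivial_action :: ('v set, 'v \<Rightarrow> 'v, _, _) fctr)"
  unfolding is_functor_def
proof (intro conjI ballI)
  fix S :: "'v set" assume "S \<in> Ob Ens"
  then show "FOb trivial_action S \<in> Ob BG"
    unfolding trivial_action_def fctr.simps by (intro BG_obI) simp_all
qed (simp_all add: trivial_action_hom trivial_action_mor trivial_action_fst)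

lemma fixed_points_ob: "FOb fixed_points P = {x \<in> fst P. \<forall>g\<in>carrier G. snd P g x = x}"
  by (simp add: fixed_points_def)

lemma fixed_points_mor: "x \<in> FOb fixed_points P \<Longrightarrow> FMor fixed_points P Q f x = f x"
  by (simp add: fixed_points_def)

lemma fixed_points_mor_in:
  assumes f: "f \<in> Hom BG P Q"
  shows "FMor fixed_points P Q f \<in> FOb fixed_points P \<rightarrow>\<^sub>E FOb fixed_points Q"
  using BG_hom_in[OF f] equivariant[OF f] by (force simp: fixed_points_def)

lemma fixed_points: "is_functor BG Ens (fixed_points :: (_, _, 'v set, 'v \<Rightarrow> 'v) fctr)"
  unfolding is_functor_def
proof (intro conjI ballI)
  fix P :: "'v set \<times> ('g \<Rightarrow> 'v \<Rightarrow> 'v)" assume P: "P \<in> Ob BG"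
  show "FOb fixed_points P \<in> Ob Ens"
    using small_subset[OF BG_small[OF P], of "FOb fixed_points P"] by (auto simp: fixed_points_ob)
  show "FMor fixed_points P P (Ident BG P) = Ident Ens (FOb fixed_points P)"
    by (auto simp: fixed_points_def fun_eq_iff)
next
  fix P Q :: "'v set \<times> ('g \<Rightarrow> 'v \<Rightarrow> 'v)" and f assume "f \<in> Hom BG P Q"
  then show "FMor fixed_points P Q f \<in> Hom Ens (FOb fixed_points P) (FOb fixed_points Q)"
    by (simp add: fixed_points_mor_in)
next
  fix P Q T :: "'v set \<times> ('g \<Rightarrow> 'v \<Rightarrow> 'v)" and f g assume f: "f \<in> Hom BG P Q"
  show "FMor fixed_points P T (Cmp BG P Q T g f) =
     Cmp Ens (FOb fixed_points P) (FOb fixed_points Q) (FOb fixed_points T) (FMor fixed_points Q T g) (FMor fixed_points P Q f)"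
    using BG_hom_in[OF f] equivariant[OF f] by (force simp: fixed_points_def compose_def fun_eq_iff)
qed

lemma trivial_adjoint_fixed_points:
  "left_adjoint Ens BG (trivial_action :: ('v set, 'v \<Rightarrow> 'v, _, _) fctr) fixed_points"
  unfolding left_adjoint_iff_adjunction[OF category_Ens category_BG trivial_action fixed_points] adjunction_def
proof (intro exI[of _ "\<lambda>S P h. h"] conjI ballI)
  fix S and P :: "'v set \<times> ('g \<Rightarrow> 'v \<Rightarrow> 'v)"
  have "h \<in> Hom BG (FOb trivial_action S) P \<longleftrightarrow> h \<in> Hom Ens S (FOb fixed_points P)" for h
    by (simp add: BG_hom trivial_action_fst trivial_action_snd fixed_points_ob PiE_iff) metis
  then have "Hom BG (FOb trivial_action S) P = Hom Ens S (FOb fixed_points P)" by blast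
  then show "bij_betw (\<lambda>h. h) (Hom BG (FOb trivial_action S) P) (Hom Ens S (FOb fixed_points P))"
    by (simp add: bij_betw_def)
next
  fix S and P Q :: "'v set \<times> ('g \<Rightarrow> 'v \<Rightarrow> 'v)" and v h assume h: "h \<in> Hom BG (FOb trivial_action S) P"
  have "h x \<in> FOb fixed_points P" if "x \<in> S" for x
    using h that by (auto simp: BG_hom trivial_action_fst trivial_action_snd fixed_points_ob PiE_iff)
  then show "Cmp BG (FOb trivial_action S) P Q v h =
      Cmp Ens S (FOb fixed_points P) (FOb fixed_points Q) (FMor fixed_points P Q v) h"
    by (auto simp: compose_def trivial_action_fst fixed_points_mor fun_eq_iff)
qed (simp add: trivial_action_fst trivial_action_mor)

lemma orbit_rep:
  assumes P: "(P :: 'v set \<times> ('g \<Rightarrow> 'v \<Rightarrow> 'v)) \<in> Ob BG" and x: "x \<in> fst P"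
  shows orbit_repE: "\<exists>g\<in>carrier G. orbit_rep P x = snd P g x"
    and orbit_rep_in: "orbit_rep P x \<in> fst P"
    and orbit_rep_action: "\<And>g. g \<in> carrier G \<Longrightarrow> orbit_rep P (snd P g x) = orbit_rep P x"
    and orbit_rep_idem: "orbit_rep P (orbit_rep P x) = orbit_rep P x"
proof -
  have "x \<in> orbit_of P x" unfolding orbit_of_def using action_one[OF P x] one_in by force
  then have "orbit_rep P x \<in> orbit_of P x" unfolding orbit_rep_def by (rule someI)
  then show ex: "\<exists>g\<in>carrier G. orbit_rep P x = snd P g x" unfolding orbit_of_def by blast
  then show "orbit_rep P x \<in> fst P" using action_in[OF P _ x] by auto
  show inv: "orbit_rep P (snd P g x) = orbit_rep P x" if g: "g \<in> carrier G" for g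
  proof -
    have "snd P h x = snd P (h \<otimes>\<^bsub>G\<^esub> inv\<^bsub>G\<^esub> g) (snd P g x)" if h: "h \<in> carrier G" for h
      using action_mult[OF P h group.inv_closed[OF G g] action_in[OF P g x]] action_inv[OF P g x] by simp
    moreover have "snd P h (snd P g x) = snd P (h \<otimes>\<^bsub>G\<^esub> g) x" if h: "h \<in> carrier G" for h
      using action_mult[OF P h g x] by simp
    ultimately have "orbit_of P (snd P g x) = orbit_of P x"
      unfolding orbit_of_def using mult_in g group.inv_closed[OF G g] by (auto simp: image_iff) metis+
    then show ?thesis unfolding orbit_rep_def by simp
  qed
  show "orbit_rep P (orbit_rep P x) = orbit_rep P x" using ex inv by auto
qed

lemma orbit_rep_hom:
  assumes P: "(P :: 'v set \<times> ('g \<Rightarrow> 'v \<Rightarrow> 'v)) \<in> Ob BG" and Q: "Q \<in> Ob BG" and f: "f \<in> Hom BG P Q" and x: "x \<in> fst P"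
  shows "orbit_rep Q (f (orbit_rep P x)) = orbit_rep Q (f x)"
  using orbit_repE[OF P x] equivariant[OF f _ x] orbit_rep_action[OF Q BG_hom_in[OF f x]] by auto

lemma orbit_reps_ob: "FOb orbit_reps P = orbit_rep P ` fst P"
  by (simp add: orbit_reps_def)

lemma orbit_reps_mor:
  "x \<in> fst P \<Longrightarrow> FMor orbit_reps P Q f (orbit_rep P x) = orbit_rep Q (f (orbit_rep P x))"
  by (simp add: orbit_reps_def)

lemma orbit_reps_mor_in:
  assumes P: "(P :: 'v set \<times> ('g \<Rightarrow> 'v \<Rightarrow> 'v)) \<in> Ob BG" and f: "f \<in> Hom BG P Q"
  shows "FMor orbit_reps P Q f \<in> FOb orbit_reps P \<rightarrow>\<^sub>E FOb orbit_reps Q"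
  using BG_hom_in[OF f orbit_rep_in[OF P]] by (auto simp: orbit_reps_def)

lemma orbit_reps: "is_functor BG Ens (orbit_reps :: (_, _, 'v set, 'v \<Rightarrow> 'v) fctr)"
  unfolding is_functor_def
proof (intro conjI ballI)
  fix P :: "'v set \<times> ('g \<Rightarrow> 'v \<Rightarrow> 'v)" assume P: "P \<in> Ob BG"
  show "FOb orbit_reps P \<in> Ob Ens"
    using small_image[OF BG_small[OF P]] by (simp add: orbit_reps_ob)
  show "FMor orbit_reps P P (Ident BG P) = Ident Ens (FOb orbit_reps P)"
    using orbit_rep_idem[OF P] orbit_rep_in[OF P] by (auto simp: orbit_reps_def fun_eq_iff)
next
  fix P Q :: "'v set \<times> ('g \<Rightarrow> 'v \<Rightarrow> 'v)" and f assume "P \<in> Ob BG" "f \<in> Hom BG P Q"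
  then show "FMor orbit_reps P Q f \<in> Hom Ens (FOb orbit_reps P) (FOb orbit_reps Q)"
    by (simp add: orbit_reps_mor_in)
next
  fix P Q T :: "'v set \<times> ('g \<Rightarrow> 'v \<Rightarrow> 'v)" and f g
  assume P: "P \<in> Ob BG" and Q: "Q \<in> Ob BG" and T: "T \<in> Ob BG" and f: "f \<in> Hom BG P Q" and g: "g \<in> Hom BG Q T"
  show "FMor orbit_reps P T (Cmp BG P Q T g f) =
     Cmp Ens (FOb orbit_reps P) (FOb orbit_reps Q) (FOb orbit_reps T) (FMor orbit_reps Q T g) (FMor orbit_reps P Q f)"
  proof
    fix y
    show "FMor orbit_reps P T (Cmp BG P Q T g f) y =
     Cmp Ens (FOb orbit_reps P) (FOb orbit_reps Q) (FOb orbit_reps T) (FMor orbit_reps Q T g) (FMor orbit_reps P Q f) y"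
    proof (cases "y \<in> orbit_rep P ` fst P")
      case True
      then obtain x where x: "x \<in> fst P" "y = orbit_rep P x" by blast
      note y = orbit_rep_in[OF P x(1), folded x(2)]
      note fy = BG_hom_in[OF f y]
      show ?thesis
        using True y fy orbit_rep_hom[OF Q T g fy] by (simp add: orbit_reps_def compose_def)
    qed (simp add: orbit_reps_def compose_def)
  qed
qed

lemma orbits_adjoint_trivial:
  "left_adjoint BG Ens orbit_reps (trivial_action :: ('v set, 'v \<Rightarrow> 'v, _, _) fctr)"
  unfolding left_adjoint_iff_adjunction[OF category_BG category_Ens orbit_reps trivial_action] adjunction_def
proof (intro exI[of _ "\<lambda>P S h. \<lambda>x\<in>fst P. h (orbit_rep P x)"] conjI ballI)
  fix P :: "'v set \<times> ('g \<Rightarrow> 'v \<Rightarrow> 'v)" and S assume P: "P \<in> Ob BG"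
  have hom: "k \<in> Hom BG P (FOb trivial_action S) \<longleftrightarrow> k \<in> fst P \<rightarrow>\<^sub>E S \<and> (\<forall>g\<in>carrier G. \<forall>x\<in>fst P. k (snd P g x) = k x)" for k
    by (auto simp: BG_hom trivial_action_fst trivial_action_snd PiE_iff)
  have krep: "k (orbit_rep P x) = k x" if "k \<in> Hom BG P (FOb trivial_action S)" "x \<in> fst P" for k x
    using that orbit_repE[OF P that(2)] unfolding hom by auto
  show "bij_betw (\<lambda>h. \<lambda>x\<in>fst P. h (orbit_rep P x)) (Hom Ens (FOb orbit_reps P) S)
      (Hom BG P (FOb trivial_action S))"
  proof (rule bij_betw_byWitness[where f' = "\<lambda>k. restrict k (orbit_rep P ` fst P)"])
    show "\<forall>h\<in>Hom Ens (FOb orbit_reps P) S. restrict (\<lambda>x\<in>fst P. h (orbit_rep P x)) (orbit_rep P ` fst P) = h"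
    proof
      fix h assume "h \<in> Hom Ens (FOb orbit_reps P) S"
      then have "h \<in> extensional (orbit_rep P ` fst P)" by (auto simp: orbit_reps_ob PiE_iff)
      then show "restrict (\<lambda>x\<in>fst P. h (orbit_rep P x)) (orbit_rep P ` fst P) = h"
        by (rule extensionalityI[OF restrict_extensional])
          (use orbit_rep_in[OF P] orbit_rep_idem[OF P] in auto)
    qed
    show "\<forall>k\<in>Hom BG P (FOb trivial_action S). (\<lambda>x\<in>fst P. restrict k (orbit_rep P ` fst P) (orbit_rep P x)) = k"
    proof
      fix k assume k: "k \<in> Hom BG P (FOb trivial_action S)"
      then have "k \<in> extensional (fst P)" unfolding hom by (auto simp: PiE_iff)
      then show "(\<lambda>x\<in>fst P. restrict k (orbit_rep P ` fst P) (orbit_rep P x)) = k"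
        using krep[OF k] by (auto simp: extensional_def fun_eq_iff)
    qed
    show "(\<lambda>h. \<lambda>x\<in>fst P. h (orbit_rep P x)) ` Hom Ens (FOb orbit_reps P) S \<subseteq> Hom BG P (FOb trivial_action S)"
      using action_in[OF P] orbit_rep_action[OF P] by (auto simp: hom orbit_reps_ob PiE_iff)
    show "(\<lambda>k. restrict k (orbit_rep P ` fst P)) ` Hom BG P (FOb trivial_action S) \<subseteq> Hom Ens (FOb orbit_reps P) S"
      using orbit_rep_in[OF P] by (auto simp: hom orbit_reps_ob PiE_iff)
  qed
next
  fix P :: "'v set \<times> ('g \<Rightarrow> 'v \<Rightarrow> 'v)" and S S' v h
  show "(\<lambda>x\<in>fst P. Cmp Ens (FOb orbit_reps P) S S' v h (orbit_rep P x)) =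
     Cmp BG P (FOb trivial_action S) (FOb trivial_action S') (FMor trivial_action S S' v) (\<lambda>x\<in>fst P. h (orbit_rep P x))"
    by (auto simp: compose_def orbit_reps_ob trivial_action_mor fun_eq_iff)
next
  fix P P' :: "'v set \<times> ('g \<Rightarrow> 'v \<Rightarrow> 'v)" and S u h
  assume P: "P \<in> Ob BG" and P': "P' \<in> Ob BG" and u: "u \<in> Hom BG P' P"
  show "(\<lambda>x\<in>fst P'. Cmp Ens (FOb orbit_reps P') (FOb orbit_reps P) S h (FMor orbit_reps P' P u) (orbit_rep P' x)) =
     Cmp BG P' P (FOb trivial_action S) (\<lambda>x\<in>fst P. h (orbit_rep P x)) u"
    using BG_hom_in[OF u] orbit_rep_hom[OF P' P u]
    by (auto simp: compose_def orbit_reps_ob orbit_reps_mor fun_eq_iff)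
qed

end

text \<open>The group acts on itself, and since it is a small subset of the universe, this action is an object of
  its classifying topos. It represents the forgetful functor.\<close>

locale small_group = gsets G for G :: "'v monoid" +
  assumes small_carrier: "small TYPE('v) (carrier G)"
begin

abbreviation BGv :: "('v set \<times> ('v \<Rightarrow> 'v \<Rightarrow> 'v), 'v \<Rightarrow> 'v) cat" where "BGv \<equiv> classifying_topos G"

text \<open>Elements of \<open>P\<close> correspond to arrows to \<open>P\<close> from the group acting on itself.\<close>

lemma BG_mono_inj:
  assumes P: "P \<in> Ob BGv" and Q: "Q \<in> Ob BGv" and m: "is_mono BGv P Q m"
  shows "inj_on m (fst P)"
proof (rule inj_onI)
  interpret group G by (rule G)
  have mh: "m \<in> Hom BGv P Q" using m unfolding is_mono_def by blast
  define L where "L = (carrier G, \<lambda>g\<in>carrier G. \<lambda>x\<in>carrier G. g \<otimes>\<^bsub>G\<^esub> x)"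
  have L: "L \<in> Ob BGv" unfolding L_def by (rule BG_obI[OF small_carrier]) (simp_all add: m_assoc)
  \<comment> \<open>\<open>orb x\<close> is the equivariant map from the group that sends the unit to \<open>x\<close>.\<close>
  define orb where "orb x = (\<lambda>g\<in>carrier G. snd P g x)" for x
  have orb: "orb x \<in> Hom BGv L P" if "x \<in> fst P" for x
    unfolding BG_hom using that action_in[OF P] action_mult[OF P] by (auto simp: L_def orb_def)
  fix x y assume x: "x \<in> fst P" and y: "y \<in> fst P" and xy: "m x = m y"
  have "Cmp BGv L P Q m (orb x) = Cmp BGv L P Q m (orb y)"
    using equivariant[OF mh _ x] equivariant[OF mh _ y] xy by (auto simp: L_def orb_def compose_def fun_eq_iff)
  then have "orb x = orb y" using m L orb[OF x] orb[OF y] unfolding is_mono_def by blast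
  then have "orb x \<one>\<^bsub>G\<^esub> = orb y \<one>\<^bsub>G\<^esub>" by simp
  then show "x = y" using action_one[OF P x] action_one[OF P y] by (simp add: orb_def)
qed

lemma BG_boolean: "boolean_topos BGv"
  unfolding boolean_topos_def
proof (intro ballI allI impI)
  fix X U m assume X: "X \<in> Ob BGv" and U: "U \<in> Ob BGv" and m: "is_mono BGv U X m"
  have mh: "m \<in> Hom BGv U X" using m unfolding is_mono_def by blast
  define C where "C = fst X - m ` fst U"
  have actC: "snd X g x \<in> C" if g: "g \<in> carrier G" and x: "x \<in> C" for g x
  proof -
    have x': "x \<in> fst X" "x \<notin> m ` fst U" using x by (auto simp: C_def)
    have "snd X g x \<notin> m ` fst U"
    proof
      assume "snd X g x \<in> m ` fst U"
      then obtain u where u: "u \<in> fst U" "snd X g x = m u" by blast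
      note gi = group.inv_closed[OF G g]
      have "x = m (snd U (inv\<^bsub>G\<^esub> g) u)"
        using action_inv(1)[OF X g x'(1)] u equivariant[OF mh gi u(1)] by simp
      then show False using x'(2) action_in[OF U gi u(1)] by blast
    qed
    then show ?thesis using action_in[OF X g x'(1)] by (simp add: C_def)
  qed
  define V where "V = (C, \<lambda>g\<in>carrier G. \<lambda>x\<in>C. snd X g x)"
  have CX: "C \<subseteq> fst X" by (auto simp: C_def)
  have V: "V \<in> Ob BGv"
    unfolding V_def
    by (rule BG_obI) (use actC CX in \<open>auto intro: small_subset[OF BG_small[OF X]] simp: action_one[OF X] action_mult[OF X] subset_iff\<close>)
  define n where "n = (\<lambda>x\<in>C. x)"
  have nh: "n \<in> Hom BGv V X" unfolding BG_hom using actC CX by (auto simp: V_def n_def)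
  have n: "is_mono BGv V X n"
    unfolding is_mono_def
  proof (intro conjI nh ballI impI)
    fix Z f g assume f: "f \<in> Hom BGv Z V" and g: "g \<in> Hom BGv Z V" and eq: "Cmp BGv Z V X n f = Cmp BGv Z V X n g"
    show "f = g"
    proof (rule BG_hom_eqI[OF f g])
      fix z assume z: "z \<in> fst Z"
      have "f z \<in> C" "g z \<in> C" using BG_hom_in[OF f z] BG_hom_in[OF g z] by (auto simp: V_def)
      then show "f z = g z" using fun_cong[OF eq, of z] z by (simp add: compose_def n_def)
    qed
  qed
  have dest: "k \<in> Hom BGv W X" if "is_mono BGv W X k" for W k using that unfolding is_mono_def by blast
  have sub: "k ` fst W \<subseteq> l ` fst T" if le: "sub_le BGv X W k T l" for W k T l
  proof -
    obtain f where f: "f \<in> Hom BGv W T" "Cmp BGv W T X l f = k" using le unfolding sub_le_def by blast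
    have "k x = l (f x)" if "x \<in> fst W" for x using f(2) that by (auto simp: compose_def)
    then show ?thesis using BG_hom_in[OF f(1)] by auto
  qed
  have "complementary_subobjects BGv X U m V n"
    unfolding complementary_subobjects_def
  proof (intro conjI ballI allI impI)
    fix W k Z z assume W: "W \<in> Ob BGv" and k: "is_mono BGv W X k" and kU: "sub_le BGv X W k U m"
      and kV: "sub_le BGv X W k V n"
    have nV: "n ` fst V = C" by (auto simp: n_def V_def)
    have "x \<notin> fst W" for x
      using sub[OF kU] sub[OF kV, unfolded nV] unfolding C_def by blast
    then have e: "fst W = {}" by blast
    have "(\<lambda>_. undefined) \<in> Hom BGv W Z" unfolding BG_hom e by simp
    moreover have "Cmp BGv W Z X z (\<lambda>_. undefined) = k"
      using BG_hom_fun[OF dest[OF k]] unfolding e by (auto simp: compose_def e)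
    ultimately show "sub_le BGv X W k Z z" unfolding sub_le_def by blast
  next
    fix W k Z z assume W: "W \<in> Ob BGv" and k: "is_mono BGv W X k" and Uk: "sub_le BGv X U m W k"
      and Vk: "sub_le BGv X V n W k" and Z: "Z \<in> Ob BGv" and z: "is_mono BGv Z X z"
    have nV: "n ` fst V = C" by (auto simp: n_def V_def)
    have "fst X \<subseteq> k ` fst W"
      using sub[OF Uk] sub[OF Vk, unfolded nV] unfolding C_def by blast
    moreover have "k ` fst W \<subseteq> fst X" using BG_hom_in[OF dest[OF k]] by blast
    ultimately have "bij_betw k (fst W) (fst X)"
      using BG_mono_inj[OF W X k] by (auto simp: bij_betw_def)
    then have "is_iso BGv W X k" by (rule BG_isoI[OF W X dest[OF k]])
    then obtain s where s: "s \<in> Hom BGv X W" "Cmp BGv X W X k s = Ident BGv X" by (rule is_isoE)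
    have "Cmp BGv Z W X k (Cmp BGv Z X W s z) = z"
      using category_assoc[OF category_BG Z X W X dest[OF z] s(1) dest[OF k]] s(2)
        category_ident_left[OF category_BG Z X dest[OF z]] by simp
    then show "sub_le BGv X Z z W k"
      unfolding sub_le_def using category_cmp[OF category_BG Z X W dest[OF z] s(1)] by blast
  qed
  then show "\<exists>V\<in>Ob BGv. \<exists>n. is_mono BGv V X n \<and> complementary_subobjects BGv X U m V n"
    using V n by blast
qed

text \<open>The inverse image functor is the trivial action functor followed by the equivalence \<open>K\<close> to \<open>E\<close>; its
  adjoints on both sides are composites with \<open>F\<close>.\<close>

lemma equivalent_imp_connected_atomic:
  assumes eq: "equivalent_cat E BGv"
  shows "connected_atomic TYPE('v) E"
proof -
  obtain F where eqF: "equivalence_functor E BGv F"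
    using eq by (rule equivalent_cat_imp_equivalence_functor)
  interpret equivalence E BGv F by (rule equivalence.intro[OF eqF])
  obtain K where K: "is_functor BGv E K" and FK: "left_adjoint E BGv F K" and KF: "left_adjoint BGv E K F"
    and KFid: "naturally_iso E E (comp_fctr K F) id_fctr" and FKid: "naturally_iso BGv BGv (comp_fctr F K) id_fctr"
    by (rule equivalence_functor_inverse[OF eqF])
  note Ens = category_Ens and E = equivalence.C[OF equivalence.intro[OF eqF]] and Ff = equivalence.F[OF equivalence.intro[OF eqF]]
  define \<Delta> where "\<Delta> = comp_fctr K trivial_action"
  define \<Gamma> where "\<Gamma> = comp_fctr fixed_points F"
  define L where "L = comp_fctr orbit_reps F"
  have \<Delta>: "is_functor Ens E \<Delta>" unfolding \<Delta>_def by (rule is_functor_comp[OF trivial_action K])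
  have \<Gamma>: "is_functor E Ens \<Gamma>" unfolding \<Gamma>_def by (rule is_functor_comp[OF Ff fixed_points])
  have L: "is_functor E Ens L" unfolding L_def by (rule is_functor_comp[OF Ff orbit_reps])
  have adj: "left_adjoint Ens E \<Delta> \<Gamma>"
    unfolding \<Delta>_def \<Gamma>_def
    by (rule left_adjoint_comp[OF Ens category_BG E trivial_action fixed_points K Ff trivial_adjoint_fixed_points KF])
  have adjL: "left_adjoint E Ens L \<Delta>"
    unfolding \<Delta>_def L_def
    by (rule left_adjoint_comp[OF E category_BG Ens Ff K orbit_reps trivial_action FK orbits_adjoint_trivial])
  have lim: "preserves_finite_limits Ens E \<Delta>"
    by (rule right_adjoint_preserves_finite_limits[OF E Ens L \<Delta> adjL])
  define \<gamma> where "\<gamma> = \<lparr>inverse_image = \<Delta>, direct_image = \<Gamma>\<rparr>"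
  have \<gamma>: "geometric_morphism E Ens \<gamma>" "inverse_image \<gamma> = \<Delta>"
    using \<Delta> \<Gamma> adj lim by (simp_all add: geometric_morphism_def \<gamma>_def)
  have K_ff: "equivalence_functor BGv E K"
    by (rule quasi_inverse_imp_equivalence_functor[OF category_BG E K Ff FKid KFid])
  have "full_functor Ens E \<Delta>"
    unfolding full_functor_def
  proof (intro ballI subsetI)
    fix S T :: "'v set" and g assume S: "S \<in> Ob Ens" and T: "T \<in> Ob Ens" and g: "g \<in> Hom E (FOb \<Delta> S) (FOb \<Delta> T)"
    obtain f where f: "f \<in> Hom BGv (FOb trivial_action S) (FOb trivial_action T)"
      "FMor K (FOb trivial_action S) (FOb trivial_action T) f = g"
      using g K_ff functor_ob[OF trivial_action S] functor_ob[OF trivial_action T]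
      unfolding equivalence_functor_def full_functor_def \<Delta>_def comp_fctr_sel by blast
    then show "g \<in> FMor \<Delta> S T ` Hom Ens S T"
      by (auto simp: trivial_action_hom \<Delta>_def trivial_action_mor)
  qed
  moreover have "faithful_functor Ens \<Delta>"
    unfolding faithful_functor_def
  proof (intro ballI)
    fix S T :: "'v set" assume S: "S \<in> Ob Ens" and T: "T \<in> Ob Ens"
    have "inj_on (FMor K (FOb trivial_action S) (FOb trivial_action T)) (S \<rightarrow>\<^sub>E T)"
      using K_ff functor_ob[OF trivial_action S] functor_ob[OF trivial_action T]
      unfolding equivalence_functor_def faithful_functor_def trivial_action_hom[symmetric] by blast
    then show "inj_on (FMor \<Delta> S T) (Hom Ens S T)" by (simp add: inj_on_def \<Delta>_def trivial_action_mor)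
  qed
  ultimately show ?thesis
    unfolding connected_atomic_def connected_topos_def locally_connected_topos_def
    using \<gamma> L adjL boolean_topos[OF BG_boolean] by blast
qed

end

section \<open>The characterization\<close>

lemma grothendieck_topos_properties:
  fixes E :: "('o, 'm) cat"
  assumes univ: "universe TYPE('v)" and topos: "grothendieck_topos TYPE('v) E"
  shows "category E" "has_equalizers E" "has_pullbacks E" "has_strict_initial E" "glues_disjoint_covers E"
proof -
  obtain C :: "('v, 'v) cat" and J where C: "small_category C" and J: "grothendieck_topology C J"
    and eq: "equivalent_cat E (sheaf_cat C J)"
    using topos unfolding grothendieck_topos_def by blast
  interpret site C J
    by unfold_locales (use C J univ in \<open>simp_all add: small_category_def\<close>)
  obtain F where "equivalence_functor E Sh F" by (rule equivalent_cat_imp_equivalence_functor[OF eq])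
  then interpret equivalence E Sh F by (rule equivalence.intro)
  show "category E" using eq unfolding equivalent_cat_def by blast
  show "has_equalizers E" "has_pullbacks E" "has_strict_initial E" "glues_disjoint_covers E"
    by (rule has_equalizers[OF Sh_has_equalizers] has_pullbacks[OF Sh_has_pullbacks]
        has_strict_initial[OF Sh_has_strict_initial] glues_disjoint_covers[OF Sh_glues_disjoint_covers])+
qed

text \<open>The counit of the adjunction, transported along \<open>Hom A X \<cong> P X\<close>: by the Yoneda lemma it is
  enough to evaluate the transpose of \<open>y : A \<rightarrow> R S\<close> at the identity of \<open>A\<close>.\<close>

lemma represented_left_adjoint_universal:
  fixes E :: "('o, 'm) cat" and P :: "('o, 'm, 'v set, 'v \<Rightarrow> 'v) fctr"
  assumes E: "category E" and A: "A \<in> Ob E" and P: "is_functor E Ens P" and R: "is_functor Ens E R"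
    and adj: "left_adjoint E Ens P R" and rep: "represented_by E A P"
  obtains ev :: "'v set \<Rightarrow> 'm \<Rightarrow> 'v" where
    "\<forall>S y. small TYPE('v) S \<longrightarrow> y \<in> Hom E A (FOb R S) \<longrightarrow> ev S y \<in> S"
    "\<forall>S X h. small TYPE('v) S \<longrightarrow> X \<in> Ob E \<longrightarrow> h \<in> Hom E A X \<rightarrow> S \<longrightarrow>
      (\<exists>!t. t \<in> Hom E X (FOb R S) \<and> (\<forall>x\<in>Hom E A X. ev S (Cmp E A X (FOb R S) t x) = h x))"
proof -
  obtain \<Phi> where \<Phi>: "adjunction E Ens P R \<Phi>"
    using adj left_adjoint_iff_adjunction[OF E category_Ens P R] by blast
  obtain \<phi> where "\<forall>X\<in>Ob E. bij_betw (\<phi> X) (Hom E A X) (FOb P X)"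
    and "\<forall>X\<in>Ob E. \<forall>Y\<in>Ob E. \<forall>f\<in>Hom E X Y. \<forall>x\<in>Hom E A X. \<phi> Y (Cmp E A X Y f x) = FMor P X Y f (\<phi> X x)"
    using rep unfolding represented_by_def by blast
  note \<phi>_bij = this(1)[rule_format] and \<phi>_nat = this(2)[rule_format]
  have \<phi>_in: "\<phi> X x \<in> FOb P X" if "X \<in> Ob E" "x \<in> Hom E A X" for X x
    using \<phi>_bij[OF that(1)] that(2) by (auto simp: bij_betw_def)
  note idA = category_ident[OF E A]
  define ev where "ev S y = inv_into (FOb P A \<rightarrow>\<^sub>E S) (\<Phi> A S) y (\<phi> A (Ident E A))" for S y
  have ev_\<Phi>: "ev S (\<Phi> A S k) = k (\<phi> A (Ident E A))" if "small TYPE('v) S" "k \<in> FOb P A \<rightarrow>\<^sub>E S" for S k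
    using inv_into_f_f[OF bij_betw_imp_inj_on[OF adjunction_bij[OF \<Phi> A, of S]], of k] that
    by (simp add: ev_def)
  have ev_app: "ev S (Cmp E A X (FOb R S) (\<Phi> X S k) x) = k (\<phi> X x)"
    if S: "small TYPE('v) S" and X: "X \<in> Ob E" and k: "k \<in> FOb P X \<rightarrow>\<^sub>E S" and x: "x \<in> Hom E A X" for S X k x
  proof -
    have Px: "FMor P A X x \<in> FOb P A \<rightarrow>\<^sub>E FOb P X" using functor_mor[OF P A X x] by simp
    have "Cmp E A X (FOb R S) (\<Phi> X S k) x = \<Phi> A S (compose (FOb P A) k (FMor P A X x))"
      using adjunction_pre[OF \<Phi> X A _ x, of S k] S k by simp
    moreover have "compose (FOb P A) k (FMor P A X x) \<in> FOb P A \<rightarrow>\<^sub>E S"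
      using k Px by (auto simp: compose_def)
    ultimately have "ev S (Cmp E A X (FOb R S) (\<Phi> X S k) x) = k (FMor P A X x (\<phi> A (Ident E A)))"
      using ev_\<Phi>[OF S] \<phi>_in[OF A idA] by (simp add: compose_def)
    also have "FMor P A X x (\<phi> A (Ident E A)) = \<phi> X x"
      using \<phi>_nat[OF A X x idA] category_ident_right[OF E A X x] by simp
    finally show ?thesis .
  qed
  have ev_in: "ev S y \<in> S" if S: "small TYPE('v) S" and y: "y \<in> Hom E A (FOb R S)" for S y
  proof -
    have "S \<in> Ob Ens" using S by simp
    then obtain k where k: "k \<in> Hom Ens (FOb P A) S" "\<Phi> A S k = y" by (rule adjunction_surjE[OF \<Phi> A _ y])
    then show ?thesis using ev_\<Phi>[OF S, of k] \<phi>_in[OF A idA] by auto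
  qed
  have univ: "\<exists>!t. t \<in> Hom E X (FOb R S) \<and> (\<forall>x\<in>Hom E A X. ev S (Cmp E A X (FOb R S) t x) = h x)"
    if S: "small TYPE('v) S" and X: "X \<in> Ob E" and h: "h \<in> Hom E A X \<rightarrow> S" for S X h
  proof -
    define \<rho> where "\<rho> = inv_into (Hom E A X) (\<phi> X)"
    have \<rho>: "\<rho> y \<in> Hom E A X" "\<phi> X (\<rho> y) = y" if "y \<in> FOb P X" for y
    proof -
      have "y \<in> \<phi> X ` Hom E A X" using that bij_betw_imp_surj_on[OF \<phi>_bij[OF X]] by simp
      then show "\<rho> y \<in> Hom E A X" "\<phi> X (\<rho> y) = y"
        unfolding \<rho>_def by (simp_all add: inv_into_into f_inv_into_f)
    qed
    have \<rho>\<phi>: "\<rho> (\<phi> X x) = x" if "x \<in> Hom E A X" for x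
      unfolding \<rho>_def by (rule inv_into_f_f[OF bij_betw_imp_inj_on[OF \<phi>_bij[OF X]] that])
    define k where "k = (\<lambda>y\<in>FOb P X. h (\<rho> y))"
    have k: "k \<in> FOb P X \<rightarrow>\<^sub>E S" unfolding k_def using h \<rho> by auto
    have S': "S \<in> Ob Ens" using S by simp
    show ?thesis
    proof (rule ex1I[of _ "\<Phi> X S k"], intro conjI ballI)
      show "\<Phi> X S k \<in> Hom E X (FOb R S)" using adjunction_in[OF \<Phi> X S', of k] k by simp
      show "ev S (Cmp E A X (FOb R S) (\<Phi> X S k) x) = h x" if "x \<in> Hom E A X" for x
        using ev_app[OF S X k that] \<phi>_in[OF X that] \<rho>\<phi>[OF that] by (simp add: k_def)
      fix t assume t: "t \<in> Hom E X (FOb R S) \<and> (\<forall>x\<in>Hom E A X. ev S (Cmp E A X (FOb R S) t x) = h x)"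
      then obtain l where l: "l \<in> Hom Ens (FOb P X) S" "\<Phi> X S l = t"
        using adjunction_surjE[OF \<Phi> X S', of t] by blast
      have l': "l \<in> FOb P X \<rightarrow>\<^sub>E S" using l(1) by simp
      have "l = k"
      proof (rule PiE_ext[OF l' k])
        fix y assume y: "y \<in> FOb P X"
        show "l y = k y"
          using ev_app[OF S X l' \<rho>(1)[OF y]] bspec[OF conjunct2[OF t] \<rho>(1)[OF y]] l(2) \<rho>(2)[OF y] y
          by (simp add: k_def)
      qed
      then show "t = \<Phi> X S k" using l(2) by simp
    qed
  qed
  show thesis by (rule that[of ev]) (use ev_in univ in blast)+
qed

theorem theoremA:
  fixes E :: "('o, 'm) cat" and A :: 'o and p :: "('v set, 'v \<Rightarrow> 'v, 'o, 'm) geom"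
  assumes "universe TYPE('v)"
    and "grothendieck_topos TYPE('v) E"
    and "is_point E p"
    and "A \<in> Ob E"
    and "represented_by E A (inverse_image p)"
  shows "(connected_atomic TYPE('v) E \<longleftrightarrow>
            (\<exists>G :: 'v monoid. group G \<and> small TYPE('v) (carrier G) \<and>
               equivalent_cat E
                 (classifying_topos G :: ('v set \<times> ('v \<Rightarrow> 'v \<Rightarrow> 'v), 'v \<Rightarrow> 'v) cat))) \<and>
         (connected_atomic TYPE('v) E \<longrightarrow>
            group (Aut_op E A) \<and> small TYPE('v) (carrier (Aut_op E A)) \<and>
            equivalent_cat E
              (classifying_topos (Aut_op E A) :: ('v set \<times> ('m \<Rightarrow> 'v \<Rightarrow> 'v), 'v \<Rightarrow> 'v) cat))"
proof -
  note univ = assms(1) and A = assms(4) and rep = assms(5)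
  note topos = grothendieck_topos_properties[OF assms(1,2)]
  have P: "is_functor E Ens (inverse_image p)" and R: "is_functor Ens E (direct_image p)"
    and adj: "left_adjoint E Ens (inverse_image p) (direct_image p)"
    using assms(3) unfolding is_point_def geometric_morphism_def by auto
  obtain ev :: "'v set \<Rightarrow> 'm \<Rightarrow> 'v" where ev:
    "\<forall>S y. small TYPE('v) S \<longrightarrow> y \<in> Hom E A (FOb (direct_image p) S) \<longrightarrow> ev S y \<in> S"
    "\<forall>S X h. small TYPE('v) S \<longrightarrow> X \<in> Ob E \<longrightarrow> h \<in> Hom E A X \<rightarrow> S \<longrightarrow>
      (\<exists>!t. t \<in> Hom E X (FOb (direct_image p) S) \<and>
         (\<forall>x\<in>Hom E A X. ev S (Cmp E A X (FOb (direct_image p) S) t x) = h x))"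
    by (rule represented_left_adjoint_universal[OF topos(1) A P R adj rep])
  have pts_small: "small TYPE('v) (Hom E A X)" if X: "X \<in> Ob E" for X
  proof -
    obtain \<phi> where "bij_betw \<phi> (Hom E A X) (FOb (inverse_image p) X)"
      using rep X unfolding represented_by_def by blast
    then have "Hom E A X \<approx> FOb (inverse_image p) X" unfolding eqpoll_def by blast
    then show ?thesis
      using functor_ob[OF P X] unfolding small_def Ens_sel by (auto intro: eq_lesspoll_trans)
  qed
  have main: "group (Aut_op E A) \<and> small TYPE('v) (carrier (Aut_op E A)) \<and>
      equivalent_cat E (classifying_topos (Aut_op E A) :: ('v set \<times> ('m \<Rightarrow> 'v \<Rightarrow> 'v), 'v \<Rightarrow> 'v) cat) \<and>
      (\<exists>G :: 'v monoid. group G \<and> small TYPE('v) (carrier G) \<and>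
         equivalent_cat E (classifying_topos G :: ('v set \<times> ('v \<Rightarrow> 'v \<Rightarrow> 'v), 'v \<Rightarrow> 'v) cat))"
    if ca: "connected_atomic TYPE('v) E"
  proof -
    interpret representable_point E A "FOb (direct_image p)" ev
    proof
      show "FOb (direct_image p) S \<in> Ob E" if "small TYPE('v) S" for S :: "'v set"
        using functor_ob[OF R, of S] that by simp
      show "boolean_topos E" using ca unfolding connected_atomic_def by blast
    qed (use univ topos A pts_small ev in blast)+
    interpret conservative_point E A "FOb (direct_image p)" ev
    proof
      show "initial_object E V" if "V \<in> Ob E" "Hom E A V = {}" for V
        using connected_no_points_initial[OF _ topos(5) that] ca unfolding connected_atomic_def by blast
    qed
    have sm: "small TYPE('v) (carrier (Aut_op E A))" unfolding Aut_op_carrier by (rule pts_small[OF A])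
    have "equivalent_cat E (classifying_topos (Aut_op E A) :: ('v set \<times> ('m \<Rightarrow> 'v \<Rightarrow> 'v), 'v \<Rightarrow> 'v) cat)"
    proof (rule equivalent_to_gsets[OF P rep group_Aut_op])
      show "(\<lambda>x. x) \<in> iso (Aut_op E A) (Aut_op E A)" by (simp add: iso_def hom_def bij_betw_def)
    qed
    moreover have "\<exists>G :: 'v monoid. group G \<and> small TYPE('v) (carrier G) \<and>
         equivalent_cat E (classifying_topos G :: ('v set \<times> ('v \<Rightarrow> 'v \<Rightarrow> 'v), 'v \<Rightarrow> 'v) cat)"
    proof -
      have "carrier (Aut_op E A) \<lesssim> (UNIV :: 'v set)"
        using sm unfolding small_def by (rule lesspoll_imp_lepoll)
      then obtain j :: "'m \<Rightarrow> 'v" where j: "inj_on j (carrier (Aut_op E A))" unfolding lepoll_def by blast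
      obtain G :: "'v monoid" and \<iota> where G: "group G" "carrier G = j ` carrier (Aut_op E A)"
        and \<iota>: "\<iota> \<in> iso G (Aut_op E A)"
        by (rule group_transport[OF group_Aut_op j])
      have "small TYPE('v) (carrier G)" unfolding G(2) by (rule small_image[OF sm])
      then show ?thesis using G(1) equivalent_to_gsets[OF P rep G(1) \<iota>] by blast
    qed
    ultimately show ?thesis using group_Aut_op sm by blast
  qed
  have "connected_atomic TYPE('v) E"
    if G: "group G" "small TYPE('v) (carrier G)" and eq: "equivalent_cat E
         (classifying_topos G :: ('v set \<times> ('v \<Rightarrow> 'v \<Rightarrow> 'v), 'v \<Rightarrow> 'v) cat)" for G :: "'v monoid"
  proof -
    interpret small_group G by (intro small_group.intro gsets.intro small_group_axioms.intro G)
    show ?thesis by (rule equivalent_imp_connected_atomic[OF eq])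
  qed
  then show ?thesis using main by blast
qed

end
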